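(* Let $(f,I,\mu)$ be a system as described in the context. There exist $c_1,c_2,c_3>0$ such that for each sufficiently small Markov interval $A\subset I$ (that is, there is $r_0>0$ such that for every Markov interval $A\subset I$ of diameter less than $r_0$), for any $0<\eta<\frac{c_1}{\mu(A)}$ and any $n\in\mathbb{N}$, $$\mu\left(\mathcal{H}_A^{n}\ge n\left(\frac1{\mu(A)}+\eta\right)\right)\;\le\; c_3\,e^{-c_2\,\eta^2\mu(A)^2\,n}.$$
   Context: Setting. $I\subset\mathbb{R}$ is an interval with a finite partition $\mathcal{P}$ into intervals, and $f:I\to\mathbb{R}$ is a map such that for each $P\in\mathcal{P}$ the restriction $f:P\to I$ is $C^2$, uniformly expanding, and extends continuously to $\overline P$ so that $f:\overline P\to I$ is a diffeomorphism (full branches). For $n\in\mathbb{N}$ let $\mathcal{P}_n=\bigvee_{i=0}^{n-1}f^{-i}\mathcal{P}$, whose elements are called $n$-cylinders, and assume bounded distortion: $\sup_n\sup_{P\in\mathcal{P}_n}\sup_{x,y\in P}|Df^n(x)|/|Df^n(y)|<\infty$. (Boundary points of cylinders have measure zero and are ignored.) $\phi:I\to\mathbb{R}$ is a potential that is Hölder on each $P\in\mathcal{P}$, with $S_n\phi=\sum_{i=0}^{n-1}\phi\circ f^i$ and pressure $P(\phi)=\lim_{n\to\infty}\frac1n\log\sum_{f^nx=x}e^{S_n\phi(x)}$; replacing $\phi$ by $\phi-P(\phi)$ we assume $P(\phi)=0$. $\mu=\mu_\phi$ is the unique $f$-invariant Gibbs probability measure for $\phi$: there is $0<C<\infty$ with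 $\frac1C\le \mu(P)/e^{S_n\phi(x)}\le C$ for all $n$, $P\in\mathcal{P}_n$, $x\in P$. The measure $\mu$ is fully supported on $I$. An interval $A\subset I$ is Markov if, for some $k\in\mathbb{N}$, it is a union of $k$-cylinders. For such $A$, $\mathcal{H}_A(x)=\min\{k\ge1:f^k(x)\in A\}$ is the first hitting time, and $\mathcal{H}_A^n(x)$ is the $n$th hitting time, i.e. the $n$th smallest $k\ge1$ with $f^k(x)\in A$. *)

theory Defs
  imports "HOL-Probability.Probability"
begin

section \<open>Full-branched interval maps\<close>

text \<open>
  Derivatives are relative to the set \<open>S\<close>, i.e. one-sided at endpoints belonging to \<open>S\<close>:
  the map need not be continuous across the boundary of a partition element.
\<close>

fun C_k_on :: "nat \<Rightarrow> real set \<Rightarrow> (real \<Rightarrow> real) \<Rightarrow> bool" where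
  "C_k_on 0 S g \<longleftrightarrow> continuous_on S g"
| "C_k_on (Suc k) S g \<longleftrightarrow>
     (\<exists>D. (\<forall>x\<in>S. (g has_real_derivative D x) (at x within S)) \<and> C_k_on k S D)"

definition diffeomorphism_on :: "real set \<Rightarrow> real set \<Rightarrow> (real \<Rightarrow> real) \<Rightarrow> bool" where
  "diffeomorphism_on S T g \<longleftrightarrow>
     bij_betw g S T \<and> C_k_on 1 S g \<and> C_k_on 1 T (the_inv_into S g)"

abbreviation deriv_within :: "real set \<Rightarrow> (real \<Rightarrow> real) \<Rightarrow> real \<Rightarrow> real" where
  "deriv_within S g x \<equiv> vector_derivative g (at x within S)"

text \<open>
  \<open>I\<close> is a nondegenerate interval. The partition is a genuine set-theoretic one, so every
  boundary point is assigned to exactly one element. \<open>g\<close> is the continuous extension of a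
  branch to the closure of its domain.
\<close>

definition full_branched_map :: "real set \<Rightarrow> real set set \<Rightarrow> (real \<Rightarrow> real) \<Rightarrow> bool" where
  "full_branched_map I \<P> f \<longleftrightarrow>
     is_interval I \<and> interior I \<noteq> {} \<and>
     finite \<P> \<and> partition_on I \<P> \<and> (\<forall>P\<in>\<P>. is_interval P) \<and>
     (\<forall>P\<in>\<P>. C_k_on 2 P f) \<and>
     (\<exists>\<gamma>>1. \<forall>P\<in>\<P>. \<forall>x\<in>P. \<bar>deriv_within P f x\<bar> \<ge> \<gamma>) \<and>
     (\<forall>P\<in>\<P>. \<exists>g. (\<forall>x\<in>P. g x = f x) \<and> diffeomorphism_on (closure P) I g)"

text \<open>The nonempty elements of the join of the partitions \<open>f\<^sup>-\<^sup>i \<P>\<close>, \<open>i < n\<close>.\<close>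

definition cylinders :: "real set \<Rightarrow> real set set \<Rightarrow> (real \<Rightarrow> real) \<Rightarrow> nat \<Rightarrow> real set set" where
  "cylinders I \<P> f n =
     {Q. Q \<noteq> {} \<and> (\<exists>p. (\<forall>i<n. p i \<in> \<P>) \<and> Q = {x\<in>I. \<forall>i<n. (f ^^ i) x \<in> p i})}"

definition bounded_distortion :: "real set \<Rightarrow> real set set \<Rightarrow> (real \<Rightarrow> real) \<Rightarrow> bool" where
  "bounded_distortion I \<P> f \<longleftrightarrow>
     (\<exists>K. \<forall>n\<ge>1. \<forall>Q\<in>cylinders I \<P> f n. \<forall>x\<in>Q. \<forall>y\<in>Q.
        \<bar>deriv_within Q (f ^^ n) x\<bar> / \<bar>deriv_within Q (f ^^ n) y\<bar> \<le> K)"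

section \<open>Potentials and Gibbs measures\<close>

definition holder_on :: "real set \<Rightarrow> (real \<Rightarrow> real) \<Rightarrow> bool" where
  "holder_on S \<phi> \<longleftrightarrow>
     (\<exists>\<alpha> K. 0 < \<alpha> \<and> \<alpha> \<le> 1 \<and> (\<forall>x\<in>S. \<forall>y\<in>S. \<bar>\<phi> x - \<phi> y\<bar> \<le> K * \<bar>x - y\<bar> powr \<alpha>))"

definition birkhoff_sum :: "(real \<Rightarrow> real) \<Rightarrow> (real \<Rightarrow> real) \<Rightarrow> nat \<Rightarrow> real \<Rightarrow> real" where
  "birkhoff_sum f \<phi> n x = (\<Sum>i<n. \<phi> ((f ^^ i) x))"

definition has_pressure :: "real set \<Rightarrow> (real \<Rightarrow> real) \<Rightarrow> (real \<Rightarrow> real) \<Rightarrow> real \<Rightarrow> bool" where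
  "has_pressure I f \<phi> p \<longleftrightarrow>
     (\<lambda>n. 1 / real n * ln (\<Sum>x\<in>{x\<in>I. (f ^^ n) x = x}. exp (birkhoff_sum f \<phi> n x)))
       \<longlonglongrightarrow> p"

definition invariant_measure :: "(real \<Rightarrow> real) \<Rightarrow> real measure \<Rightarrow> bool" where
  "invariant_measure f \<mu> \<longleftrightarrow> f \<in> measurable \<mu> \<mu> \<and> distr \<mu> \<mu> f = \<mu>"

definition gibbs_measure ::
  "real set \<Rightarrow> real set set \<Rightarrow> (real \<Rightarrow> real) \<Rightarrow> (real \<Rightarrow> real) \<Rightarrow> real measure \<Rightarrow> bool" where
  "gibbs_measure I \<P> f \<phi> \<mu> \<longleftrightarrow>
     (\<exists>C>0. \<forall>n\<ge>1. \<forall>Q\<in>cylinders I \<P> f n. \<forall>x\<in>Q.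
        1 / C \<le> measure \<mu> Q / exp (birkhoff_sum f \<phi> n x) \<and>
        measure \<mu> Q / exp (birkhoff_sum f \<phi> n x) \<le> C)"

definition fully_supported_on :: "real set \<Rightarrow> real measure \<Rightarrow> bool" where
  "fully_supported_on I \<mu> \<longleftrightarrow> (\<forall>U. open U \<and> U \<inter> I \<noteq> {} \<longrightarrow> measure \<mu> (U \<inter> I) > 0)"

section \<open>Markov intervals and hitting times\<close>

definition markov_interval ::
  "real set \<Rightarrow> real set set \<Rightarrow> (real \<Rightarrow> real) \<Rightarrow> real set \<Rightarrow> bool" where
  "markov_interval I \<P> f A \<longleftrightarrow>
     A \<noteq> {} \<and> is_interval A \<and> (\<exists>k\<ge>1. \<exists>\<Q>\<subseteq>cylinders I \<P> f k. A = \<Union>\<Q>)"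

text \<open>
  The time \<open>k\<close> is the \<open>n\<close>th smallest hitting time if it is a hitting time and there are
  exactly \<open>n\<close> hitting times in \<open>{1..k}\<close>. The value is \<open>\<infinity>\<close> if the orbit hits \<open>A\<close> fewer than
  \<open>n\<close> times.
\<close>

definition hitting_time :: "(real \<Rightarrow> real) \<Rightarrow> real set \<Rightarrow> nat \<Rightarrow> real \<Rightarrow> enat" where
  "hitting_time f A n x =
     Inf (enat ` {k. k \<ge> 1 \<and> (f ^^ k) x \<in> A \<and> card {j\<in>{1..k}. (f ^^ j) x \<in> A} = n})"

end

theory Submission
  imports Defs
begin

text \<open>
  Write \<open>p = \<mu> A\<close> and \<open>\<epsilon> = \<eta> p\<close>. If the \<open>n\<close>th hitting time is at least \<open>n (1/p + \<eta>)\<close>, then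
  among the first \<open>T\<close> iterates, where \<open>p T\<close> is \<open>n (1 + \<epsilon>)\<close> up to rounding, fewer than \<open>n\<close> lie in
  \<open>A\<close>. The claim is thus a lower-tail estimate for a sum of \<open>T\<close> dependent indicators of
  probability \<open>p\<close>, and the point is that its variance must be of the order \<open>p T\<close>, not \<open>T\<close>, with a
  constant that does not depend on \<open>A\<close>.

  The orbit is read backwards in time. Let \<open>L\<close> be the transfer operator of \<open>\<mu>\<close>, so that
  \<open>L\<^sup>i 1\<^sub>A\<close> is the conditional probability of being in \<open>A\<close> given the future from time \<open>i\<close> on. An
  interval \<open>A\<close> is, for every \<open>m\<close>, a union of \<open>m\<close>-cylinders up to at most two of them
  (\<open>card_cut_words\<close>), these have exponentially small measure (\<open>cylinder_decay\<close>), and on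
  cylinders \<open>\<mu>\<close> mixes exponentially (\<open>exponential_mixing\<close>). Splitting \<open>i\<close> steps into two halves
  gives \<open>|L\<^sup>i 1\<^sub>A - p| \<le> D \<rho>\<^sup>i\<close> in the supremum norm, uniformly in \<open>A\<close> (\<open>hitting_decay\<close>). Hence
  \<open>u = - \<Sum>\<^sub>i\<^sub>\<ge>\<^sub>1 (L\<^sup>i 1\<^sub>A - p)\<close> is bounded independently of \<open>A\<close> and solves
  \<open>L u = u - p + L 1\<^sub>A\<close> (\<open>poisson_solution\<close>). For small \<open>s\<close>, a function \<open>H = 1 + \<sigma> u\<close> with
  \<open>\<sigma> = s - O(s\<^sup>2)\<close> satisfies \<open>L (exp (- s 1\<^sub>A) H) \<le> exp (- p (s - \<gamma> s\<^sup>2)) H\<close> (\<open>supersolution\<close>);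
  iterating this \<open>T\<close> times bounds the Laplace transform of the number of hits, and the
  exponential Markov inequality with \<open>s\<close> proportional to \<open>\<epsilon>\<close> yields the tail \<open>few_hits_tail\<close>.

  It remains to see why \<open>\<mu>\<close> mixes exponentially although it is only known through the Gibbs
  inequalities. Everything is expressed through the numbers \<open>M w = \<mu> (cylinder of w)\<close>, for words
  \<open>w\<close> over the alphabet \<open>\<P>\<close>. A conformal measure \<open>m\<close> for the potential is a limit of
  discounted sums of \<open>exp\<close> of Birkhoff sums; the distortion of these sums makes the Jacobians of
  \<open>m\<close> log-Hoelder (\<open>conformal_measure_exists\<close>). The Gibbs inequalities give
  \<open>m/C \<le> M \<le> C m\<close>. As \<open>M\<close> is invariant, it is a limit of mixtures of push-forwards of
  restrictions of \<open>m\<close> to cylinders, so its density with respect to \<open>m\<close> is log-Hoelder too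
  (\<open>invariant_log_regular\<close>), and therefore the Jacobians of \<open>M\<close> itself are
  (\<open>quasi_bernoulli\<close>). Pushing a log-Hoelder density forward improves its regularity, which leaves
  room to split off a fixed proportion of \<open>M\<close> at every step (\<open>push_contracts\<close>).
\<close>

section \<open>Words\<close>

definition words :: "'a set \<Rightarrow> nat \<Rightarrow> 'a list set" where
  "words X n = {w \<in> lists X. length w = n}"

lemma words_0 [simp]: "words X 0 = {[]}"
  by (auto simp: words_def)

lemma finite_words [simp]: "finite X \<Longrightarrow> finite (words X n)"
  using finite_lists_length_eq[of X n] by (simp add: words_def lists_eq_set)

lemma wordsD: "w \<in> words X n \<Longrightarrow> w \<in> lists X" "w \<in> words X n \<Longrightarrow> length w = n"
  by (auto simp: words_def)

lemma sum_words_append: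
  "(\<Sum>w\<in>words X (m + n). F w) = (\<Sum>u\<in>words X m. \<Sum>v\<in>words X n. F (u @ v))"
proof -
  have "bij_betw (\<lambda>(u, v). u @ v) (words X m \<times> words X n) (words X (m + n))"
    by (rule bij_betwI[where g = "\<lambda>w. (take m w, drop m w)"])
       (auto simp: words_def in_lists_conv_set dest: in_set_takeD in_set_dropD)
  then have "(\<Sum>w\<in>words X (m + n). F w) = (\<Sum>z\<in>words X m \<times> words X n. F (case z of (u, v) \<Rightarrow> u @ v))"
    by (rule sum.reindex_bij_betw[symmetric])
  then show ?thesis by (simp add: sum.cartesian_product split_def)
qed

lemma sum_words_1: "(\<Sum>w\<in>words X (Suc 0). F w) = (\<Sum>p\<in>X. F [p])"
proof -
  have "bij_betw (\<lambda>p. [p]) X (words X (Suc 0))"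
    by (rule bij_betwI[where g = hd]) (auto simp: words_def length_Suc_conv)
  then show ?thesis by (rule sum.reindex_bij_betw[symmetric])
qed

lemma sum_words_Cons: "(\<Sum>w\<in>words X (Suc n). F w) = (\<Sum>v\<in>words X n. \<Sum>p\<in>X. F (p # v))"
  using sum_words_append[of F X "Suc 0" n] by (simp add: sum_words_1 sum.swap[of _ X])

lemma sum_words_snoc: "(\<Sum>w\<in>words X (Suc n). F w) = (\<Sum>v\<in>words X n. \<Sum>p\<in>X. F (v @ [p]))"
  using sum_words_append[of F X n "Suc 0"] by (simp add: sum_words_1)

section \<open>Log-regular functions of words\<close>

definition additive_on_words :: "'a set \<Rightarrow> ('a list \<Rightarrow> real) \<Rightarrow> bool" where
  "additive_on_words X \<nu> \<longleftrightarrow> (\<forall>w\<in>lists X. \<nu> w = (\<Sum>p\<in>X. \<nu> (w @ [p])))"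

text \<open>
  The density of \<open>\<nu>\<close> with respect to \<open>m\<close>, on the scale of finite words the quotient \<open>\<nu> w / m w\<close>,
  varies by a factor of at most \<open>exp (K \<theta>\<^sup>n)\<close> inside a cylinder of length \<open>n\<close>. The product form
  passes to nonnegative combinations and to limits. For \<open>w = []\<close> it compares \<open>\<nu>\<close> with a
  multiple of \<open>m\<close> from both sides.
\<close>

definition log_regular ::
    "'a set \<Rightarrow> ('a list \<Rightarrow> real) \<Rightarrow> real \<Rightarrow> real \<Rightarrow> ('a list \<Rightarrow> real) \<Rightarrow> bool" where
  "log_regular X m K \<theta> \<nu> \<longleftrightarrow>
     (\<forall>w\<in>lists X. \<forall>u\<in>lists X. \<forall>v\<in>lists X.
        \<nu> (w @ u) * m (w @ v) \<le> exp (K * \<theta> ^ length w) * (\<nu> (w @ v) * m (w @ u)))"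

lemma additive_words:
  assumes "additive_on_words X \<nu>" "w \<in> lists X"
  shows "(\<Sum>v\<in>words X n. \<nu> (w @ v)) = \<nu> w"
proof (induction n)
  case (Suc n)
  have "(\<Sum>v\<in>words X (Suc n). \<nu> (w @ v)) = (\<Sum>v\<in>words X n. \<Sum>p\<in>X. \<nu> ((w @ v) @ [p]))"
    by (simp add: sum_words_snoc)
  also have "\<dots> = (\<Sum>v\<in>words X n. \<nu> (w @ v))"
    using assms by (intro sum.cong refl) (simp add: additive_on_words_def wordsD)
  finally show ?case using Suc by simp
qed simp

lemma log_regularD:
  assumes "log_regular X m K \<theta> \<nu>" "w \<in> lists X" "u \<in> lists X" "v \<in> lists X"
  shows "\<nu> (w @ u) * m (w @ v) \<le> exp (K * \<theta> ^ length w) * (\<nu> (w @ v) * m (w @ u))"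
  using assms by (auto simp: log_regular_def)

lemma log_regular_mono:
  assumes "log_regular X m K \<theta> \<nu>" "K \<le> K'" "0 \<le> \<theta>"
    and "\<And>w. w \<in> lists X \<Longrightarrow> 0 \<le> \<nu> w" "\<And>w. w \<in> lists X \<Longrightarrow> 0 \<le> m w"
  shows "log_regular X m K' \<theta> \<nu>"
  unfolding log_regular_def
proof (intro ballI)
  fix w u v assume w: "w \<in> lists X" "u \<in> lists X" "v \<in> lists X"
  have "\<nu> (w @ u) * m (w @ v) \<le> exp (K * \<theta> ^ length w) * (\<nu> (w @ v) * m (w @ u))"
    by (rule log_regularD[OF assms(1) w])
  also have "\<dots> \<le> exp (K' * \<theta> ^ length w) * (\<nu> (w @ v) * m (w @ u))"
    using assms w by (intro mult_right_mono) (auto intro: mult_right_mono)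
  finally show "\<nu> (w @ u) * m (w @ v) \<le> exp (K' * \<theta> ^ length w) * (\<nu> (w @ v) * m (w @ u))" .
qed

lemma log_regular_sum:
  assumes "\<And>q. q \<in> Q \<Longrightarrow> log_regular X m K \<theta> (\<nu> q)" "\<And>q. q \<in> Q \<Longrightarrow> 0 \<le> c q"
  shows "log_regular X m K \<theta> (\<lambda>w. \<Sum>q\<in>Q. c q * \<nu> q w)"
  unfolding log_regular_def
proof (intro ballI)
  fix w u v assume w: "w \<in> lists X" "u \<in> lists X" "v \<in> lists X"
  have "(\<Sum>q\<in>Q. c q * (\<nu> q (w @ u) * m (w @ v)))
      \<le> (\<Sum>q\<in>Q. c q * (exp (K * \<theta> ^ length w) * (\<nu> q (w @ v) * m (w @ u))))"
    using assms log_regularD[OF assms(1) w] by (intro sum_mono mult_left_mono) auto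
  then show "(\<Sum>q\<in>Q. c q * \<nu> q (w @ u)) * m (w @ v)
      \<le> exp (K * \<theta> ^ length w) * ((\<Sum>q\<in>Q. c q * \<nu> q (w @ v)) * m (w @ u))"
    by (simp add: sum_distrib_left sum_distrib_right mult_ac)
qed

section \<open>A conformal measure by discounted summation\<close>

text \<open>
  Tychonoff compactness of a product of intervals, phrased with a finer filter along which all
  coordinates converge at once; the index set of the coordinates need not be countable, so
  diagonal subsequences are not an option.
\<close>

lemma simultaneous_limit:
  fixes g :: "'i \<Rightarrow> 'b \<Rightarrow> real"
  assumes "F \<noteq> bot" and "eventually (\<lambda>i. \<forall>w. g i w \<in> {l..u}) F"
  obtains G m where "G \<le> F" "G \<noteq> bot" "\<And>w. ((\<lambda>i. g i w) \<longlongrightarrow> m w) G"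
proof -
  let ?U = "PiE UNIV (\<lambda>_::'b. {l..u})"
  have "compactin (product_topology (\<lambda>_. euclidean) UNIV) ?U"
    by (subst compactin_PiE) auto
  then have "compact ?U"
    by (simp add: euclidean_product_topology)
  moreover have "eventually (\<lambda>x. x \<in> ?U) (filtermap g F)"
    using assms(2) by (simp add: eventually_filtermap PiE_UNIV_domain Pi_iff)
  moreover have "filtermap g F \<noteq> bot"
    using assms(1) by (simp add: filtermap_bot_iff)
  ultimately obtain m where m: "inf (nhds m) (filtermap g F) \<noteq> bot"
    unfolding compact_filter by meson
  define G where "G = inf F (filtercomap g (nhds m))"
  have "G \<noteq> bot"
  proof
    assume "G = bot"
    then have "eventually (\<lambda>_. False) G" by simp
    then obtain P Q where PQ: "eventually P F" "eventually Q (filtercomap g (nhds m))"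
      "\<And>i. P i \<Longrightarrow> Q i \<Longrightarrow> False"
      unfolding G_def eventually_inf by blast
    obtain Q' where Q': "eventually Q' (nhds m)" "\<And>i. Q' (g i) \<Longrightarrow> Q i"
      using PQ(2) unfolding eventually_filtercomap by blast
    have "eventually (\<lambda>y. \<not> Q' y) (filtermap g F)"
      unfolding eventually_filtermap using PQ(1) by (rule eventually_mono) (use PQ(3) Q'(2) in blast)
    then have "eventually (\<lambda>_. False) (inf (nhds m) (filtermap g F))"
      unfolding eventually_inf using Q'(1) by blast
    then show False using m by (simp add: eventually_False)
  qed
  moreover have "((\<lambda>i. g i w) \<longlongrightarrow> m w) G" for w
  proof -
    have "(g \<longlongrightarrow> m) (filtercomap g (nhds m))" by (rule filterlim_filtercomap)
    then have "(g \<longlongrightarrow> m) G"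
      by (rule tendsto_mono[rotated]) (simp add: G_def)
    moreover have "continuous_on UNIV (\<lambda>x::'b \<Rightarrow> real. x w)" by simp
    ultimately show ?thesis
      using continuous_on_tendsto_compose[of UNIV "\<lambda>x::'b \<Rightarrow> real. x w" g m G] by simp
  qed
  ultimately show ?thesis by (intro that[of G m]) (auto simp: G_def)
qed

lemma suminf_product_le:
  fixes x y z t :: "nat \<Rightarrow> real"
  assumes "summable x" "summable y" "summable z" "summable t"
    and le: "\<And>i j. x i * y j \<le> c * (z j * t i)"
  shows "suminf x * suminf y \<le> c * (suminf z * suminf t)"
proof -
  have 1: "suminf x * y j \<le> c * (z j * suminf t)" for j
  proof -
    have "suminf x * y j = (\<Sum>i. x i * y j)" using assms by (intro suminf_mult2)
    also have "\<dots> \<le> (\<Sum>i. (c * z j) * t i)"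
      using assms le[of _ j] by (intro suminf_le summable_mult2 summable_mult) (auto simp: mult_ac)
    also have "\<dots> = (c * z j) * suminf t" using assms by (intro suminf_mult)
    also have "\<dots> = c * (z j * suminf t)" by simp
    finally show ?thesis .
  qed
  have "suminf x * suminf y = (\<Sum>j. suminf x * y j)" using assms by (simp add: suminf_mult)
  also have "\<dots> \<le> (\<Sum>j. (c * suminf t) * z j)"
    using assms 1 by (intro suminf_le summable_mult) (auto simp: mult_ac)
  also have "\<dots> = (c * suminf t) * suminf z" using assms by (intro suminf_mult)
  also have "\<dots> = c * (suminf z * suminf t)" by simp
  finally show ?thesis .
qed

text \<open>
  The cylinder probabilities of a shift-invariant measure: additivity at the end of a word is
  Kolmogorov consistency, additivity at its beginning is invariance.
\<close>

locale word_measure =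
  fixes X :: "'a set" and M :: "'a list \<Rightarrow> real"
  assumes fin_X: "finite X"
    and M_Nil: "M [] = 1"
    and M_pos: "w \<in> lists X \<Longrightarrow> 0 < M w"
    and M_snoc: "additive_on_words X M"
    and M_Cons: "w \<in> lists X \<Longrightarrow> (\<Sum>p\<in>X. M (p # w)) = M w"
begin

lemma M_ext: "w \<in> lists X \<Longrightarrow> (\<Sum>v\<in>words X n. M (w @ v)) = M w"
  by (rule additive_words[OF M_snoc])

lemma M_past: "w \<in> lists X \<Longrightarrow> (\<Sum>v\<in>words X n. M (v @ w)) = M w"
proof (induction n)
  case (Suc n)
  then show ?case
    by (simp add: sum_words_Cons) (metis (no_types, lifting) M_Cons append_in_lists_conv sum.cong wordsD(1))
qed simp

lemma M_total: "(\<Sum>w\<in>words X n. M w) = 1"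
  using M_ext[of "[]" n] by (simp add: M_Nil)

lemma M_le_1: "w \<in> lists X \<Longrightarrow> M w \<le> 1"
  using member_le_sum[of w "words X (length w)" M] M_total[of "length w"] M_pos fin_X
  by (force simp: words_def less_imp_le)

end

text \<open>
  The \<open>i\<close>th term of this Birkhoff sum sees only the suffix \<open>drop i w\<close>. Evaluating the potential
  on finite words, instead of at points of a cylinder, makes the cocycle identity exact and
  avoids the inverse branches of the map, which need not be defined at boundary points.
\<close>

primrec word_birkhoff :: "('a list \<Rightarrow> real) \<Rightarrow> 'a list \<Rightarrow> real" where
  "word_birkhoff h [] = 0"
| "word_birkhoff h (p # w) = h (p # w) + word_birkhoff h w"

text \<open>
  The letter of \<open>q\<close> at distance \<open>i\<close> from \<open>w\<close> contributes at most \<open>K\<close> times the power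
  \<open>i + length w\<close> of \<open>\<theta>\<close>, and these contributions form a geometric series.
\<close>

lemma word_birkhoff_distortion:
  assumes h: "\<And>w u v. w \<in> lists X \<Longrightarrow> u \<in> lists X \<Longrightarrow> v \<in> lists X \<Longrightarrow> w \<noteq> [] \<Longrightarrow>
      \<bar>h (w @ u) - h (w @ v)\<bar> \<le> K * \<theta> ^ length w"
    and \<theta>: "0 < \<theta>" "\<theta> < 1" and K: "0 \<le> K"
    and X: "q \<in> lists X" "w \<in> lists X" "u \<in> lists X" "v \<in> lists X"
  shows "\<bar>(word_birkhoff h (q @ w @ u) - word_birkhoff h (w @ u)) -
          (word_birkhoff h (q @ w @ v) - word_birkhoff h (w @ v))\<bar> \<le> K / (1 - \<theta>) * \<theta> ^ length w"
proof -
  define c where "c = K / (1 - \<theta>) * \<theta> ^ length w"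
  have "\<bar>(word_birkhoff h (q @ w @ u) - word_birkhoff h (w @ u)) -
          (word_birkhoff h (q @ w @ v) - word_birkhoff h (w @ v))\<bar>
        \<le> K / (1 - \<theta>) * \<theta> ^ length w * (1 - \<theta> ^ length q)" if "q \<in> lists X" for q
    using that
  proof (induction q)
    case (Cons p q)
    have "\<bar>h ((p # q @ w) @ u) - h ((p # q @ w) @ v)\<bar> \<le> K * \<theta> ^ length (p # q @ w)"
      using Cons.hyps X(2-4) by (intro h) auto
    also have "\<dots> \<le> K * \<theta> ^ (length w + length q)"
      using \<theta> K by (intro mult_left_mono power_decreasing) auto
    also have "\<dots> = K / (1 - \<theta>) * \<theta> ^ length w * (\<theta> ^ length q * (1 - \<theta>))"
      using \<theta> by (simp add: field_simps power_add)
    also have "\<theta> ^ length q * (1 - \<theta>) = \<theta> ^ length q - \<theta> ^ length (p # q)"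
      by (simp add: algebra_simps)
    finally have "\<bar>h ((p # q @ w) @ u) - h ((p # q @ w) @ v)\<bar>
        \<le> c * (\<theta> ^ length q - \<theta> ^ length (p # q))" by (simp only: c_def)
    then show ?case using Cons.IH unfolding c_def[symmetric] right_diff_distrib by simp
  qed simp
  note this[OF X(1)]
  also have "K / (1 - \<theta>) * \<theta> ^ length w * (1 - \<theta> ^ length q) \<le> K / (1 - \<theta>) * \<theta> ^ length w * 1"
    using \<theta> K by (intro mult_left_mono) auto
  finally show ?thesis by simp
qed

locale gibbs_word_measure = word_measure +
  fixes h :: "'a list \<Rightarrow> real" and H \<theta> C :: real
  assumes h_regular: "\<And>w u v. w \<in> lists X \<Longrightarrow> u \<in> lists X \<Longrightarrow> v \<in> lists X \<Longrightarrow> w \<noteq> [] \<Longrightarrow>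
      \<bar>h (w @ u) - h (w @ v)\<bar> \<le> H * \<theta> ^ length w"
    and \<theta>: "0 < \<theta>" "\<theta> < 1" and H: "0 \<le> H" and C: "0 < C"
    and gibbs_lower: "\<And>w. w \<in> lists X \<Longrightarrow> M w / C \<le> exp (word_birkhoff h w)"
    and gibbs_upper: "\<And>w. w \<in> lists X \<Longrightarrow> exp (word_birkhoff h w) \<le> C * M w"
begin

definition weight :: "'a list \<Rightarrow> real" where "weight w = exp (word_birkhoff h w)"

text \<open>
  The mass that the cylinder of \<open>w\<close> receives when a unit mass is pulled back \<open>length w + n\<close> times
  by the dual of the transfer operator of the potential.
\<close>

definition extension_sum :: "nat \<Rightarrow> 'a list \<Rightarrow> real" where "extension_sum n w = (\<Sum>v\<in>words X n. weight (w @ v))"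

definition K :: real where "K = H / (1 - \<theta>)"

lemma K_nonneg: "0 \<le> K" using H \<theta> by (simp add: K_def)

lemma extension_sum_bounds:
  assumes "w \<in> lists X"
  shows "M w / C \<le> extension_sum n w" "extension_sum n w \<le> C * M w"
proof -
  have "M w / C = (\<Sum>v\<in>words X n. M (w @ v) / C)"
    using M_ext[OF assms, of n] by (simp add: sum_divide_distrib[symmetric])
  also have "\<dots> \<le> extension_sum n w"
    unfolding extension_sum_def weight_def using assms by (intro sum_mono gibbs_lower) (simp add: wordsD)
  finally show "M w / C \<le> extension_sum n w" .
  have "extension_sum n w \<le> (\<Sum>v\<in>words X n. C * M (w @ v))"
    unfolding extension_sum_def weight_def using assms by (intro sum_mono gibbs_upper) (simp add: wordsD)
  then show "extension_sum n w \<le> C * M w"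
    using M_ext[OF assms, of n] by (simp add: sum_distrib_left[symmetric])
qed

lemma extension_sum_nonneg: "w \<in> lists X \<Longrightarrow> 0 \<le> extension_sum n w"
  unfolding extension_sum_def weight_def by (intro sum_nonneg) simp

lemma weight_distortion:
  assumes "q \<in> lists X" "w \<in> lists X" "u \<in> lists X" "v \<in> lists X"
  shows "weight (q @ w @ u) * weight (w @ v) \<le> exp (K * \<theta> ^ length w) * (weight (q @ w @ v) * weight (w @ u))"
proof -
  have "\<bar>(word_birkhoff h (q @ w @ u) - word_birkhoff h (w @ u)) -
          (word_birkhoff h (q @ w @ v) - word_birkhoff h (w @ v))\<bar> \<le> H / (1 - \<theta>) * \<theta> ^ length w"
    by (rule word_birkhoff_distortion[OF h_regular \<theta> H assms])
  then show ?thesis unfolding weight_def K_def exp_add[symmetric] by (simp add: K_def)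
qed

text \<open>
  The prefix \<open>q\<close> multiplies all weights of words starting with \<open>w\<close> by nearly the same factor, no
  matter how they continue. The two sides pair the same levels \<open>i\<close> and \<open>j\<close> after removing \<open>q\<close>.
\<close>

lemma extension_sum_distortion:
  assumes "q \<in> lists X" "w \<in> lists X" "u \<in> lists X" "v \<in> lists X"
  shows "extension_sum i (q @ w @ u) * extension_sum j (w @ v) \<le> exp (K * \<theta> ^ length w) * (extension_sum j (q @ w @ v) * extension_sum i (w @ u))"
proof -
  have "extension_sum i (q @ w @ u) * extension_sum j (w @ v)
      = (\<Sum>a\<in>words X i. \<Sum>b\<in>words X j. weight (q @ w @ u @ a) * weight (w @ v @ b))"
    by (simp add: extension_sum_def sum_product)
  also have "\<dots> \<le> (\<Sum>a\<in>words X i. \<Sum>b\<in>words X j. exp (K * \<theta> ^ length w) * (weight (q @ w @ v @ b) * weight (w @ u @ a)))"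
    using assms by (intro sum_mono weight_distortion) (auto simp: wordsD)
  also have "\<dots> = exp (K * \<theta> ^ length w) * (\<Sum>a\<in>words X i. \<Sum>b\<in>words X j. weight (w @ u @ a) * weight (q @ w @ v @ b))"
    by (simp add: sum_distrib_left mult_ac)
  also have "\<dots> = exp (K * \<theta> ^ length w) * (extension_sum j (q @ w @ v) * extension_sum i (w @ u))"
    by (simp add: extension_sum_def sum_product[symmetric] mult_ac)
  finally show ?thesis .
qed

lemma extension_sum_Suc: "extension_sum (Suc n) w = (\<Sum>p\<in>X. extension_sum n (w @ [p]))"
  using sum_words_append[of "\<lambda>v. weight (w @ v)" X "Suc 0" n] by (simp add: extension_sum_def sum_words_1)

text \<open>
  Patterson's device: Abel summation over the levels. Every word is discounted by \<open>s\<close> to the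
  power of its length, so a prefix \<open>q\<close> contributes just one more power of \<open>s\<close>, which cancels in
  the distortion inequality; only additivity is violated, by a term of order \<open>1 - s\<close>.
\<close>

definition discounted :: "real \<Rightarrow> 'a list \<Rightarrow> real" where
  "discounted s w = (1 - s) * (\<Sum>n. s ^ (n + length w) * extension_sum n w)"

lemma discounted_summable:
  assumes "w \<in> lists X" "0 < s" "s < 1"
  shows "summable (\<lambda>n. s ^ (n + length w) * extension_sum n w)"
proof (rule summable_comparison_test)
  show "\<exists>N. \<forall>n\<ge>N. norm (s ^ (n + length w) * extension_sum n w) \<le> s ^ n * (C * M w)"
  proof (intro exI allI impI)
    fix n
    have "s ^ (n + length w) * extension_sum n w \<le> s ^ n * (C * M w)"
      using assms extension_sum_bounds[of w n] extension_sum_nonneg[of w n]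
      by (intro mult_mono power_decreasing) auto
    then show "norm (s ^ (n + length w) * extension_sum n w) \<le> s ^ n * (C * M w)"
      using assms extension_sum_nonneg[of w n] by simp
  qed
  show "summable (\<lambda>n. s ^ n * (C * M w))"
    using assms by (intro summable_mult2 summable_geometric) auto
qed

lemma discounted_bounds:
  assumes "w \<in> lists X" "0 < s" "s < 1"
  shows "s ^ length w * (M w / C) \<le> discounted s w" "discounted s w \<le> C * M w"
proof -
  have sg: "summable (\<lambda>n. s ^ n)" "(\<Sum>n. s ^ n) = 1 / (1 - s)"
    using assms by (auto intro: summable_geometric suminf_geometric)
  have "s ^ length w * (M w / C) = (1 - s) * (\<Sum>n. s ^ n * (s ^ length w * (M w / C)))"
    using assms sg by (subst suminf_mult2[symmetric]) auto
  also have "\<dots> \<le> discounted s w"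
    unfolding discounted_def using assms extension_sum_bounds[OF assms(1)] sg discounted_summable
    by (intro mult_left_mono suminf_le summable_mult2) (simp_all add: power_add mult.assoc mult_left_mono del: times_divide_eq_right)
  finally show "s ^ length w * (M w / C) \<le> discounted s w" .
  have "discounted s w \<le> (1 - s) * (\<Sum>n. s ^ n * (C * M w))"
    unfolding discounted_def using assms sg discounted_summable extension_sum_bounds[OF assms(1)] extension_sum_nonneg[OF assms(1)]
    by (intro mult_left_mono suminf_le summable_mult2) (auto intro!: mult_mono power_decreasing)
  also have "\<dots> = C * M w"
    using assms sg by (subst suminf_mult2[symmetric]) auto
  finally show "discounted s w \<le> C * M w" .
qed

lemma discounted_snoc:
  assumes "w \<in> lists X" "0 < s" "s < 1"
  shows "discounted s w = (1 - s) * (s ^ length w * weight w) + (\<Sum>p\<in>X. discounted s (w @ [p]))"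
proof -
  have "(\<Sum>n. s ^ (n + length w) * extension_sum n w)
      = s ^ length w * weight w + (\<Sum>n. s ^ (Suc n + length w) * extension_sum (Suc n) w)"
    using suminf_split_head[OF discounted_summable[OF assms]] by (simp add: extension_sum_def)
  also have "(\<Sum>n. s ^ (Suc n + length w) * extension_sum (Suc n) w)
      = (\<Sum>n. \<Sum>p\<in>X. s ^ (n + length (w @ [p])) * extension_sum n (w @ [p]))"
    by (simp add: extension_sum_Suc sum_distrib_left)
  also have "\<dots> = (\<Sum>p\<in>X. \<Sum>n. s ^ (n + length (w @ [p])) * extension_sum n (w @ [p]))"
    using assms by (intro suminf_sum discounted_summable) auto
  finally show ?thesis
    by (simp add: discounted_def distrib_left sum_distrib_left)
qed

lemma discounted_distortion:
  assumes "q \<in> lists X" "w \<in> lists X" "u \<in> lists X" "v \<in> lists X" "0 < s" "s < 1"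
  shows "discounted s (q @ w @ u) * discounted s (w @ v)
      \<le> exp (K * \<theta> ^ length w) * (discounted s (q @ w @ v) * discounted s (w @ u))"
proof -
  have "(\<Sum>n. s ^ (n + length (q @ w @ u)) * extension_sum n (q @ w @ u)) * (\<Sum>n. s ^ (n + length (w @ v)) * extension_sum n (w @ v))
      \<le> exp (K * \<theta> ^ length w) * ((\<Sum>n. s ^ (n + length (q @ w @ v)) * extension_sum n (q @ w @ v))
          * (\<Sum>n. s ^ (n + length (w @ u)) * extension_sum n (w @ u)))"
  proof (rule suminf_product_le)
    fix i j
    have "s ^ (i + length (q @ w @ u)) * s ^ (j + length (w @ v)) * (extension_sum i (q @ w @ u) * extension_sum j (w @ v))
        \<le> s ^ (i + length (q @ w @ u)) * s ^ (j + length (w @ v)) *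
          (exp (K * \<theta> ^ length w) * (extension_sum j (q @ w @ v) * extension_sum i (w @ u)))"
      using assms by (intro mult_left_mono extension_sum_distortion) auto
    moreover have "s ^ (i + length (q @ w @ u)) * s ^ (j + length (w @ v))
        = s ^ (j + length (q @ w @ v)) * s ^ (i + length (w @ u))"
      by (simp add: power_add[symmetric] algebra_simps)
    moreover have "(\<alpha> * x) * (\<beta> * y) \<le> k * ((\<gamma> * z) * (\<delta> * t))"
      if "\<alpha> * \<beta> * (x * y) \<le> \<alpha> * \<beta> * (k * (z * t))" "\<alpha> * \<beta> = \<gamma> * \<delta>" for \<alpha> \<beta> \<gamma> \<delta> x y z t k :: real
    proof -
      have "(\<alpha> * x) * (\<beta> * y) = \<alpha> * \<beta> * (x * y)" by (simp add: mult_ac)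
      also have "\<dots> \<le> \<gamma> * \<delta> * (k * (z * t))" using that by simp
      also have "\<dots> = k * ((\<gamma> * z) * (\<delta> * t))" by (simp add: mult_ac)
      finally show ?thesis .
    qed
    ultimately show "s ^ (i + length (q @ w @ u)) * extension_sum i (q @ w @ u) * (s ^ (j + length (w @ v)) * extension_sum j (w @ v))
      \<le> exp (K * \<theta> ^ length w) * (s ^ (j + length (q @ w @ v)) * extension_sum j (q @ w @ v) *
         (s ^ (i + length (w @ u)) * extension_sum i (w @ u)))"
      by blast
  qed (use assms in \<open>auto intro!: discounted_summable simp del: length_append append_assoc\<close>)
  then have "(1 - s)\<^sup>2 * ((\<Sum>n. s ^ (n + length (q @ w @ u)) * extension_sum n (q @ w @ u)) * (\<Sum>n. s ^ (n + length (w @ v)) * extension_sum n (w @ v)))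
      \<le> (1 - s)\<^sup>2 * (exp (K * \<theta> ^ length w) * ((\<Sum>n. s ^ (n + length (q @ w @ v)) * extension_sum n (q @ w @ v))
          * (\<Sum>n. s ^ (n + length (w @ u)) * extension_sum n (w @ u))))"
    by (intro mult_left_mono) auto
  then show ?thesis
    unfolding discounted_def power2_eq_square by (simp only: mult_ac)
qed

text \<open>
  A limit point of the discounted sums as \<open>s\<close> increases to 1. The Gibbs inequalities bound every
  extension sum of \<open>w\<close> by multiples of \<open>M w\<close> from both sides, so no normalisation is necessary
  and the limit is comparable to \<open>M\<close>.
\<close>

proposition conformal_measure_exists:
  obtains m where "additive_on_words X m"
    and "\<And>w. w \<in> lists X \<Longrightarrow> M w / C \<le> m w" "\<And>w. w \<in> lists X \<Longrightarrow> m w \<le> C * M w"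
    and "\<And>q. q \<in> lists X \<Longrightarrow> log_regular X m K \<theta> (\<lambda>w. m (q @ w))"
proof -
  define g where "g s w = (if w \<in> lists X then discounted s w else 0)" for s w
  have ev: "eventually (\<lambda>s::real. 0 < s \<and> s < 1) (at_left 1)"
    by (rule eventually_at_leftI[of 0]) auto
  have "g s w \<in> {0..C}" if "0 < s \<and> s < 1" for s w
  proof (cases "w \<in> lists X")
    case True
    have "0 \<le> s ^ length w * (M w / C)" "C * M w \<le> C * 1"
      using that True M_pos[OF True] M_le_1[OF True] C by auto
    then show ?thesis using discounted_bounds[OF True, of s] that by (simp add: g_def True)
  qed (use C in \<open>simp add: g_def\<close>)
  then have "eventually (\<lambda>s. \<forall>w. g s w \<in> {0..C}) (at_left 1)"
    using ev by (auto elim: eventually_mono)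
  then obtain G m where G: "G \<le> at_left (1::real)" "G \<noteq> bot" and m: "\<And>w. ((\<lambda>s. g s w) \<longlongrightarrow> m w) G"
    using simultaneous_limit[of "at_left (1::real)" g 0 C] by (auto simp: trivial_limit_at_left_real)
  have ev: "eventually (\<lambda>s. 0 < s \<and> s < 1) G" using ev G(1) by (rule filter_leD[rotated])
  have lim: "((\<lambda>s. discounted s w) \<longlongrightarrow> m w) G" if "w \<in> lists X" for w
    using m[of w] that by (simp add: g_def)
  have s1: "((\<lambda>s. s) \<longlongrightarrow> (1::real)) G"
    by (rule tendsto_mono[OF G(1)]) (rule tendsto_ident_at)
  have G_bot: "\<not> trivial_limit G" using G(2) by simp
  show ?thesis
  proof (rule that[of m])
    show "additive_on_words X m"
      unfolding additive_on_words_def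
    proof
      fix w assume w: "w \<in> lists X"
      have "((\<lambda>s. (1 - s) * (s ^ length w * weight w) + (\<Sum>p\<in>X. discounted s (w @ [p])))
          \<longlongrightarrow> (1 - 1) * (1 ^ length w * weight w) + (\<Sum>p\<in>X. m (w @ [p]))) G"
        using w by (intro tendsto_intros s1 lim) auto
      moreover have "eventually (\<lambda>s. (1 - s) * (s ^ length w * weight w) + (\<Sum>p\<in>X. discounted s (w @ [p]))
          = discounted s w) G"
        using ev by (rule eventually_mono) (use discounted_snoc[OF w] in auto)
      ultimately have "((\<lambda>s. discounted s w) \<longlongrightarrow> (1 - 1) * (1 ^ length w * weight w) + (\<Sum>p\<in>X. m (w @ [p]))) G"
        by (rule Lim_transform_eventually)
      then show "m w = (\<Sum>p\<in>X. m (w @ [p]))"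
        using tendsto_unique[OF G_bot lim[OF w]] by simp
    qed
  next
    fix w assume w: "w \<in> lists X"
    have "((\<lambda>s. s ^ length w * (M w / C)) \<longlongrightarrow> 1 ^ length w * (M w / C)) G"
      by (intro tendsto_intros s1)
    then have "1 ^ length w * (M w / C) \<le> m w"
      by (rule tendsto_le[OF G_bot lim[OF w]])
         (use ev discounted_bounds[OF w] in \<open>auto elim: eventually_mono\<close>)
    then show "M w / C \<le> m w" by simp
    show "m w \<le> C * M w"
      by (rule tendsto_upperbound[OF lim[OF w] _ G_bot])
         (use ev discounted_bounds[OF w] in \<open>auto elim: eventually_mono\<close>)
  next
    fix q assume q: "q \<in> lists X"
    show "log_regular X m K \<theta> (\<lambda>w. m (q @ w))"
      unfolding log_regular_def
    proof (intro ballI)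
      fix w u v assume w: "w \<in> lists X" "u \<in> lists X" "v \<in> lists X"
      show "m (q @ w @ u) * m (w @ v) \<le> exp (K * \<theta> ^ length w) * (m (q @ w @ v) * m (w @ u))"
      proof (rule tendsto_le[OF G_bot])
        show "((\<lambda>s. discounted s (q @ w @ u) * discounted s (w @ v))
            \<longlongrightarrow> m (q @ w @ u) * m (w @ v)) G"
          using q w by (intro tendsto_intros lim) auto
        show "((\<lambda>s. exp (K * \<theta> ^ length w) * (discounted s (q @ w @ v) * discounted s (w @ u)))
            \<longlongrightarrow> exp (K * \<theta> ^ length w) * (m (q @ w @ v) * m (w @ u))) G"
          using q w by (intro tendsto_intros lim) auto
        show "\<forall>\<^sub>F s in G. discounted s (q @ w @ u) * discounted s (w @ v)
            \<le> exp (K * \<theta> ^ length w) * (discounted s (q @ w @ v) * discounted s (w @ u))"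
          using ev by (rule eventually_mono) (use discounted_distortion[OF q w] in auto)
      qed
    qed
  qed
qed

end

section \<open>Log-regularity of invariant Gibbs measures\<close>

lemma square_expand: "0 < b \<Longrightarrow> (a / b - c)\<^sup>2 * b = a\<^sup>2 / b - 2 * c * a + c\<^sup>2 * b" for a b c :: real
  by (simp add: field_simps power2_eq_square)

context word_measure
begin

text \<open>
  Pythagoras for the martingale of densities \<open>M q / m q\<close>, \<open>q\<close> of length \<open>k\<close>, in the Hilbert space
  of \<open>m\<close>.
\<close>

lemma energy_increment:
  assumes m: "additive_on_words X m" "\<And>w. w \<in> lists X \<Longrightarrow> 0 < m w"
  shows "(\<Sum>q\<in>words X k. \<Sum>v\<in>words X n. (M (q @ v) / m (q @ v) - M q / m q)\<^sup>2 * m (q @ v))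
    = (\<Sum>q\<in>words X (k + n). (M q)\<^sup>2 / m q) - (\<Sum>q\<in>words X k. (M q)\<^sup>2 / m q)"
proof -
  have "(\<Sum>v\<in>words X n. (M (q @ v) / m (q @ v) - M q / m q)\<^sup>2 * m (q @ v))
      = (\<Sum>v\<in>words X n. (M (q @ v))\<^sup>2 / m (q @ v)) - (M q)\<^sup>2 / m q" if q: "q \<in> words X k" for q
  proof -
    have qX: "q \<in> lists X" using q by (rule wordsD)
    have "(\<Sum>v\<in>words X n. (M (q @ v) / m (q @ v) - M q / m q)\<^sup>2 * m (q @ v))
        = (\<Sum>v\<in>words X n. (M (q @ v))\<^sup>2 / m (q @ v) - 2 * (M q / m q) * M (q @ v)
             + (M q / m q)\<^sup>2 * m (q @ v))"
    proof (intro sum.cong refl)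
      fix v assume "v \<in> words X n"
      then have "0 < m (q @ v)" using qX by (intro m(2)) (auto simp: wordsD)
      then show "(M (q @ v) / m (q @ v) - M q / m q)\<^sup>2 * m (q @ v)
          = (M (q @ v))\<^sup>2 / m (q @ v) - 2 * (M q / m q) * M (q @ v) + (M q / m q)\<^sup>2 * m (q @ v)"
        by (rule square_expand)
    qed
    also have "\<dots> = (\<Sum>v\<in>words X n. (M (q @ v))\<^sup>2 / m (q @ v))
        - 2 * (M q / m q) * (\<Sum>v\<in>words X n. M (q @ v)) + (M q / m q)\<^sup>2 * (\<Sum>v\<in>words X n. m (q @ v))"
      by (simp add: sum.distrib sum_subtractf sum_distrib_left)
    also have "\<dots> = (\<Sum>v\<in>words X n. (M (q @ v))\<^sup>2 / m (q @ v)) - (M q)\<^sup>2 / m q"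
      using m(2)[OF qX] by (simp add: M_ext[OF qX] additive_words[OF m(1) qX] power2_eq_square)
    finally show ?thesis .
  qed
  then show ?thesis by (simp add: sum_words_append sum_subtractf)
qed

text \<open>
  By invariance, \<open>M w\<close> is the sum of \<open>M (q @ w)\<close> over the words \<open>q\<close> of length \<open>k\<close>. Replacing the
  density of \<open>M\<close> on the cylinder of \<open>q\<close> by its average turns this sum into \<open>B k w\<close>, a mixture of
  the log-regular functions \<open>w \<mapsto> m (q @ w)\<close>. The error is a martingale increment. The
  martingale is bounded in the Hilbert space of \<open>m\<close>, since \<open>M\<close> is at most a multiple of \<open>m\<close>, so
  the increments tend to zero.
\<close>

proposition invariant_log_regular:
  assumes m: "additive_on_words X m" and C: "0 < C"
    and mM: "\<And>w. w \<in> lists X \<Longrightarrow> M w / C \<le> m w" "\<And>w. w \<in> lists X \<Longrightarrow> m w \<le> C * M w"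
    and reg: "\<And>q. q \<in> lists X \<Longrightarrow> log_regular X m K \<theta> (\<lambda>w. m (q @ w))"
  shows "log_regular X m K \<theta> M"
proof -
  have m_pos: "0 < m w" if "w \<in> lists X" for w
    using mM(1)[OF that] divide_pos_pos[OF M_pos[OF that] C] by linarith
  define E where "E k = (\<Sum>q\<in>words X k. (M q)\<^sup>2 / m q)" for k
  define B where "B k w = (\<Sum>q\<in>words X k. M q / m q * m (q @ w))" for k w
  have incr: "(\<Sum>q\<in>words X k. \<Sum>v\<in>words X n. (M (q @ v) / m (q @ v) - M q / m q)\<^sup>2 * m (q @ v))
      = E (k + n) - E k" for k n
    unfolding E_def using m m_pos by (rule energy_increment)
  have nonneg: "0 \<le> (M (q @ v) / m (q @ v) - M q / m q)\<^sup>2 * m (q @ v)"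
    if "q \<in> words X k" "v \<in> words X n" for q v k n
    using that m_pos[of "q @ v"] by (auto simp: wordsD)
  have "E k \<le> E (Suc k)" for k
  proof -
    have "0 \<le> E (k + Suc 0) - E k"
      unfolding incr[symmetric] by (intro sum_nonneg nonneg)
    then show ?thesis by simp
  qed
  then have E_mono: "incseq E" by (rule incseq_SucI)
  have E_bound: "E k \<le> C" for k
  proof -
    have "E k \<le> (\<Sum>q\<in>words X k. C * M q)"
      unfolding E_def
    proof (intro sum_mono)
      fix q assume "q \<in> words X k"
      then have q: "q \<in> lists X" by (rule wordsD)
      then have "M q \<le> C * m q" using mM(1)[OF q] C by (simp add: field_simps)
      then have "M q * M q \<le> C * m q * M q" using M_pos[OF q] by (intro mult_right_mono) auto
      then show "(M q)\<^sup>2 / m q \<le> C * M q" using m_pos[OF q] by (simp add: field_simps power2_eq_square)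
    qed
    then show ?thesis by (simp add: sum_distrib_left[symmetric] M_total)
  qed
  obtain L where L: "E \<longlonglongrightarrow> L" and "\<forall>k. E k \<le> L"
    by (rule incseq_convergent[OF E_mono allI[OF E_bound]])
  have B_lim: "(\<lambda>k. B k w) \<longlonglongrightarrow> M w" if w: "w \<in> lists X" for w
  proof -
    have bound: "(B k w - M w)\<^sup>2 \<le> C * (E (k + length w) - E k)" for k
    proof -
      let ?d = "\<lambda>q. M (q @ w) / m (q @ w) - M q / m q"
      have qw: "0 < m (q @ w)" "m (q @ w) \<le> C * M (q @ w)" if "q \<in> words X k" for q
        using that w m_pos[of "q @ w"] mM(2)[of "q @ w"] by (auto simp: wordsD)
      have "M w - B k w = (\<Sum>q\<in>words X k. M (q @ w) - M q / m q * m (q @ w))"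
        by (simp add: B_def sum_subtractf M_past[OF w])
      also have "\<dots> = (\<Sum>q\<in>words X k. sqrt (m (q @ w)) * (sqrt (m (q @ w)) * ?d q))"
      proof (intro sum.cong refl)
        fix q assume "q \<in> words X k"
        then have pos: "0 < m (q @ w)" by (rule qw)
        then have "sqrt (m (q @ w)) * sqrt (m (q @ w)) = m (q @ w)" by simp
        then have "sqrt (m (q @ w)) * (sqrt (m (q @ w)) * ?d q) = m (q @ w) * ?d q"
          by (simp only: mult.assoc[symmetric])
        with pos show "M (q @ w) - M q / m q * m (q @ w)
            = sqrt (m (q @ w)) * (sqrt (m (q @ w)) * ?d q)"
          by (simp add: right_diff_distrib)
      qed
      finally have eq: "M w - B k w = (\<Sum>q\<in>words X k. sqrt (m (q @ w)) * (sqrt (m (q @ w)) * ?d q))" .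
      have "(M w - B k w)\<^sup>2 \<le> (\<Sum>q\<in>words X k. (sqrt (m (q @ w)))\<^sup>2) * (\<Sum>q\<in>words X k. (sqrt (m (q @ w)) * ?d q)\<^sup>2)"
        unfolding eq by (rule Cauchy_Schwarz_ineq_sum)
      also have "\<dots> = (\<Sum>q\<in>words X k. m (q @ w)) * (\<Sum>q\<in>words X k. (?d q)\<^sup>2 * m (q @ w))"
      proof -
        have "(sqrt (m (q @ w)))\<^sup>2 = m (q @ w)" "(sqrt (m (q @ w)) * ?d q)\<^sup>2 = (?d q)\<^sup>2 * m (q @ w)"
          if "q \<in> words X k" for q
          using qw(1)[OF that] by (simp_all add: power_mult_distrib)
        then show ?thesis by (simp cong: sum.cong)
      qed
      also have "\<dots> \<le> C * (E (k + length w) - E k)"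
      proof (rule mult_mono)
        have "(\<Sum>q\<in>words X k. m (q @ w)) \<le> (\<Sum>q\<in>words X k. C * M (q @ w))"
          by (intro sum_mono qw)
        also have "\<dots> = C * M w" by (simp add: sum_distrib_left[symmetric] M_past[OF w])
        also have "\<dots> \<le> C" using M_le_1[OF w] C by simp
        finally show "(\<Sum>q\<in>words X k. m (q @ w)) \<le> C" .
        have "(\<Sum>q\<in>words X k. (?d q)\<^sup>2 * m (q @ w))
            \<le> (\<Sum>q\<in>words X k. \<Sum>v\<in>words X (length w). (M (q @ v) / m (q @ v) - M q / m q)\<^sup>2 * m (q @ v))"
        proof (intro sum_mono)
          fix q assume q: "q \<in> words X k"
          have "w \<in> words X (length w)" using w by (simp add: words_def)
          then show "(?d q)\<^sup>2 * m (q @ w)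
              \<le> (\<Sum>v\<in>words X (length w). (M (q @ v) / m (q @ v) - M q / m q)\<^sup>2 * m (q @ v))"
            using nonneg[OF q] fin_X
            by (intro member_le_sum[of w _ "\<lambda>v. (M (q @ v) / m (q @ v) - M q / m q)\<^sup>2 * m (q @ v)"]) auto
        qed
        then show "(\<Sum>q\<in>words X k. (?d q)\<^sup>2 * m (q @ w)) \<le> E (k + length w) - E k"
          by (simp add: incr)
        show "0 \<le> (\<Sum>q\<in>words X k. (?d q)\<^sup>2 * m (q @ w))"
          using qw by (intro sum_nonneg) (auto simp: less_imp_le)
      qed (use C in auto)
      finally show ?thesis by (simp add: power2_commute)
    qed
    have "(\<lambda>k. C * (E (k + length w) - E k)) \<longlonglongrightarrow> C * (L - L)"
      by (intro tendsto_mult tendsto_const tendsto_diff L LIMSEQ_ignore_initial_segment[OF L])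
    then have "(\<lambda>k. (B k w - M w)\<^sup>2) \<longlonglongrightarrow> 0"
      by (intro tendsto_sandwich[of "\<lambda>_. 0" "\<lambda>k. (B k w - M w)\<^sup>2" sequentially
            "\<lambda>k. C * (E (k + length w) - E k)"]) (simp_all add: bound)
    then have "(\<lambda>k. sqrt ((B k w - M w)\<^sup>2)) \<longlonglongrightarrow> sqrt 0"
      by (rule tendsto_real_sqrt)
    then show ?thesis by (simp add: tendsto_rabs_zero_iff LIM_zero_iff)
  qed
  have B_reg: "log_regular X m K \<theta> (B k)" for k
  proof -
    have "log_regular X m K \<theta> (\<lambda>w. \<Sum>q\<in>words X k. M q / m q * m (q @ w))"
      by (intro log_regular_sum reg) (auto simp: wordsD M_pos m_pos less_imp_le)
    then show ?thesis by (simp add: B_def[abs_def])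
  qed
  show ?thesis
    unfolding log_regular_def
  proof (intro ballI)
    fix w u v assume w: "w \<in> lists X" "u \<in> lists X" "v \<in> lists X"
    show "M (w @ u) * m (w @ v) \<le> exp (K * \<theta> ^ length w) * (M (w @ v) * m (w @ u))"
    proof (rule LIMSEQ_le)
      show "(\<lambda>k. B k (w @ u) * m (w @ v)) \<longlonglongrightarrow> M (w @ u) * m (w @ v)"
        using w by (intro tendsto_intros B_lim) auto
      show "(\<lambda>k. exp (K * \<theta> ^ length w) * (B k (w @ v) * m (w @ u)))
          \<longlonglongrightarrow> exp (K * \<theta> ^ length w) * (M (w @ v) * m (w @ u))"
        using w by (intro tendsto_intros B_lim) auto
    qed (use log_regularD[OF B_reg w] in auto)
  qed
qed

end

context gibbs_word_measure
begin

text \<open>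
  Chain rule: the density of \<open>M (q @ -)\<close> with respect to \<open>M\<close> is the density of \<open>M\<close> with respect to
  \<open>m\<close> on the cylinder of \<open>q\<close>, times the one of \<open>m (q @ -)\<close> with respect to \<open>m\<close>, times the one of
  \<open>m\<close> with respect to \<open>M\<close>. Each factor is log-regular with constant \<open>K\<close>.
\<close>

proposition quasi_bernoulli:
  assumes q: "q \<in> lists X"
  shows "log_regular X M (3 * K) \<theta> (\<lambda>w. M (q @ w))"
proof -
  obtain m where m: "additive_on_words X m"
    and mM: "\<And>w. w \<in> lists X \<Longrightarrow> M w / C \<le> m w" "\<And>w. w \<in> lists X \<Longrightarrow> m w \<le> C * M w"
    and reg: "\<And>q. q \<in> lists X \<Longrightarrow> log_regular X m K \<theta> (\<lambda>w. m (q @ w))"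
    by (rule conformal_measure_exists, rule that)
  have m_pos: "0 < m w" if "w \<in> lists X" for w
    using mM(1)[OF that] divide_pos_pos[OF M_pos[OF that] C] by linarith
  have M_reg: "log_regular X m K \<theta> M"
    by (rule invariant_log_regular[OF m C mM reg])
  show ?thesis
    unfolding log_regular_def
  proof (intro ballI)
    fix w u v assume w: "w \<in> lists X" "u \<in> lists X" "v \<in> lists X"
    define c where "c = exp (K * \<theta> ^ length w)"
    have c: "exp (3 * K * \<theta> ^ length w) = c * c * c"
      by (simp add: c_def flip: exp_add)
    have 1: "M (q @ w @ u) * m (q @ w @ v) \<le> c * (M (q @ w @ v) * m (q @ w @ u))"
    proof -
      have "M (q @ w @ u) * m (q @ w @ v)
          \<le> exp (K * \<theta> ^ length (q @ w)) * (M (q @ w @ v) * m (q @ w @ u))"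
        using log_regularD[OF M_reg, of "q @ w" u v] q w by simp
      also have "\<dots> \<le> c * (M (q @ w @ v) * m (q @ w @ u))"
      proof -
        have "\<theta> ^ length (q @ w) \<le> \<theta> ^ length w"
          using \<theta> by (intro power_decreasing) auto
        then show ?thesis
          using K_nonneg M_pos[of "q @ w @ v"] m_pos[of "q @ w @ u"] q w
          unfolding c_def by (intro mult_right_mono) (auto simp del: length_append intro: mult_left_mono)
      qed
      finally show ?thesis .
    qed
    have 2: "m (q @ w @ u) * m (w @ v) \<le> c * (m (q @ w @ v) * m (w @ u))"
      unfolding c_def by (rule log_regularD[OF reg[OF q] w])
    have 3: "M (w @ v) * m (w @ u) \<le> c * (M (w @ u) * m (w @ v))"
      unfolding c_def by (rule log_regularD[OF M_reg w(1,3,2)])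
    have pos: "0 < M (q @ w @ u)" "0 < M (w @ v)" "0 < M (q @ w @ v)" "0 < M (w @ u)"
      "0 < m (q @ w @ u)" "0 < m (w @ v)" "0 < m (q @ w @ v)" "0 < m (w @ u)" "0 < c"
      using q w by (auto simp: c_def intro!: M_pos m_pos)
    have "(M (q @ w @ u) * m (q @ w @ v)) * (m (q @ w @ u) * m (w @ v)) * (M (w @ v) * m (w @ u))
        \<le> (c * (M (q @ w @ v) * m (q @ w @ u))) * (c * (m (q @ w @ v) * m (w @ u)))
            * (c * (M (w @ u) * m (w @ v)))"
      by (rule mult_mono[OF mult_mono[OF 1 2] 3]) (use pos in \<open>auto intro!: mult_nonneg_nonneg less_imp_le\<close>)
    then have "(M (q @ w @ u) * M (w @ v)) * (m (q @ w @ v) * m (q @ w @ u) * m (w @ v) * m (w @ u))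
        \<le> (c * c * c * (M (q @ w @ v) * M (w @ u))) * (m (q @ w @ v) * m (q @ w @ u) * m (w @ v) * m (w @ u))"
      by (simp add: mult_ac)
    then show "M (q @ w @ u) * M (w @ v) \<le> exp (3 * K * \<theta> ^ length w) * (M (q @ w @ v) * M (w @ u))"
      unfolding c by (rule mult_right_le_imp_le) (use pos in auto)
  qed
qed

end

section \<open>Exponential mixing\<close>

lemma exp_scaled_ge:
  fixes l t :: real
  assumes "1 \<le> l" "0 \<le> t"
  shows "1 + l * (exp t - 1) \<le> exp (l * t)"
proof -
  have "exp ((1 - 1 / l) *\<^sub>R 0 + (1 / l) *\<^sub>R (l * t)) \<le> (1 - 1 / l) * exp 0 + (1 / l) * exp (l * t)"
    using assms by (intro convex_onD[OF exp_convex]) auto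
  then have "exp t \<le> (1 - 1 / l) + (1 / l) * exp (l * t)" using assms by simp
  then have "l * exp t \<le> l * ((1 - 1 / l) + (1 / l) * exp (l * t))" using assms by (intro mult_left_mono) auto
  also have "\<dots> = l - 1 + exp (l * t)" using assms by (simp add: distrib_left right_diff_distrib)
  finally show ?thesis by (simp add: right_diff_distrib)
qed

text \<open>
  Removing from \<open>\<nu>\<close> a multiple of \<open>M\<close> that is at most the fraction \<open>\<delta>\<close> of \<open>\<nu>\<close> increases the
  relative oscillation of the density by at most the factor \<open>1 / (1 - \<delta>)\<close>; by convexity of the
  exponential function the same factor is enough for the logarithmic oscillation.
\<close>

lemma log_regular_subtract:
  assumes reg: "log_regular X M K \<theta> \<nu>" and "0 \<le> K" "0 \<le> \<theta>" "0 \<le> \<delta>" "\<delta> < 1"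
    and nonneg: "\<And>w. w \<in> lists X \<Longrightarrow> 0 \<le> \<nu> w"
    and M: "\<And>w. w \<in> lists X \<Longrightarrow> 0 \<le> M w"
    and c: "\<And>w. w \<in> lists X \<Longrightarrow> c * M w \<le> \<delta> * \<nu> w"
  shows "log_regular X M (K / (1 - \<delta>)) \<theta> (\<lambda>w. \<nu> w - c * M w)"
  unfolding log_regular_def
proof (intro ballI)
  fix w u v assume w: "w \<in> lists X" "u \<in> lists X" "v \<in> lists X"
  define x y a b t where "x = \<nu> (w @ v)" "y = \<nu> (w @ u)" "a = M (w @ u)" "b = M (w @ v)"
    "t = K * \<theta> ^ length w"
  note defs = this
  have "0 \<le> a" using w M by (simp add: defs)
  have t: "0 \<le> t" using assms by (simp add: defs)
  have le: "y * b \<le> exp t * (x * a)" unfolding defs by (rule log_regularD[OF reg w])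
  have cb: "c * b \<le> \<delta> * x" using c[of "w @ v"] w by (simp add: defs)
  then have x: "x \<le> 1 / (1 - \<delta>) * (x - c * b)" using \<open>\<delta> < 1\<close> by (simp add: field_simps)
  have "0 \<le> x" using nonneg[of "w @ v"] w by (simp add: defs)
  then have "\<delta> * x \<le> 1 * x" using \<open>\<delta> < 1\<close> by (intro mult_right_mono) auto
  then have xcb: "0 \<le> x - c * b" using cb by simp
  have "(y - c * a) * b \<le> exp t * (x * a) - c * a * b" using le by (simp add: algebra_simps)
  also have "\<dots> = (x - c * b) * a + (exp t - 1) * a * x" by (simp add: algebra_simps)
  also have "\<dots> \<le> (x - c * b) * a + (exp t - 1) * a * (1 / (1 - \<delta>) * (x - c * b))"
    using x t \<open>0 \<le> a\<close> by (intro add_left_mono mult_left_mono) auto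
  also have "\<dots> = (1 + (1 / (1 - \<delta>)) * (exp t - 1)) * ((x - c * b) * a)"
  proof -
    have "z * a + (exp t - 1) * a * (r * z) = (1 + r * (exp t - 1)) * (z * a)" for z r
      by (simp add: algebra_simps)
    then show ?thesis .
  qed
  also have "\<dots> \<le> exp ((1 / (1 - \<delta>)) * t) * ((x - c * b) * a)"
    using t assms(4,5) xcb \<open>0 \<le> a\<close> by (intro mult_right_mono exp_scaled_ge) auto
  finally show "(\<nu> (w @ u) - c * M (w @ u)) * M (w @ v)
      \<le> exp (K / (1 - \<delta>) * \<theta> ^ length w) * ((\<nu> (w @ v) - c * M (w @ v)) * M (w @ u))"
    by (simp add: defs)
qed

text \<open>
  Log-regularity of the Jacobians of \<open>M\<close>. On the empty word it says that \<open>M (q @ w)\<close> and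
  \<open>M q * M w\<close> agree up to a constant factor, which is the quasi-Bernoulli property.
\<close>

locale quasi_bernoulli_measure = word_measure +
  fixes K \<theta> :: real
  assumes \<theta>: "0 < \<theta>" "\<theta> < 1" and K: "0 \<le> K"
    and reg: "\<And>q. q \<in> lists X \<Longrightarrow> log_regular X M K \<theta> (\<lambda>w. M (q @ w))"
begin

text \<open>
  One step of the shift. On the cylinder of \<open>p # w\<close> the density of \<open>\<nu>\<close> is smoother by the factor
  \<open>\<theta>\<close>, as this word is longer than \<open>w\<close>; the Jacobian of \<open>M\<close> along the letter \<open>p\<close> costs \<open>K\<close>.
\<close>

lemma push_log_regular:
  assumes \<nu>: "log_regular X M K' \<theta> \<nu>" and nonneg: "\<And>w. w \<in> lists X \<Longrightarrow> 0 \<le> \<nu> w"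
  shows "log_regular X M (K' * \<theta> + K) \<theta> (\<lambda>w. \<Sum>p\<in>X. \<nu> (p # w))"
  unfolding log_regular_def
proof (intro ballI)
  fix w u v assume w: "w \<in> lists X" "u \<in> lists X" "v \<in> lists X"
  define a b where "a = exp (K' * \<theta> ^ Suc (length w))" "b = exp (K * \<theta> ^ length w)"
  have ab: "exp ((K' * \<theta> + K) * \<theta> ^ length w) = a * b"
    by (simp add: a_b_def exp_add[symmetric] algebra_simps)
  have "\<nu> (p # w @ u) * M (w @ v) \<le> a * b * (\<nu> (p # w @ v) * M (w @ u))" if p: "p \<in> X" for p
  proof -
    have 1: "\<nu> (p # w @ u) * M (p # w @ v) \<le> a * (\<nu> (p # w @ v) * M (p # w @ u))"
      using log_regularD[OF \<nu>, of "p # w" u v] p w by (simp add: a_b_def)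
    have 2: "M (p # w @ u) * M (w @ v) \<le> b * (M (p # w @ v) * M (w @ u))"
      using log_regularD[OF reg[of "[p]"] w] p by (simp add: a_b_def)
    have pos: "0 < M (p # w @ u)" "0 < M (p # w @ v)" "0 < M (w @ v)" "0 < M (w @ u)" "0 < a" "0 < b"
      using p w by (auto simp: a_b_def intro!: M_pos)
    have "(\<nu> (p # w @ u) * M (p # w @ v)) * (M (p # w @ u) * M (w @ v))
        \<le> (a * (\<nu> (p # w @ v) * M (p # w @ u))) * (b * (M (p # w @ v) * M (w @ u)))"
      using pos nonneg[of "p # w @ v"] p w
      by (intro mult_mono[OF 1 2]) (auto intro!: mult_nonneg_nonneg less_imp_le)
    then have "(\<nu> (p # w @ u) * M (w @ v)) * (M (p # w @ u) * M (p # w @ v))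
        \<le> (a * b * (\<nu> (p # w @ v) * M (w @ u))) * (M (p # w @ u) * M (p # w @ v))"
      by (simp add: mult_ac)
    then show ?thesis by (rule mult_right_le_imp_le) (use pos in auto)
  qed
  then have "(\<Sum>p\<in>X. \<nu> (p # w @ u) * M (w @ v)) \<le> (\<Sum>p\<in>X. a * b * (\<nu> (p # w @ v) * M (w @ u)))"
    by (rule sum_mono)
  then show "(\<Sum>p\<in>X. \<nu> (p # w @ u)) * M (w @ v)
      \<le> exp ((K' * \<theta> + K) * \<theta> ^ length w) * ((\<Sum>p\<in>X. \<nu> (p # w @ v)) * M (w @ u))"
    by (simp only: ab sum_distrib_left sum_distrib_right)
qed

text \<open>
  The constant \<open>K1\<close> is chosen such that one push-forward followed by the removal of the fraction
  \<open>(1 - \<theta>) / 2\<close> leads back to the same regularity class: \<open>(K1 \<theta> + K) / (1 - (1 - \<theta>) / 2) = K1\<close>.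
  The proportion of mass that survives the removal is \<open>\<tau>\<close>.
\<close>

definition K1 :: real where "K1 = 2 * K / (1 - \<theta>)"
definition \<tau> :: real where "\<tau> = 1 - (1 - \<theta>) / 2 * exp (- (K1 * \<theta> + K))"

lemma K1_nonneg: "0 \<le> K1" using K \<theta> by (simp add: K1_def)

lemma \<tau>_bounds: "0 < \<tau>" "\<tau> < 1"
proof -
  have "0 \<le> K1 * \<theta> + K" using K K1_nonneg \<theta> by simp
  then have "exp (- (K1 * \<theta> + K)) \<le> 1" by simp
  then have "(1 - \<theta>) / 2 * exp (- (K1 * \<theta> + K)) \<le> (1 - \<theta>) / 2 * 1"
    using \<theta> by (intro mult_left_mono) auto
  also have "\<dots> < 1" using \<theta> by simp
  finally show "0 < \<tau>" unfolding \<tau>_def by (simp only: diff_gt_0_iff_gt)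
  show "\<tau> < 1" using \<theta> by (simp add: \<tau>_def)
qed

text \<open>
  After each push-forward a fixed proportion of \<open>\<nu>\<close> is split off as a multiple of \<open>M\<close>, which all
  later push-forwards leave unchanged. The remainder is again log-regular with constant \<open>K1\<close> and
  has mass \<open>\<tau>\<close> times the previous one.
\<close>

lemma push_contracts:
  assumes "additive_on_words X \<nu>" "\<And>w. w \<in> lists X \<Longrightarrow> 0 \<le> \<nu> w" "log_regular X M K1 \<theta> \<nu>"
    and w: "w \<in> lists X"
  shows "\<bar>(\<Sum>v\<in>words X n. \<nu> (v @ w)) - \<nu> [] * M w\<bar> \<le> exp K1 * \<tau> ^ n * (\<nu> [] * M w)"
  using assms(1-3)
proof (induction n arbitrary: \<nu>)
  case 0
  have "\<nu> w \<le> exp K1 * (\<nu> [] * M w)"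
    using log_regularD[OF 0(3), of "[]" w "[]"] w by (simp add: M_Nil)
  moreover have "1 * (\<nu> [] * M w) \<le> exp K1 * (\<nu> [] * M w)"
    using 0(2)[of "[]"] M_pos[OF w] K1_nonneg by (intro mult_right_mono) auto
  moreover have "0 \<le> \<nu> w" "0 \<le> \<nu> [] * M w" using 0(2)[of "[]"] M_pos[OF w] 0(2)[OF w] by auto
  ultimately show ?case by simp
next
  case (Suc n)
  define \<delta> K' where "\<delta> = (1 - \<theta>) / 2" "K' = K1 * \<theta> + K"
  define \<nu>1 where "\<nu>1 w = (\<Sum>p\<in>X. \<nu> (p # w))" for w
  define c where "c = \<delta> * exp (- K') * \<nu> []"
  define \<nu>2 where "\<nu>2 w = \<nu>1 w - c * M w" for w
  have K': "0 \<le> K'" using K1_nonneg K \<theta> by (simp add: \<delta>_K'_def)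
  have \<delta>: "0 < \<delta>" "\<delta> < 1" using \<theta> by (auto simp: \<delta>_K'_def)
  have "K = K1 * ((1 - \<theta>) / 2)" using \<theta> by (simp add: K1_def)
  then have "K' = K1 * (1 - \<delta>)" unfolding \<delta>_K'_def by argo
  then have K1: "K' / (1 - \<delta>) = K1" using \<delta> by simp
  have add1: "additive_on_words X \<nu>1"
    unfolding additive_on_words_def
  proof
    fix w assume "w \<in> lists X"
    then have "\<nu>1 w = (\<Sum>q\<in>X. \<Sum>p\<in>X. \<nu> ((q # w) @ [p]))"
      using Suc.prems(1) unfolding \<nu>1_def additive_on_words_def by (intro sum.cong) auto
    then show "\<nu>1 w = (\<Sum>p\<in>X. \<nu>1 (w @ [p]))"
      unfolding \<nu>1_def by (subst sum.swap) simp
  qed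
  have mass: "\<nu>1 [] = \<nu> []"
    using Suc.prems(1) by (simp add: \<nu>1_def additive_on_words_def)
  have reg1: "log_regular X M K' \<theta> \<nu>1"
    unfolding \<nu>1_def[abs_def] \<delta>_K'_def by (rule push_log_regular[OF Suc.prems(3,2)])
  have c: "c * M w \<le> \<delta> * \<nu>1 w" if "w \<in> lists X" for w
  proof -
    have "\<nu> [] * M w \<le> exp K' * \<nu>1 w"
      using log_regularD[OF reg1, of "[]" "[]" w] that by (simp add: M_Nil mass)
    then have "exp (- K') * (\<nu> [] * M w) \<le> exp (- K') * (exp K' * \<nu>1 w)"
      by (intro mult_left_mono) auto
    also have "\<dots> = \<nu>1 w" by (simp add: exp_minus)
    finally have "\<delta> * (exp (- K') * (\<nu> [] * M w)) \<le> \<delta> * \<nu>1 w"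
      using \<delta> by (intro mult_left_mono) auto
    then show ?thesis by (simp add: c_def mult_ac)
  qed
  have nonneg1: "0 \<le> \<nu>1 w" if "w \<in> lists X" for w
    unfolding \<nu>1_def using Suc.prems(2) that by (intro sum_nonneg) auto
  have add2: "additive_on_words X \<nu>2"
    using add1 M_snoc unfolding additive_on_words_def \<nu>2_def
    by (simp add: sum_subtractf sum_distrib_left)
  have nonneg2: "0 \<le> \<nu>2 w" if "w \<in> lists X" for w
  proof -
    have "\<delta> * \<nu>1 w \<le> 1 * \<nu>1 w" using \<delta> nonneg1[OF that] by (intro mult_right_mono) auto
    then show ?thesis using c[OF that] by (simp add: \<nu>2_def)
  qed
  have reg2: "log_regular X M K1 \<theta> \<nu>2"
    unfolding \<nu>2_def[abs_def] K1[symmetric]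
    by (rule log_regular_subtract[OF reg1 K']) (use \<delta> \<theta> c nonneg1 M_pos in \<open>auto intro: less_imp_le\<close>)
  have mass2: "\<nu>2 [] = \<tau> * \<nu> []"
    by (simp add: \<nu>2_def mass c_def M_Nil \<tau>_def \<delta>_K'_def algebra_simps)
  have "(\<Sum>v\<in>words X (Suc n). \<nu> (v @ w)) = (\<Sum>v\<in>words X n. \<nu>1 (v @ w))"
    by (simp add: sum_words_Cons \<nu>1_def)
  also have "\<dots> = (\<Sum>v\<in>words X n. \<nu>2 (v @ w)) + c * M w"
    by (simp add: \<nu>2_def sum_subtractf sum_distrib_left[symmetric] M_past[OF w])
  also have "\<dots> - \<nu> [] * M w = (\<Sum>v\<in>words X n. \<nu>2 (v @ w)) - \<nu>2 [] * M w"
    by (simp add: \<nu>2_def mass M_Nil algebra_simps)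
  finally have "\<bar>(\<Sum>v\<in>words X (Suc n). \<nu> (v @ w)) - \<nu> [] * M w\<bar>
      = \<bar>(\<Sum>v\<in>words X n. \<nu>2 (v @ w)) - \<nu>2 [] * M w\<bar>" by simp
  also have "\<dots> \<le> exp K1 * \<tau> ^ n * (\<nu>2 [] * M w)"
    by (rule Suc.IH[OF add2 nonneg2 reg2])
  finally show ?case by (simp add: mass2 mult_ac)
qed

theorem exponential_mixing:
  assumes q: "q \<in> lists X" and w: "w \<in> lists X"
  shows "\<bar>(\<Sum>v\<in>words X n. M (q @ v @ w)) - M q * M w\<bar> \<le> exp K1 * \<tau> ^ n * (M q * M w)"
proof -
  have "K * 1 \<le> K * (2 / (1 - \<theta>))" using \<theta> K by (intro mult_left_mono) (auto simp: field_simps)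
  then have "K \<le> K1" by (simp add: K1_def mult.commute)
  have "additive_on_words X (\<lambda>w. M (q @ w))"
    using M_snoc q unfolding additive_on_words_def by auto
  moreover have "log_regular X M K1 \<theta> (\<lambda>w. M (q @ w))"
    by (rule log_regular_mono[OF reg[OF q] \<open>K \<le> K1\<close>]) (use \<theta> q in \<open>auto intro!: less_imp_le M_pos\<close>)
  ultimately show ?thesis
    using push_contracts[of "\<lambda>w. M (q @ w)" w n] q w M_pos by (simp add: less_imp_le)
qed

end

section \<open>Decay of correlations for interval-like sets\<close>

definition hits :: "nat \<Rightarrow> 'a list set \<Rightarrow> 'a list \<Rightarrow> bool" where
  "hits k A w \<longleftrightarrow> take k w \<in> A"

text \<open>
  The words of length \<open>m\<close> whose cylinder meets the set described by \<open>A\<close> without being contained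
  in it. Extending by \<open>k\<close> letters ensures that membership is decided even if \<open>m < k\<close>.
\<close>

definition cut_words :: "'a set \<Rightarrow> nat \<Rightarrow> 'a list set \<Rightarrow> nat \<Rightarrow> 'a list set" where
  "cut_words X k A m = {q \<in> words X m.
     (\<exists>v\<in>words X k. hits k A (q @ v)) \<and> (\<exists>v\<in>words X k. \<not> hits k A (q @ v))}"

lemma hits_take:
  assumes "k \<le> length w"
  shows "hits k A (q @ w) \<longleftrightarrow> hits k A (q @ take k w)"
  using assms by (simp add: hits_def min_def)

context quasi_bernoulli_measure
begin

lemma M_snoc_ge:
  assumes "w \<in> lists X" "p \<in> X"
  shows "M w * M [p] \<le> exp K * M (w @ [p])"
  using log_regularD[OF reg[OF assms(1)], of "[]" "[]" "[p]"] assms by (simp add: M_Nil)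

text \<open>
  Every cylinder leaves at least a fixed proportion of its mass to each of its subcylinders, so
  no single one of two or more subcylinders can carry almost all of it.
\<close>

lemma cylinder_decay:
  assumes "2 \<le> card X"
  obtains \<eta> where "0 \<le> \<eta>" "\<eta> < 1" "\<And>w. w \<in> lists X \<Longrightarrow> M w \<le> \<eta> ^ length w"
proof -
  have ne: "X \<noteq> {}" using assms by auto
  define \<mu> where "\<mu> = Min ((\<lambda>p. M [p]) ` X)"
  have \<mu>: "0 < \<mu>" "\<And>p. p \<in> X \<Longrightarrow> \<mu> \<le> M [p]"
    using fin_X ne M_pos by (auto simp: \<mu>_def)
  define \<eta> where "\<eta> = 1 - exp (- K) * \<mu>"
  have "\<mu> \<le> 1" using \<mu>(2) M_le_1 ne by (metis all_not_in_conv lists.Cons lists.Nil order_trans)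
  then have "exp (- K) * \<mu> \<le> 1 * 1" using K \<mu> by (intro mult_mono) auto
  then have \<eta>: "0 \<le> \<eta>" "\<eta> < 1" using \<mu> by (auto simp: \<eta>_def)
  have step: "M (w @ [p]) \<le> \<eta> * M w" if w: "w \<in> lists X" and p: "p \<in> X" for w p
  proof -
    have "X - {p} \<noteq> {}"
    proof
      assume "X - {p} = {}"
      then have "X \<subseteq> {p}" by auto
      then have "card X \<le> 1" using card_mono[of "{p}" X] by simp
      then show False using assms by simp
    qed
    then obtain r where r: "r \<in> X" "r \<noteq> p" by auto
    have "M w * \<mu> \<le> M w * M [r]" using \<mu>(2)[OF r(1)] M_pos[OF w] by simp
    also have "\<dots> \<le> exp K * M (w @ [r])" by (rule M_snoc_ge[OF w r(1)])
    finally have "exp (- K) * (M w * \<mu>) \<le> exp (- K) * (exp K * M (w @ [r]))"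
      by (intro mult_left_mono) auto
    also have "\<dots> = M (w @ [r])" by (simp add: exp_minus)
    finally have *: "exp (- K) * \<mu> * M w \<le> M (w @ [r])" by (simp add: mult_ac)
    have "M (w @ [p]) + M (w @ [r]) = (\<Sum>q\<in>{p, r}. M (w @ [q]))" using r by simp
    also have "\<dots> \<le> (\<Sum>q\<in>X. M (w @ [q]))"
      using w p r fin_X by (intro sum_mono2) (auto intro!: less_imp_le M_pos)
    also have "\<dots> = M w" using M_snoc w by (simp add: additive_on_words_def)
    finally show ?thesis using * by (simp add: \<eta>_def left_diff_distrib)
  qed
  have "M w \<le> \<eta> ^ length w" if "w \<in> lists X" for w
    using that
  proof (induction w rule: rev_induct)
    case (snoc p w)
    have "M (w @ [p]) \<le> \<eta> * M w" using snoc.prems by (intro step) auto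
    also have "\<dots> \<le> \<eta> * \<eta> ^ length w" using snoc \<eta> by (intro mult_left_mono) auto
    finally show ?case by simp
  qed (simp add: M_Nil)
  then show ?thesis using that \<eta> by blast
qed

lemma hits_mass:
  assumes "A \<subseteq> words X k"
  shows "(\<Sum>q\<in>words X m. \<Sum>v\<in>words X k. M (q @ v) * of_bool (hits k A (q @ v))) = (\<Sum>a\<in>A. M a)"
proof -
  have "(\<Sum>q\<in>words X m. \<Sum>v\<in>words X k. M (q @ v) * of_bool (hits k A (q @ v)))
      = (\<Sum>w\<in>words X (k + m). M w * of_bool (hits k A w))"
    by (simp add: sum_words_append add.commute[of k])
  also have "\<dots> = (\<Sum>a\<in>words X k. \<Sum>v\<in>words X m. M (a @ v) * of_bool (a \<in> A))"
    by (simp add: sum_words_append hits_def wordsD cong: sum.cong)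
  also have "\<dots> = (\<Sum>a\<in>words X k. M a * of_bool (a \<in> A))"
    by (intro sum.cong refl) (simp add: sum_distrib_right[symmetric] M_ext wordsD)
  also have "\<dots> = (\<Sum>a\<in>A. M a)"
    using assms fin_X by (intro sum.mono_neutral_cong_right) auto
  finally show ?thesis .
qed

text \<open>
  Of the \<open>n\<close> letters in front of \<open>w\<close>, let \<open>q\<close> be the first \<open>m = n div 2\<close>. Unless \<open>q\<close> is cut by
  \<open>A\<close>, it decides whether \<open>A\<close> is hit, and the remaining \<open>n - m\<close> letters make \<open>q\<close> and \<open>w\<close>
  independent up to \<open>\<tau>\<close> to the power \<open>n - m\<close>. The at most two cut words contribute their measure,
  which is exponentially small in \<open>m\<close>. All constants are independent of \<open>A\<close> and \<open>k\<close>.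
\<close>

proposition hitting_decay:
  assumes "2 \<le> card X"
  obtains D \<rho> where "0 < D" "0 < \<rho>" "\<rho> < 1"
    "\<And>A k w n. A \<subseteq> words X k \<Longrightarrow> (\<And>m. card (cut_words X k A m) \<le> 2) \<Longrightarrow>
       w \<in> lists X \<Longrightarrow> k \<le> length w \<Longrightarrow>
       \<bar>(\<Sum>v\<in>words X n. M (v @ w) * of_bool (hits k A (v @ w))) - (\<Sum>a\<in>A. M a) * M w\<bar>
         \<le> D * \<rho> ^ n * M w"
proof -
  obtain \<eta> where \<eta>: "0 \<le> \<eta>" "\<eta> < 1" "\<And>w. w \<in> lists X \<Longrightarrow> M w \<le> \<eta> ^ length w"
    using cylinder_decay[OF assms] by blast
  define \<sigma> where "\<sigma> = max \<tau> \<eta>"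
  have \<sigma>: "0 < \<sigma>" "\<sigma> < 1" using \<tau>_bounds \<eta> by (auto simp: \<sigma>_def)
  define \<rho> where "\<rho> = sqrt \<sigma>"
  have \<rho>: "0 < \<rho>" "\<rho> < 1" "\<rho>\<^sup>2 = \<sigma>" using \<sigma> by (auto simp: \<rho>_def)
  define Q where "Q = exp K1"
  have Q: "1 \<le> Q" using K1_nonneg by (simp add: Q_def)
  define D where "D = (Q + 2 * (1 + Q)) / \<rho>"
  have "0 < D" using \<rho> Q by (simp add: D_def)
  moreover have "\<bar>(\<Sum>v\<in>words X n. M (v @ w) * of_bool (hits k A (v @ w))) - (\<Sum>a\<in>A. M a) * M w\<bar>
         \<le> D * \<rho> ^ n * M w"
    if A: "A \<subseteq> words X k" and cut: "\<And>m. card (cut_words X k A m) \<le> 2"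
      and w: "w \<in> lists X" "k \<le> length w" for A k w n
  proof -
    \<comment> \<open>each half of the letters decays at rate \<open>\<sigma>\<close>, hence all of them at rate \<open>\<rho> = sqrt \<sigma>\<close>\<close>
    define m where "m = n div 2"
    define r where "r = n - m"
    have n: "n = m + r" by (simp add: m_def r_def)
    let ?a = "\<lambda>w. of_bool (hits k A w) :: real"
    define S where "S q = (\<Sum>v\<in>words X r. M (q @ v @ w) * ?a (q @ v @ w))" for q
    define T where "T q = (\<Sum>v\<in>words X k. M (q @ v) * ?a (q @ v))" for q
    let ?B = "cut_words X k A m"
    have mix: "\<bar>(\<Sum>v\<in>words X r. M (q @ v @ w)) - M q * M w\<bar> \<le> Q * \<tau> ^ r * (M q * M w)"
      if "q \<in> words X m" for q
      unfolding Q_def using that w by (intro exponential_mixing) (auto simp: wordsD)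
    have pw: "\<tau> ^ r \<le> \<rho> ^ n / \<rho>" "\<eta> ^ m \<le> \<rho> ^ n / \<rho>" "\<tau> ^ r \<le> 1"
    proof -
      have le: "\<sigma> ^ j \<le> \<rho> ^ n / \<rho>" if "m \<le> j" for j
      proof -
        have "\<rho> * \<sigma> ^ j = \<rho> ^ (2 * j + 1)" by (simp add: \<rho>(3)[symmetric] power_mult)
        also have "\<dots> \<le> \<rho> ^ n" using \<rho> that by (intro power_decreasing) (auto simp: m_def)
        finally show ?thesis using \<rho> by (simp add: field_simps)
      qed
      have "\<tau> ^ r \<le> \<sigma> ^ r" using \<tau>_bounds by (intro power_mono) (auto simp: \<sigma>_def)
      also have "\<dots> \<le> \<rho> ^ n / \<rho>" by (rule le) (simp add: r_def m_def)
      finally show "\<tau> ^ r \<le> \<rho> ^ n / \<rho>" .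
      have "\<eta> ^ m \<le> \<sigma> ^ m" using \<eta> by (intro power_mono) (auto simp: \<sigma>_def)
      also have "\<dots> \<le> \<rho> ^ n / \<rho>" by (rule le) simp
      finally show "\<eta> ^ m \<le> \<rho> ^ n / \<rho>" .
      show "\<tau> ^ r \<le> 1" using \<tau>_bounds by (intro power_le_one) auto
    qed
    have Mq: "0 < M q" if "q \<in> words X m" for q using that by (intro M_pos wordsD)
    have Mw: "0 < M w" by (rule M_pos[OF w(1)])
    have good: "\<bar>S q - T q * M w\<bar> \<le> Q * \<tau> ^ r * (M q * M w)" if q: "q \<in> words X m - ?B" for q
    proof -
      have qX: "q \<in> words X m" "q \<in> lists X" using q wordsD(1)[of q X m] by auto
      have hits_iff: "hits k A (q @ v @ w) \<longleftrightarrow> hits k A (q @ take k (v @ w))" for v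
        using hits_take[of k "v @ w" A q] w by simp
      have tk: "take k (v @ w) \<in> words X k" if "v \<in> words X r" for v
        using that w by (auto simp: words_def in_lists_conv_set dest: in_set_takeD)
      consider "\<And>v. v \<in> words X k \<Longrightarrow> hits k A (q @ v)" | "\<And>v. v \<in> words X k \<Longrightarrow> \<not> hits k A (q @ v)"
        using q by (auto simp: cut_words_def)
      then show ?thesis
      proof cases
        case 1
        have "S q = (\<Sum>v\<in>words X r. M (q @ v @ w))"
          unfolding S_def using 1 tk by (intro sum.cong) (auto simp: hits_iff)
        moreover have "T q = M q" unfolding T_def using 1 M_ext[OF qX(2)] by simp
        ultimately show ?thesis using mix[OF qX(1)] by simp
      next
        case 2
        have "S q = 0" unfolding S_def using 2 tk by (intro sum.neutral) (auto simp: hits_iff)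
        moreover have "T q = 0" unfolding T_def using 2 by simp
        ultimately show ?thesis using Q \<tau>_bounds Mq[OF qX(1)] Mw by simp
      qed
    qed
    have bad: "\<bar>S q - T q * M w\<bar> \<le> (1 + Q) * (\<rho> ^ n / \<rho>) * M w" if q: "q \<in> ?B" for q
    proof -
      have qX: "q \<in> words X m" "q \<in> lists X" using q wordsD(1)[of q X m] by (auto simp: cut_words_def)
      have "S q \<le> (\<Sum>v\<in>words X r. M (q @ v @ w))"
        unfolding S_def using qX w by (intro sum_mono) (auto simp: words_def intro!: less_imp_le M_pos)
      also have "\<dots> \<le> M q * M w + Q * \<tau> ^ r * (M q * M w)" using mix[OF qX(1)] by linarith
      also have "Q * \<tau> ^ r * (M q * M w) \<le> Q * 1 * (M q * M w)"
        using pw(3) Q Mq[OF qX(1)] Mw by (intro mult_right_mono mult_left_mono) auto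
      finally have "S q \<le> (1 + Q) * (M q * M w)" by (simp add: distrib_right)
      moreover have "0 \<le> S q"
        unfolding S_def using qX w by (intro sum_nonneg) (auto simp: words_def intro!: less_imp_le M_pos)
      moreover have "T q \<le> M q"
      proof -
        have "T q \<le> (\<Sum>v\<in>words X k. M (q @ v))"
          unfolding T_def using qX by (intro sum_mono) (auto simp: words_def intro!: less_imp_le M_pos)
        then show ?thesis by (simp add: M_ext qX)
      qed
      moreover have "0 \<le> T q"
        unfolding T_def using qX by (intro sum_nonneg) (auto simp: words_def intro!: less_imp_le M_pos)
      moreover from calculation have "T q * M w \<le> M q * M w" "0 \<le> T q * M w" using Mw by auto
      moreover have "0 \<le> Q * (M q * M w)" using Q Mq[OF qX(1)] Mw by simp
      ultimately have "\<bar>S q - T q * M w\<bar> \<le> (1 + Q) * (M q * M w)" by (simp add: distrib_right)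
      also have "\<dots> \<le> (1 + Q) * (\<rho> ^ n / \<rho> * M w)"
        using \<eta>(3)[OF qX(2)] pw(2) Q Mw by (intro mult_left_mono mult_right_mono) (auto simp: wordsD(2)[OF qX(1)])
      finally show ?thesis by simp
    qed
    have "(\<Sum>v\<in>words X n. M (v @ w) * ?a (v @ w)) = (\<Sum>q\<in>words X m. S q)"
      by (simp add: n sum_words_append S_def)
    moreover have "(\<Sum>a\<in>A. M a) = (\<Sum>q\<in>words X m. T q)"
      unfolding T_def using hits_mass[OF A] by simp
    ultimately have "\<bar>(\<Sum>v\<in>words X n. M (v @ w) * ?a (v @ w)) - (\<Sum>a\<in>A. M a) * M w\<bar>
        = \<bar>\<Sum>q\<in>words X m. S q - T q * M w\<bar>"
      by (simp add: sum_subtractf sum_distrib_right)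
    also have "\<dots> \<le> (\<Sum>q\<in>words X m. \<bar>S q - T q * M w\<bar>)" by (rule sum_abs)
    also have "\<dots> = (\<Sum>q\<in>words X m - ?B. \<bar>S q - T q * M w\<bar>) + (\<Sum>q\<in>?B. \<bar>S q - T q * M w\<bar>)"
      using fin_X by (intro sum.subset_diff) (auto simp: cut_words_def)
    also have "\<dots> \<le> (\<Sum>q\<in>words X m - ?B. Q * \<tau> ^ r * (M q * M w))
        + (\<Sum>q\<in>?B. (1 + Q) * (\<rho> ^ n / \<rho>) * M w)"
      by (intro add_mono sum_mono good bad)
    also have "(\<Sum>q\<in>words X m - ?B. Q * \<tau> ^ r * (M q * M w)) \<le> (\<Sum>q\<in>words X m. Q * \<tau> ^ r * (M q * M w))"
      using fin_X Q \<tau>_bounds Mq Mw by (intro sum_mono2) (auto simp: less_imp_le)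
    also have "\<dots> = Q * \<tau> ^ r * M w"
    proof -
      have "(\<Sum>q\<in>words X m. Q * \<tau> ^ r * (M q * M w)) = Q * \<tau> ^ r * M w * (\<Sum>q\<in>words X m. M q)"
        by (subst sum_distrib_left) (simp add: mult_ac)
      then show ?thesis by (simp add: M_total)
    qed
    also have "\<dots> \<le> Q * (\<rho> ^ n / \<rho>) * M w"
      using pw(1) Q Mw by (intro mult_right_mono mult_left_mono) auto
    also have "(\<Sum>q\<in>?B. (1 + Q) * (\<rho> ^ n / \<rho>) * M w) = real (card ?B) * ((1 + Q) * (\<rho> ^ n / \<rho>) * M w)"
      by simp
    also have "\<dots> \<le> 2 * ((1 + Q) * (\<rho> ^ n / \<rho>) * M w)"
      using cut[of m] Q \<rho> Mw by (intro mult_right_mono) auto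
    finally have "\<bar>(\<Sum>v\<in>words X n. M (v @ w) * ?a (v @ w)) - (\<Sum>a\<in>A. M a) * M w\<bar>
        \<le> (Q + 2 * (1 + Q)) * (\<rho> ^ n / \<rho>) * M w" by (simp only: distrib_right mult.assoc)
    then show ?thesis by (simp add: D_def)
  qed
  ultimately show ?thesis using that[of D \<rho>] \<rho> by blast
qed

end

section \<open>Lower tail of the number of hits\<close>

lemma one_minus_exp_neg_bounds:
  fixes s :: real
  assumes "0 \<le> s"
  shows "s - s\<^sup>2 / 2 \<le> 1 - exp (- s)" "1 - exp (- s) \<le> s"
proof -
  show "1 - exp (- s) \<le> s" using exp_ge_add_one_self[of "- s"] by simp
  have "exp (- s) \<le> 1 - s + s\<^sup>2 / 2"
  proof -
    have "1 + s + s\<^sup>2 / 2 \<le> exp s" by (rule exp_lower_Taylor_quadratic[OF assms])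
    moreover have "1 \<le> (1 + s + s\<^sup>2 / 2) * (1 - s + s\<^sup>2 / 2)"
    proof -
      have "(1 + s + s\<^sup>2 / 2) * (1 - s + s\<^sup>2 / 2) = 1 + s ^ 4 / 4"
        by (simp add: field_simps power2_eq_square power4_eq_xxxx)
      then show ?thesis by simp
    qed
    moreover have "0 \<le> 1 - s + s\<^sup>2 / 2"
    proof -
      have "0 \<le> ((1 - s)\<^sup>2 + 1) / 2" by simp
      then show ?thesis by (simp only: power2_diff) (simp add: field_simps)
    qed
    ultimately have "1 \<le> exp s * (1 - s + s\<^sup>2 / 2)"
      by (meson mult_right_mono order_trans)
    then show ?thesis by (simp add: exp_minus field_simps)
  qed
  then show "s - s\<^sup>2 / 2 \<le> 1 - exp (- s)" by simp
qed

context quasi_bernoulli_measure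
begin

text \<open>
  In the notation of the introduction, \<open>L g\<close> at \<open>w\<close> is the average of \<open>g (q # w)\<close> with weights
  \<open>M (q # w) / M w\<close>, and \<open>d n\<close> in the proof is \<open>L\<^sup>n a - p\<close>. The series
  \<open>u = - \<Sum>\<^sub>i\<^sub>\<ge>\<^sub>1 d i\<close> converges geometrically, and applying \<open>L\<close> shifts its index by one.
\<close>

lemma poisson_solution:
  assumes dec: "\<And>w n. w \<in> lists X \<Longrightarrow> k \<le> length w \<Longrightarrow>
       \<bar>(\<Sum>v\<in>words X n. M (v @ w) * a (v @ w)) - p * M w\<bar> \<le> D * \<rho> ^ n * M w"
    and \<rho>: "0 < \<rho>" "\<rho> < 1"
  obtains u where "\<And>w. w \<in> lists X \<Longrightarrow> k \<le> length w \<Longrightarrow> \<bar>u w\<bar> \<le> D / (1 - \<rho>)"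
    and "\<And>w. w \<in> lists X \<Longrightarrow> k \<le> length w \<Longrightarrow>
      (\<Sum>q\<in>X. M (q # w) * u (q # w)) = M w * (u w - p) + (\<Sum>q\<in>X. M (q # w) * a (q # w))"
proof -
  define d where "d n w = (\<Sum>v\<in>words X n. M (v @ w) * a (v @ w)) / M w - p" for n w
  define u where "u w = - (\<Sum>n. d (Suc n) w)" for w
  have d: "\<bar>d n w\<bar> \<le> D * \<rho> ^ n" if "w \<in> lists X" "k \<le> length w" for n w
  proof -
    have "d n w = ((\<Sum>v\<in>words X n. M (v @ w) * a (v @ w)) - p * M w) / M w"
      using M_pos[OF that(1)] by (simp add: d_def diff_divide_distrib)
    then have "\<bar>d n w\<bar> = \<bar>(\<Sum>v\<in>words X n. M (v @ w) * a (v @ w)) - p * M w\<bar> / M w"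
      using M_pos[OF that(1)] by (simp only: abs_divide abs_of_pos)
    then show ?thesis using dec[OF that, of n] M_pos[OF that(1)] by (simp only: pos_divide_le_eq)
  qed
  have sg: "summable (\<lambda>n. D * \<rho> ^ n)" using \<rho> by (intro summable_mult summable_geometric) auto
  have sd: "summable (\<lambda>n. d n w)" if "w \<in> lists X" "k \<le> length w" for w
    using d[OF that] by (intro summable_comparison_test[OF _ sg]) auto
  have sd1: "summable (\<lambda>n. d (Suc n) w)" if "w \<in> lists X" "k \<le> length w" for w
    using sd[OF that] by (subst summable_Suc_iff)
  have D: "0 \<le> D" if "w \<in> lists X" "k \<le> length w" for w
    using d[OF that, of 0] by simp
  have u: "\<bar>u w\<bar> \<le> D / (1 - \<rho>)" if w: "w \<in> lists X" "k \<le> length w" for w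
  proof -
    have le: "\<bar>d (Suc n) w\<bar> \<le> D * \<rho> ^ n" for n
    proof -
      have "D * \<rho> ^ Suc n \<le> D * \<rho> ^ n" using D[OF w] \<rho> by (intro mult_left_mono power_decreasing) auto
      then show ?thesis using d[OF w, of "Suc n"] by linarith
    qed
    have sa: "summable (\<lambda>n. \<bar>d (Suc n) w\<bar>)"
      using le by (intro summable_comparison_test[OF _ sg]) auto
    have "\<bar>u w\<bar> = \<bar>\<Sum>n. d (Suc n) w\<bar>" by (simp add: u_def)
    also have "\<dots> \<le> (\<Sum>n. \<bar>d (Suc n) w\<bar>)" by (rule summable_rabs[OF sa])
    also have "\<dots> \<le> (\<Sum>n. D * \<rho> ^ n)" using le sa sg by (intro suminf_le) auto
    also have "\<dots> = D / (1 - \<rho>)" using \<rho> by (simp add: suminf_mult suminf_geometric)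
    finally show ?thesis .
  qed
  have d_step: "(\<Sum>q\<in>X. M (q # w) * d n (q # w)) = M w * d (Suc n) w"
    if w: "w \<in> lists X" for n w
  proof -
    have "(\<Sum>q\<in>X. M (q # w) * d n (q # w))
        = (\<Sum>q\<in>X. (\<Sum>v\<in>words X n. M (v @ q # w) * a (v @ q # w)) - p * M (q # w))"
    proof (intro sum.cong refl)
      fix q assume "q \<in> X"
      then have "0 < M (q # w)" using w by (intro M_pos) auto
      then show "M (q # w) * d n (q # w)
          = (\<Sum>v\<in>words X n. M (v @ q # w) * a (v @ q # w)) - p * M (q # w)"
        by (simp add: d_def field_simps)
    qed
    also have "\<dots> = (\<Sum>q\<in>X. \<Sum>v\<in>words X n. M (v @ q # w) * a (v @ q # w)) - p * M w"
      using w by (simp add: sum_subtractf sum_distrib_left[symmetric] M_Cons)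
    also have "(\<Sum>q\<in>X. \<Sum>v\<in>words X n. M (v @ q # w) * a (v @ q # w))
        = (\<Sum>v\<in>words X (Suc n). M (v @ w) * a (v @ w))"
      by (simp add: sum_words_snoc sum.swap[of _ X])
    also have "\<dots> - p * M w = M w * d (Suc n) w"
      using M_pos[OF w] by (simp add: d_def right_diff_distrib)
    finally show ?thesis .
  qed
  have eq: "(\<Sum>q\<in>X. M (q # w) * u (q # w)) = M w * (u w - p) + (\<Sum>q\<in>X. M (q # w) * a (q # w))"
    if w: "w \<in> lists X" "k \<le> length w" for w
  proof -
    have "(\<Sum>q\<in>X. M (q # w) * u (q # w)) = - (\<Sum>q\<in>X. \<Sum>n. M (q # w) * d (Suc n) (q # w))"
    proof -
      have "M (q # w) * u (q # w) = - (\<Sum>n. M (q # w) * d (Suc n) (q # w))" if "q \<in> X" for q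
        using sd1[of "q # w"] that w by (simp add: u_def suminf_mult)
      then show ?thesis by (simp add: sum_negf)
    qed
    also have "(\<Sum>q\<in>X. \<Sum>n. M (q # w) * d (Suc n) (q # w)) = (\<Sum>n. \<Sum>q\<in>X. M (q # w) * d (Suc n) (q # w))"
      using w by (intro suminf_sum[symmetric] summable_mult sd1) auto
    also have "\<dots> = (\<Sum>n. M w * d (Suc (Suc n)) w)" by (simp add: d_step[OF w(1)])
    also have "\<dots> = M w * (\<Sum>n. d (Suc (Suc n)) w)"
      using sd1[OF w] by (intro suminf_mult) (subst summable_Suc_iff)
    also have "(\<Sum>n. d (Suc (Suc n)) w) = - u w - d (Suc 0) w"
      using suminf_split_head[OF sd1[OF w]] by (simp add: u_def)
    finally have "(\<Sum>q\<in>X. M (q # w) * u (q # w)) = M w * u w + M w * d (Suc 0) w"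
      by (simp add: algebra_simps)
    also have "M w * d (Suc 0) w = (\<Sum>q\<in>X. M (q # w) * a (q # w)) - p * M w"
      using M_pos[OF w(1)] by (simp add: d_def sum_words_1 field_simps)
    finally show ?thesis by (simp add: algebra_simps)
  qed
  show ?thesis using that[of u] u eq by blast
qed

text \<open>
  Expanding the exponential, \<open>L (exp (- s a) (1 + \<sigma> u))\<close> is at most
  \<open>1 + \<sigma> u - \<sigma> p + (\<sigma> - s + s\<^sup>2/2 + U s\<^sup>2) L a\<close> by the Poisson equation. The term with \<open>L a\<close> is
  not of order \<open>p\<close> pointwise, and the choice of \<open>\<sigma>\<close> makes its coefficient vanish. What is lost is of
  order \<open>p s\<^sup>2\<close>, uniformly. The condition on \<open>s\<close> keeps \<open>1 + \<sigma> u\<close> between \<open>1/2\<close> and \<open>3/2\<close>.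
\<close>

lemma supersolution:
  assumes u: "\<And>w. w \<in> lists X \<Longrightarrow> k \<le> length w \<Longrightarrow> \<bar>u w\<bar> \<le> U"
    and poisson: "\<And>w. w \<in> lists X \<Longrightarrow> k \<le> length w \<Longrightarrow>
      (\<Sum>q\<in>X. M (q # w) * u (q # w)) = M w * (u w - p) + (\<Sum>q\<in>X. M (q # w) * of_bool (a (q # w)))"
    and p: "0 \<le> p" and s: "0 \<le> s" "s * (2 * U + 1) \<le> 1"
    and w: "w \<in> lists X" "k \<le> length w"
    and \<sigma>: "\<sigma> = s - (U + 1/2) * s\<^sup>2"
  shows "(\<Sum>q\<in>X. M (q # w) * exp (- s * of_bool (a (q # w))) * (1 + \<sigma> * u (q # w)))
      \<le> M w * (1 + \<sigma> * u w) * exp (- p * (s - (2 * U + 1/2) * s\<^sup>2))"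
    and "\<bar>\<sigma> * u w\<bar> \<le> 1 / 2"
proof -
  have U: "0 \<le> U" using u[OF w] by linarith
  have \<sigma>_eq: "\<sigma> = s * (1 - s * (2 * U + 1) / 2)" by (simp add: \<sigma> power2_eq_square algebra_simps)
  have \<sigma>0: "0 \<le> \<sigma>" unfolding \<sigma>_eq using s by (intro mult_nonneg_nonneg) auto
  have \<sigma>s: "\<sigma> \<le> s" using U by (simp add: \<sigma>)
  have sU: "s * U \<le> 1 / 2" using s by (simp add: algebra_simps)
  have \<sigma>u: "\<bar>\<sigma> * u w\<bar> \<le> s * U" if "w \<in> lists X" "k \<le> length w" for w
    using u[OF that] \<sigma>0 \<sigma>s U s by (simp add: abs_mult mult_mono)
  then show "\<bar>\<sigma> * u w\<bar> \<le> 1 / 2" using sU w by force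
  define d where "d = 1 - exp (- s)"
  have d: "s - s\<^sup>2 / 2 \<le> d" "d \<le> s" unfolding d_def using one_minus_exp_neg_bounds[OF s(1)] by auto
  have d0: "0 \<le> d" using s by (simp add: d_def)
  have step: "exp (- s * of_bool (a (q # w))) * (1 + \<sigma> * u (q # w))
      \<le> 1 + \<sigma> * u (q # w) - (d - s\<^sup>2 * U) * of_bool (a (q # w))" if "q \<in> X" for q
  proof (cases "a (q # w)")
    case True
    have "\<bar>d * (\<sigma> * u (q # w))\<bar> \<le> s * (s * U)"
      unfolding abs_mult[of d] using \<sigma>u[of "q # w"] that w d d0 s U by (intro mult_mono) auto
    then have "- (d * (\<sigma> * u (q # w))) \<le> s\<^sup>2 * U" by (simp add: power2_eq_square mult_ac)
    moreover have "exp (- s * of_bool (a (q # w))) * (1 + y) = 1 + y - d - d * y" for y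
      using True by (simp add: d_def algebra_simps)
    ultimately show ?thesis using True by simp
  qed simp
  define A where "A = (\<Sum>q\<in>X. M (q # w) * of_bool (a (q # w)))"
  have A: "0 \<le> A" unfolding A_def using w by (intro sum_nonneg mult_nonneg_nonneg less_imp_le[OF M_pos]) auto
  have "(\<Sum>q\<in>X. M (q # w) * exp (- s * of_bool (a (q # w))) * (1 + \<sigma> * u (q # w)))
      \<le> (\<Sum>q\<in>X. M (q # w) * (1 + \<sigma> * u (q # w) - (d - s\<^sup>2 * U) * of_bool (a (q # w))))"
    unfolding mult.assoc[of "M _"] using w by (intro sum_mono mult_left_mono step less_imp_le[OF M_pos]) auto
  also have "\<dots> = (\<Sum>q\<in>X. M (q # w)) + \<sigma> * (\<Sum>q\<in>X. M (q # w) * u (q # w)) - (d - s\<^sup>2 * U) * A"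
    unfolding A_def by (simp add: sum.distrib sum_subtractf sum_distrib_left algebra_simps)
  also have "\<dots> = M w * (1 + \<sigma> * u w - \<sigma> * p) + (\<sigma> - d + s\<^sup>2 * U) * A"
    unfolding M_Cons[OF w(1)] poisson[OF w] A_def[symmetric] by (simp add: algebra_simps)
  also have "\<dots> \<le> M w * (1 + \<sigma> * u w - \<sigma> * p)"
  proof -
    have "\<sigma> - d + s\<^sup>2 * U \<le> 0" using d(1) by (simp add: \<sigma> algebra_simps)
    then show ?thesis using A by (simp add: mult_nonpos_nonneg)
  qed
  also have "\<dots> \<le> M w * ((1 + \<sigma> * u w) * exp (- p * (s - (2 * U + 1/2) * s\<^sup>2)))"
  proof (intro mult_left_mono less_imp_le[OF M_pos[OF w(1)]])
    define \<kappa> where "\<kappa> = s - (2 * U + 1/2) * s\<^sup>2"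
    have "\<kappa> = s * (1 - s * (2 * U + 1) + s / 2)" by (simp add: \<kappa>_def power2_eq_square algebra_simps)
    then have \<kappa>0: "0 \<le> \<kappa>" using s by simp
    have h: "1 + \<sigma> * u w \<le> 1 + s * U" "0 \<le> 1 + \<sigma> * u w" using \<sigma>u[OF w] sU by linarith+
    have "(1 + \<sigma> * u w) * \<kappa> \<le> (1 + s * U) * \<kappa>" using h \<kappa>0 by (intro mult_right_mono) auto
    also have "\<dots> = \<sigma> - s\<^sup>2 * s * U * (2 * U + 1/2)"
      by (simp add: \<kappa>_def \<sigma> power2_eq_square algebra_simps)
    also have "\<dots> \<le> \<sigma>" using s U by simp
    finally have "p * ((1 + \<sigma> * u w) * \<kappa>) \<le> p * \<sigma>" using p by (intro mult_left_mono) auto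
    then have "1 + \<sigma> * u w - \<sigma> * p \<le> (1 + \<sigma> * u w) * (1 + (- p * \<kappa>))" by (simp add: algebra_simps)
    also have "\<dots> \<le> (1 + \<sigma> * u w) * exp (- p * \<kappa>)"
      using h exp_ge_add_one_self[of "- p * \<kappa>"] by (intro mult_left_mono) auto
    finally show "1 + \<sigma> * u w - \<sigma> * p \<le> (1 + \<sigma> * u w) * exp (- p * \<kappa>)" .
  qed
  finally show "(\<Sum>q\<in>X. M (q # w) * exp (- s * of_bool (a (q # w))) * (1 + \<sigma> * u (q # w)))
      \<le> M w * (1 + \<sigma> * u w) * exp (- p * (s - (2 * U + 1/2) * s\<^sup>2))" by (simp only: mult.assoc)
qed

text \<open>
  The supersolution property is applied letter by letter, from the front of the word. The weight
  of a letter depends on the whole word behind it, which is why \<open>H\<close> is a function of words of all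
  lengths at least \<open>k\<close>.
\<close>

lemma laplace_bound:
  assumes super: "\<And>w. w \<in> lists X \<Longrightarrow> k \<le> length w \<Longrightarrow>
      (\<Sum>q\<in>X. M (q # w) * exp (- s * of_bool (a (q # w))) * H (q # w)) \<le> M w * H w * \<Lambda>"
    and "0 \<le> \<Lambda>" and w: "w \<in> lists X" "k \<le> length w"
  shows "(\<Sum>v\<in>words X T. M (v @ w) * exp (- s * real (card {j\<in>{..<T}. a (drop j (v @ w))})) * H (v @ w))
      \<le> M w * H w * \<Lambda> ^ T"
proof (induction T)
  case (Suc T)
  let ?N = "\<lambda>T x. card {j\<in>{..<T}. a (drop j x)}"
  have N: "real (?N (Suc T) (q # x)) = of_bool (a (q # x)) + real (?N T x)" for q x
  proof -
    have "{j\<in>{..<Suc T}. a (drop j (q # x))} = {j\<in>{0}. a (q # x)} \<union> Suc ` {j\<in>{..<T}. a (drop j x)}"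
      by (auto simp: image_iff less_Suc_eq_0_disj)
    also have "card \<dots> = card {j\<in>{0::nat}. a (q # x)} + card (Suc ` {j\<in>{..<T}. a (drop j x)})"
      by (intro card_Un_disjoint) auto
    also have "card {j\<in>{0::nat}. a (q # x)} = of_bool (a (q # x))" by (cases "a (q # x)") auto
    finally show ?thesis by (simp add: card_image)
  qed
  have "(\<Sum>v\<in>words X (Suc T). M (v @ w) * exp (- s * real (?N (Suc T) (v @ w))) * H (v @ w))
      = (\<Sum>v\<in>words X T. exp (- s * real (?N T (v @ w))) *
          (\<Sum>q\<in>X. M (q # v @ w) * exp (- s * of_bool (a (q # v @ w))) * H (q # v @ w)))"
    by (simp only: sum_words_Cons append_Cons N distrib_left exp_add sum_distrib_left mult_ac)
  also have "\<dots> \<le> (\<Sum>v\<in>words X T. exp (- s * real (?N T (v @ w))) * (M (v @ w) * H (v @ w) * \<Lambda>))"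
    using w by (intro sum_mono mult_left_mono super) (auto simp: words_def)
  also have "\<dots> = (\<Sum>v\<in>words X T. M (v @ w) * exp (- s * real (?N T (v @ w))) * H (v @ w)) * \<Lambda>"
    by (subst sum_distrib_right) (simp only: mult_ac)
  also have "\<dots> \<le> (M w * H w * \<Lambda> ^ T) * \<Lambda>" using Suc \<open>0 \<le> \<Lambda>\<close> by (intro mult_right_mono)
  finally show ?case by (simp add: mult_ac)
qed simp

text \<open>
  The exponential Markov inequality for \<open>exp (- s N)\<close>, \<open>N\<close> the number of hits, with exponent
  \<open>s n - T p (s - \<gamma> s\<^sup>2) \<le> - \<epsilon> s n + 2 \<gamma> s\<^sup>2 n + 1\<close>. The optimal \<open>s = \<epsilon> / (4 \<gamma>)\<close> is admissible for
  all \<open>\<epsilon> < 1\<close>. The factor 3 bounds the ratio of the extreme values of \<open>H\<close>, and \<open>exp 1\<close> pays for the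
  rounding of \<open>T\<close>.
\<close>

theorem few_hits_tail:
  assumes "2 \<le> card X"
  obtains c where "0 < c"
    and "\<And>A k T n \<epsilon>. A \<subseteq> words X k \<Longrightarrow> (\<And>m. card (cut_words X k A m) \<le> 2) \<Longrightarrow>
      0 < \<epsilon> \<Longrightarrow> \<epsilon> < 1 \<Longrightarrow> real n * (1 + \<epsilon>) - 1 \<le> real T * (\<Sum>a\<in>A. M a) \<Longrightarrow>
      (\<Sum>w | w \<in> words X (T + k) \<and> card {j\<in>{..<T}. hits k A (drop j w)} < n. M w)
        \<le> 3 * exp 1 * exp (- c * \<epsilon>\<^sup>2 * real n)"
proof -
  obtain D \<rho> where D: "0 < D" and \<rho>: "0 < \<rho>" "\<rho> < 1"
    and dec: "\<And>A k w n. A \<subseteq> words X k \<Longrightarrow> (\<And>m. card (cut_words X k A m) \<le> 2) \<Longrightarrow>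
       w \<in> lists X \<Longrightarrow> k \<le> length w \<Longrightarrow>
       \<bar>(\<Sum>v\<in>words X n. M (v @ w) * of_bool (hits k A (v @ w))) - (\<Sum>a\<in>A. M a) * M w\<bar>
         \<le> D * \<rho> ^ n * M w"
    using hitting_decay[OF assms] by blast
  define U where "U = D / (1 - \<rho>)"
  have U: "0 < U" using D \<rho> by (simp add: U_def)
  define \<gamma> where "\<gamma> = 2 * U + 1 / 2"
  have \<gamma>: "0 < \<gamma>" using U by (simp add: \<gamma>_def)
  show ?thesis
  proof (rule that[of "1 / (8 * \<gamma>)"])
    show "0 < 1 / (8 * \<gamma>)" using \<gamma> by simp
    fix A k T n \<epsilon>
    assume A: "A \<subseteq> words X k" and cut: "\<And>m. card (cut_words X k A m) \<le> 2"
      and \<epsilon>: "0 < \<epsilon>" "\<epsilon> < (1::real)" and T: "real n * (1 + \<epsilon>) - 1 \<le> real T * (\<Sum>a\<in>A. M a)"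
    define p where "p = (\<Sum>a\<in>A. M a)"
    have p: "0 \<le> p" unfolding p_def using A by (intro sum_nonneg less_imp_le M_pos) (auto simp: words_def)
    have dec_A: "\<bar>(\<Sum>v\<in>words X i. M (v @ w) * of_bool (hits k A (v @ w))) - p * M w\<bar> \<le> D * \<rho> ^ i * M w"
      if "w \<in> lists X" "k \<le> length w" for w i
      unfolding p_def by (rule dec[OF A cut that])
    have "\<exists>u. (\<forall>w. w \<in> lists X \<longrightarrow> k \<le> length w \<longrightarrow> \<bar>u w\<bar> \<le> U) \<and>
        (\<forall>w. w \<in> lists X \<longrightarrow> k \<le> length w \<longrightarrow>
          (\<Sum>q\<in>X. M (q # w) * u (q # w)) = M w * (u w - p) + (\<Sum>q\<in>X. M (q # w) * of_bool (hits k A (q # w))))"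
      by (rule poisson_solution[where a = "\<lambda>w. of_bool (hits k A w)", OF dec_A \<rho>, folded U_def]) blast+
    then obtain u where u: "\<And>w. w \<in> lists X \<Longrightarrow> k \<le> length w \<Longrightarrow> \<bar>u w\<bar> \<le> U"
      and poisson: "\<And>w. w \<in> lists X \<Longrightarrow> k \<le> length w \<Longrightarrow>
        (\<Sum>q\<in>X. M (q # w) * u (q # w)) = M w * (u w - p) + (\<Sum>q\<in>X. M (q # w) * of_bool (hits k A (q # w)))"
      by blast
    define s where "s = \<epsilon> / (4 * \<gamma>)"
    have "\<epsilon> * (2 * U + 1) \<le> 1 * (4 * \<gamma>)"
      using \<epsilon> U by (intro mult_mono) (auto simp: \<gamma>_def)
    then have s: "0 \<le> s" "s * (2 * U + 1) \<le> 1" "s \<le> 1"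
      using \<epsilon> U by (auto simp: s_def \<gamma>_def field_simps)
    define \<sigma> where "\<sigma> = s - (U + 1/2) * s\<^sup>2"
    define H where "H w = 1 + \<sigma> * u w" for w
    define \<kappa> where "\<kappa> = s - \<gamma> * s\<^sup>2"
    have sup: "(\<Sum>q\<in>X. M (q # w) * exp (- s * of_bool (hits k A (q # w))) * H (q # w)) \<le> M w * H w * exp (- p * \<kappa>)"
      "\<bar>\<sigma> * u w\<bar> \<le> 1 / 2" if w: "w \<in> lists X" "k \<le> length w" for w
      unfolding H_def \<kappa>_def \<gamma>_def
    proof -
      show "(\<Sum>q\<in>X. M (q # w) * exp (- s * of_bool (hits k A (q # w))) * (1 + \<sigma> * u (q # w)))
          \<le> M w * (1 + \<sigma> * u w) * exp (- p * (s - (2 * U + 1 / 2) * s\<^sup>2))"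
        using u poisson p s(1,2) w \<sigma>_def by (rule supersolution(1))
      show "\<bar>\<sigma> * u w\<bar> \<le> 1 / 2"
        using u poisson p s(1,2) w \<sigma>_def by (rule supersolution(2))
    qed
    have H: "1 / 2 \<le> H w" "H w \<le> 3 / 2" if "w \<in> lists X" "k \<le> length w" for w
      using sup(2)[OF that] unfolding H_def by linarith+
    let ?N = "\<lambda>x. card {j\<in>{..<T}. hits k A (drop j x)}"
    have lap: "(\<Sum>v\<in>words X T. M (v @ w) * exp (- s * real (?N (v @ w))) * H (v @ w))
        \<le> M w * H w * exp (- p * \<kappa>) ^ T" if "w \<in> lists X" "k \<le> length w" for w
      using sup(1) exp_ge_zero that by (rule laplace_bound)
    have total: "(\<Sum>x\<in>words X (T + k). M x * exp (- s * real (?N x))) \<le> 3 * exp (- p * \<kappa>) ^ T"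
    proof -
      have "(\<Sum>x\<in>words X (T + k). M x * exp (- s * real (?N x)))
          \<le> (\<Sum>x\<in>words X (T + k). 2 * (M x * exp (- s * real (?N x)) * H x))"
      proof (intro sum_mono)
        fix x assume "x \<in> words X (T + k)"
        then have x: "x \<in> lists X" "k \<le> length x" by (auto simp: words_def)
        have "M x * exp (- s * real (?N x)) * 1 \<le> M x * exp (- s * real (?N x)) * (2 * H x)"
          using H(1)[OF x] M_pos[OF x(1)] by (intro mult_left_mono) auto
        then show "M x * exp (- s * real (?N x)) \<le> 2 * (M x * exp (- s * real (?N x)) * H x)" by simp
      qed
      also have "\<dots> = 2 * (\<Sum>w\<in>words X k. \<Sum>v\<in>words X T. M (v @ w) * exp (- s * real (?N (v @ w))) * H (v @ w))"
        by (simp add: sum_words_append sum_distrib_left sum.swap[of _ "words X T"])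
      also have "\<dots> \<le> 2 * (\<Sum>w\<in>words X k. M w * (3 / 2) * exp (- p * \<kappa>) ^ T)"
      proof (intro mult_left_mono sum_mono)
        fix w assume "w \<in> words X k"
        then have w: "w \<in> lists X" "k \<le> length w" by (auto simp: words_def)
        have "M w * H w * exp (- p * \<kappa>) ^ T \<le> M w * (3 / 2) * exp (- p * \<kappa>) ^ T"
          using H(2)[OF w] M_pos[OF w(1)] by (intro mult_right_mono mult_left_mono) auto
        then show "(\<Sum>v\<in>words X T. M (v @ w) * exp (- s * real (?N (v @ w))) * H (v @ w))
            \<le> M w * (3 / 2) * exp (- p * \<kappa>) ^ T" using lap[OF w] by linarith
      qed simp
      also have "\<dots> = 3 * exp (- p * \<kappa>) ^ T * (\<Sum>w\<in>words X k. M w)"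
        by (subst (1 2) sum_distrib_left) (simp add: mult_ac)
      finally show ?thesis by (simp add: M_total)
    qed
    have "(\<Sum>w | w \<in> words X (T + k) \<and> ?N w < n. M w)
        \<le> (\<Sum>w | w \<in> words X (T + k) \<and> ?N w < n. exp (s * real n) * (M w * exp (- s * real (?N w))))"
    proof (intro sum_mono)
      fix w assume w: "w \<in> {w \<in> words X (T + k). ?N w < n}"
      then have "s * real (?N w) \<le> s * real n" using s by (intro mult_left_mono) auto
      then have "M w * 1 \<le> M w * exp (s * real n + - s * real (?N w))"
        using w M_pos[of w] by (intro mult_left_mono) (auto simp: words_def less_imp_le)
      then show "M w \<le> exp (s * real n) * (M w * exp (- s * real (?N w)))"
        unfolding exp_add by (simp add: mult_ac)
    qed
    also have "\<dots> \<le> (\<Sum>w\<in>words X (T + k). exp (s * real n) * (M w * exp (- s * real (?N w))))"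
      using fin_X by (intro sum_mono2) (auto dest: wordsD(1) intro!: mult_nonneg_nonneg less_imp_le[OF M_pos])
    also have "\<dots> \<le> exp (s * real n) * (3 * exp (- p * \<kappa>) ^ T)"
      unfolding sum_distrib_left[symmetric] by (intro mult_left_mono total) auto
    also have "\<dots> = 3 * exp (s * real n - real T * p * \<kappa>)"
    proof -
      have "exp (- p * \<kappa>) ^ T = exp (real T * (- p * \<kappa>))" by (rule exp_of_nat_mult[symmetric])
      moreover have "exp (s * real n) * exp (real T * (- p * \<kappa>)) = exp (s * real n - real T * p * \<kappa>)"
        unfolding mult_exp_exp by simp
      ultimately show ?thesis by simp
    qed
    also have "\<dots> \<le> 3 * exp (1 - 1 / (8 * \<gamma>) * \<epsilon>\<^sup>2 * real n)"
    proof -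
      have "s * real n - real T * p * \<kappa> \<le> 1 - 1 / (8 * \<gamma>) * \<epsilon>\<^sup>2 * real n"
      proof -
        have \<gamma>s: "\<gamma> * s\<^sup>2 = s * \<epsilon> / 4" using \<gamma> by (simp add: s_def power2_eq_square)
        then have \<kappa>: "\<kappa> = s * (1 - \<epsilon> / 4)" by (simp add: \<kappa>_def algebra_simps)
        then have \<kappa>0: "0 \<le> \<kappa>" "\<kappa> \<le> 1" using s \<epsilon> by (auto intro: mult_le_one simp: mult_le_one)
        have "(real n * (1 + \<epsilon>) - 1) * \<kappa> \<le> real T * p * \<kappa>"
          using T \<kappa>0 unfolding p_def by (intro mult_right_mono) auto
        then have "s * real n - real T * p * \<kappa> \<le> s * real n - real n * (1 + \<epsilon>) * \<kappa> + 1"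
          using \<kappa>0 by (simp add: algebra_simps)
        also have "\<dots> = 1 - real n * s * (\<epsilon> * (3 - \<epsilon>) / 4)" 
        proof -
          have "(1 + \<epsilon>) * (1 - \<epsilon> / 4) = 1 + \<epsilon> * (3 - \<epsilon>) / 4" 
            by (simp add: field_simps)
          then have "real n * s * ((1 + \<epsilon>) * (1 - \<epsilon> / 4)) = real n * s * (1 + \<epsilon> * (3 - \<epsilon>) / 4)" by simp
          moreover have "real n * (1 + \<epsilon>) * \<kappa> = real n * s * ((1 + \<epsilon>) * (1 - \<epsilon> / 4))" by (simp add: \<kappa>)
          ultimately show ?thesis by (simp add: distrib_left mult.commute)
        qed
        also have "\<dots> \<le> 1 - real n * s * (\<epsilon> / 2)"
        proof -
          have "\<epsilon> * 2 \<le> \<epsilon> * (3 - \<epsilon>)" using \<epsilon> by (intro mult_left_mono) auto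
          then have "\<epsilon> / 2 \<le> \<epsilon> * (3 - \<epsilon>) / 4" by simp
          then have "real n * s * (\<epsilon> / 2) \<le> real n * s * (\<epsilon> * (3 - \<epsilon>) / 4)"
            using s by (intro mult_left_mono) auto
          then show ?thesis by simp
        qed
        also have "\<dots> = 1 - 1 / (8 * \<gamma>) * \<epsilon>\<^sup>2 * real n" by (simp add: s_def power2_eq_square)
        finally show ?thesis .
      qed
      then show ?thesis by simp
    qed
    finally show "(\<Sum>w | w \<in> words X (T + k) \<and> ?N w < n. M w)
        \<le> 3 * exp 1 * exp (- (1 / (8 * \<gamma>)) * \<epsilon>\<^sup>2 * real n)"
      by (simp add: mult.assoc mult_exp_exp)
  qed
qed

end

section \<open>Cylinders of a full-branched map\<close>

primrec cyl :: "real set \<Rightarrow> (real \<Rightarrow> real) \<Rightarrow> real set list \<Rightarrow> real set" where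
  "cyl I f [] = I"
| "cyl I f (p # w) = {x \<in> p. f x \<in> cyl I f w}"

lemma disjoint_intervals_ordered:
  fixes p q :: "real set"
  assumes "is_interval p" "is_interval q" "\<And>x. x \<in> p \<Longrightarrow> x \<notin> q"
    and ab: "a \<in> p" "b \<in> q" "a < b" and xy: "x \<in> p" "y \<in> q"
  shows "x < y"
proof (rule ccontr)
  assume "\<not> x < y"
  show False
  proof (cases "y \<le> a")
    case True
    then have "a \<in> q" using assms(2) xy ab unfolding is_interval_1 by (meson less_imp_le)
    then show False using assms(3) ab by blast
  next
    case False
    then have "y \<in> p" using assms(1) xy ab \<open>\<not> x < y\<close> unfolding is_interval_1 by (meson linorder_not_le less_imp_le not_less)
    then show False using assms(3) xy by blast
  qed
qed

lemma bounded_if_bdd: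
  fixes a :: "real set"
  assumes "bdd_above a" "bdd_below a" shows "bounded a"
proof -
  obtain l u where "\<forall>x\<in>a. x \<le> u" "\<forall>x\<in>a. l \<le> x" using assms unfolding bdd_above_def bdd_below_def by blast
  then have "a \<subseteq> {l..u}" by auto
  then show ?thesis by (rule bounded_subset[OF bounded_closed_interval])
qed

locale full_branched =
  fixes I :: "real set" and \<P> :: "real set set" and f :: "real \<Rightarrow> real"
  assumes full: "full_branched_map I \<P> f"
begin

lemma interval_I: "is_interval I"
  and interior_I: "interior I \<noteq> {}"
  and finite_P: "finite \<P>"
  and partition_P: "partition_on I \<P>"
  and interval_P: "p \<in> \<P> \<Longrightarrow> is_interval p"
  using full by (auto simp: full_branched_map_def)

lemma P_subset: "p \<in> \<P> \<Longrightarrow> p \<subseteq> I"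
  using partition_P by (auto simp: partition_on_def)

lemma P_cover: "x \<in> I \<Longrightarrow> \<exists>p\<in>\<P>. x \<in> p"
  using partition_P by (auto simp: partition_on_def)

lemma P_disjoint: "p \<in> \<P> \<Longrightarrow> q \<in> \<P> \<Longrightarrow> x \<in> p \<Longrightarrow> x \<in> q \<Longrightarrow> p = q"
  using partition_P by (auto simp: partition_on_def disjoint_def)

lemma branch_extension:
  assumes "p \<in> \<P>"
  shows "\<exists>g. (\<forall>x\<in>p. g x = f x) \<and> bij_betw g (closure p) I \<and> continuous_on (closure p) g"
proof -
  obtain g where g: "\<forall>x\<in>p. g x = f x" "diffeomorphism_on (closure p) I g"
    using full assms unfolding full_branched_map_def by blast
  then have "C_k_on (Suc 0) (closure p) g" "bij_betw g (closure p) I"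
    by (auto simp: diffeomorphism_on_def)
  moreover from this have "continuous_on (closure p) g"
    by (auto intro: DERIV_continuous_on)
  ultimately show ?thesis using g(1) by blast
qed

lemma f_maps: "x \<in> I \<Longrightarrow> f x \<in> I"
proof -
  assume "x \<in> I"
  then obtain p where p: "p \<in> \<P>" "x \<in> p" using P_cover by blast
  obtain g where g: "\<forall>x\<in>p. g x = f x" "bij_betw g (closure p) I"
    using branch_extension[OF p(1)] by blast
  have "g x \<in> I" using g(2) p(2) closure_subset by (auto simp: bij_betw_def)
  then show ?thesis using g p by simp
qed

lemma inj_on_branch: "p \<in> \<P> \<Longrightarrow> inj_on f p"
proof -
  assume p: "p \<in> \<P>"
  obtain g where g: "\<forall>x\<in>p. g x = f x" "bij_betw g (closure p) I"
    using branch_extension[OF p] by blast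
  have "inj_on g p" using g(2) closure_subset by (auto simp: bij_betw_def intro: inj_on_subset)
  then show ?thesis using g(1) by (simp cong: inj_on_cong)
qed

lemma continuous_branch: "p \<in> \<P> \<Longrightarrow> continuous_on p f"
proof -
  assume p: "p \<in> \<P>"
  obtain g where g: "\<forall>x\<in>p. g x = f x" "continuous_on (closure p) g"
    using branch_extension[OF p] by blast
  have "continuous_on p g" using g(2) closure_subset by (rule continuous_on_subset)
  then show ?thesis using g(1) by (simp cong: continuous_on_cong)
qed

lemma infinite_I: "infinite I"
proof
  assume fin: "finite I"
  obtain x where "x \<in> interior I" using interior_I by blast
  then obtain e where e: "0 < e" "ball x e \<subseteq> I" by (auto simp: mem_interior)
  have "{x<..<x + e} \<subseteq> ball x e" by (auto simp: dist_real_def)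
  then have "finite {x<..<x + e}" using e fin by (blast intro: finite_subset)
  then show False using e infinite_Ioo[of x "x + e"] by simp
qed

lemma P_nondegenerate:
  assumes p: "p \<in> \<P>"
  shows "\<exists>a b. a \<in> p \<and> b \<in> p \<and> a < b"
proof -
  have "\<not> (\<exists>c. p \<subseteq> {c})"
  proof
    assume "\<exists>c. p \<subseteq> {c}"
    then obtain c where "p \<subseteq> {c}" by blast
    then have "closure p \<subseteq> {c}" by (intro closure_minimal) auto
    then have "finite (closure p)" by (rule finite_subset) simp
    moreover obtain g where "bij_betw g (closure p) I" using branch_extension[OF p] by blast
    ultimately have "finite I" by (simp add: bij_betw_finite)
    then show False using infinite_I by simp
  qed
  then have "\<exists>a b. a \<in> p \<and> b \<in> p \<and> a \<noteq> b" by blast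
  then obtain a b where "a \<in> p" "b \<in> p" "a \<noteq> b" by blast
  then show ?thesis by (cases a b rule: linorder_cases) auto
qed

lemma interior_P: "p \<in> \<P> \<Longrightarrow> interior p \<noteq> {}"
proof -
  assume p: "p \<in> \<P>"
  obtain a b where ab: "a \<in> p" "b \<in> p" "a < b" using P_nondegenerate[OF p] by blast
  then have "{a<..<b} \<subseteq> p" using interval_P[OF p] unfolding is_interval_1 by (meson greaterThanLessThan_iff less_imp_le subsetI)
  then have "{a<..<b} \<subseteq> interior p" by (intro interior_maximal) auto
  moreover have "(a + b) / 2 \<in> {a<..<b}" using ab by auto
  ultimately show ?thesis by blast
qed

subsection \<open>Cylinders as intervals\<close>

abbreviation cy where "cy \<equiv> cyl I f"

lemma cyl_subset: "w \<in> lists \<P> \<Longrightarrow> cy w \<subseteq> I"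
  using P_subset by (cases w) auto

lemma cyl_append: "x \<in> cy (v @ w) \<Longrightarrow> w \<in> lists \<P> \<Longrightarrow> v \<in> lists \<P> \<Longrightarrow> x \<in> cy v"
proof (induction v arbitrary: x rule: list.induct)
  case Nil
  then show ?case using cyl_subset[of w] by auto
qed auto

lemma cyl_drop: "x \<in> cy w \<Longrightarrow> j \<le> length w \<Longrightarrow> (f ^^ j) x \<in> cy (drop j w)"
proof (induction j arbitrary: x w)
  case (Suc j)
  then obtain p v where w: "w = p # v" by (cases w) auto
  then have "(f ^^ j) (f x) \<in> cy (drop j v)" using Suc by auto
  then show ?case by (simp add: w funpow_swap1)
qed simp

lemma cyl_unique:
  assumes "x \<in> cy v" "x \<in> cy w" "v \<in> lists \<P>" "w \<in> lists \<P>" "length v = length w"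
  shows "v = w"
  using assms(5,1-4)
proof (induction v w arbitrary: x rule: list_induct2)
  case (Cons p v q w)
  then have "v = w" by auto
  moreover have "p = q" using Cons.prems by (intro P_disjoint[of p q x]) auto
  ultimately show ?case by simp
qed simp

lemma cyl_exists: "x \<in> I \<Longrightarrow> \<exists>w\<in>words \<P> n. x \<in> cy w"
proof (induction n arbitrary: x)
  case (Suc n)
  obtain w where w: "w \<in> words \<P> n" "f x \<in> cy w" using Suc.IH f_maps[OF Suc.prems] by blast
  obtain p where p: "p \<in> \<P>" "x \<in> p" using P_cover[OF Suc.prems] by blast
  show ?case using w p by (intro bexI[of _ "p # w"]) (auto simp: words_def)
qed simp

lemma interval_cyl: "w \<in> lists \<P> \<Longrightarrow> is_interval (cy w)"
proof (induction w rule: list.induct)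
  case (Cons p w)
  then have p: "p \<in> \<P>" and w: "is_interval (cy w)" by auto
  show ?case
    unfolding is_interval_1
  proof (intro ballI allI impI)
    fix a b x assume ab: "a \<in> cy (p # w)" "b \<in> cy (p # w)" and x: "a \<le> x \<and> x \<le> b"
    have sub: "{a..b} \<subseteq> p" using ab interval_P[OF p] unfolding is_interval_1 by auto
    have "x \<in> p" using x sub by auto
    moreover have "f x \<in> cy w"
    proof (cases "x = a \<or> x = b")
      case False
      then have "(f a < f x \<and> f x < f b) \<or> (f b < f x \<and> f x < f a)"
        using x by (intro continuous_inj_imp_mono continuous_on_subset[OF continuous_branch[OF p] sub]
            inj_on_subset[OF inj_on_branch[OF p] sub]) auto
      then show ?thesis using ab w unfolding is_interval_1 by (auto intro: less_imp_le)
    qed (use ab in auto)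
    ultimately show "x \<in> cy (p # w)" by simp
  qed
qed (simp add: interval_I)

text \<open>
  A branch maps its domain \<open>p\<close> onto \<open>I\<close> only up to the images of those endpoints that do not belong
  to \<open>p\<close>. Nonemptiness of cylinders is therefore not inductive, whereas having a nonempty open
  subset is.
\<close>

lemma cyl_open_subset: "w \<in> lists \<P> \<Longrightarrow> \<exists>U. open U \<and> U \<noteq> {} \<and> U \<subseteq> cy w"
proof (induction w rule: list.induct)
  case Nil
  show ?case using interior_I interior_subset[of I] open_interior[of I] by auto
next
  case (Cons p w)
  then have p: "p \<in> \<P>" and w: "w \<in> lists \<P>" by auto
  obtain U where U: "open U" "U \<noteq> {}" "U \<subseteq> cy w" using Cons by auto
  obtain g where g: "\<forall>x\<in>p. g x = f x" "bij_betw g (closure p) I" "continuous_on (closure p) g"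
    using branch_extension[OF p] by blast
  obtain y where "y \<in> U" using U by blast
  then have "y \<in> I" using U cyl_subset[OF w] by blast
  then obtain x where x: "x \<in> closure p" "g x \<in> U" using g(2) \<open>y \<in> U\<close> by (auto simp: bij_betw_def)
  obtain V where V: "open V" "V \<inter> closure p = g -` U \<inter> closure p"
    using g(3) U(1) unfolding continuous_on_open_invariant by blast
  have "convex p" using interval_P[OF p] by (simp add: is_interval_convex_1)
  then have "closure (interior p) = closure p"
    by (rule convex_closure_interior[OF _ interior_P[OF p]])
  then have "x \<in> closure (interior p)" "x \<in> V" using x V by auto
  then have "V \<inter> interior p \<noteq> {}"
    using open_Int_closure_eq_empty[OF V(1), of "interior p"] by blast
  moreover have "V \<inter> interior p \<subseteq> cy (p # w)"
  proof
    fix z assume z: "z \<in> V \<inter> interior p"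
    then have "z \<in> p" using interior_subset by blast
    then have "z \<in> V \<inter> closure p" using z closure_subset by blast
    then have "g z \<in> U" using V by auto
    then show "z \<in> cy (p # w)" using U(3) g(1) \<open>z \<in> p\<close> by auto
  qed
  moreover have "open (V \<inter> interior p)" using V by auto
  ultimately show ?case by blast
qed

lemma cyl_nonempty: "w \<in> lists \<P> \<Longrightarrow> cy w \<noteq> {}"
  using cyl_open_subset by blast

subsection \<open>Expansion and small cylinders\<close>

text \<open>
  If some branch has a bounded domain, then \<open>I\<close> is the continuous image of a compact set.
  Otherwise two branches have disjoint unbounded domains, so \<open>I\<close> is unbounded in both
  directions and the closure of the left domain has a maximum, which a monotone bijection would
  map to an endpoint of \<open>I\<close>.
\<close>

lemma bounded_P:
  assumes card: "2 \<le> card \<P>"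
  shows "\<exists>B>0. \<forall>p\<in>\<P>. \<forall>x\<in>p. \<forall>y\<in>p. \<bar>x - y\<bar> \<le> B"
proof -
  have "bounded I"
  proof (cases "\<exists>p\<in>\<P>. bounded p")
    case True
    then obtain p where p: "p \<in> \<P>" "bounded p" by blast
    obtain g where g: "bij_betw g (closure p) I" "continuous_on (closure p) g"
      using branch_extension[OF p(1)] by blast
    have "compact (g ` closure p)" using p(2) g(2) by (intro compact_continuous_image) auto
    moreover have "g ` closure p = I" using g(1) by (simp add: bij_betw_def)
    ultimately show ?thesis using compact_imp_bounded by simp
  next
    case False
    have "\<not> card \<P> \<le> Suc 0" using card by simp
    then obtain p q where pq: "p \<in> \<P>" "q \<in> \<P>" "p \<noteq> q"
      using finite_P by (auto simp: card_le_Suc0_iff_eq)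
    have disj: "x \<notin> q" if "x \<in> p" for x using P_disjoint[OF pq(1,2) that] pq(3) by blast
    have sep: "(\<forall>x\<in>p. \<forall>y\<in>q. x < y) \<or> (\<forall>x\<in>q. \<forall>y\<in>p. x < y)"
    proof -
      obtain a where a: "a \<in> p" using P_nondegenerate[OF pq(1)] by blast
      obtain b where b: "b \<in> q" using P_nondegenerate[OF pq(2)] by blast
      have "a \<noteq> b" using disj a b by blast
      then consider "a < b" | "b < a" by linarith
      then show ?thesis
      proof cases
        case 1
        have "x < y" if "x \<in> p" "y \<in> q" for x y
          using disjoint_intervals_ordered[OF interval_P[OF pq(1)] interval_P[OF pq(2)] disj a b 1 that] .
        then show ?thesis by blast
      next
        case 2
        have "x < y" if "x \<in> q" "y \<in> p" for x y
        proof (rule disjoint_intervals_ordered[OF interval_P[OF pq(2)] interval_P[OF pq(1)] _ b a 2 that])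
          show "z \<notin> p" if "z \<in> q" for z using disj[of z] that by blast
        qed
        then show ?thesis by blast
      qed
    qed
    have contra: False
      if ab: "a \<in> \<P>" "b \<in> \<P>" "\<And>x y. x \<in> a \<Longrightarrow> y \<in> b \<Longrightarrow> x < y" for a b
    proof -
      have "\<not> bounded a" "\<not> bounded b" using False ab by auto
      obtain y0 where y0: "y0 \<in> b" using P_nondegenerate[OF ab(2)] by blast
      obtain x0 where x0: "x0 \<in> a" using P_nondegenerate[OF ab(1)] by blast
      have bd: "bdd_above a" using ab(3)[OF _ y0] by (intro bdd_aboveI[of _ y0]) (rule less_imp_le)
      have "\<not> bdd_below a" using \<open>\<not> bounded a\<close> bounded_if_bdd[OF bd] by blast
      have "bdd_below b" using ab(3)[OF x0] by (intro bdd_belowI[of _ x0]) (rule less_imp_le)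
      then have "\<not> bdd_above b" using \<open>\<not> bounded b\<close> bounded_if_bdd[of b] by blast
      define m where "m = Sup a"
      have m: "m \<in> closure a" using closure_contains_Sup[of a] bd x0 by (auto simp: m_def)
      have "closure a \<subseteq> {..m}"
        using bd by (intro closure_minimal) (auto simp: m_def intro: cSup_upper)
      then have le_m: "x \<le> m" if "x \<in> closure a" for x using that by auto
      obtain g where g: "bij_betw g (closure a) I" "continuous_on (closure a) g"
        using branch_extension[OF ab(1)] by blast
      have img: "g ` closure a = I" and inj: "inj_on g (closure a)" using g(1) by (auto simp: bij_betw_def)
      have "convex (closure a)" using interval_P[OF ab(1)] by (simp add: is_interval_convex_1 convex_closure)
      then have icl: "is_interval (closure a)" by (simp add: is_interval_convex_1)
      have unb_I: "\<exists>z\<in>I. z < c" "\<exists>z\<in>I. c < z" for c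
      proof -
        obtain z where "z \<in> a" "\<not> c \<le> z" using \<open>\<not> bdd_below a\<close> unfolding bdd_below_def by blast
        then show "\<exists>z\<in>I. z < c" using P_subset[OF ab(1)] by (intro bexI[of _ z]) auto
        obtain z where "z \<in> b" "\<not> z \<le> c" using \<open>\<not> bdd_above b\<close> unfolding bdd_above_def by blast
        then show "\<exists>z\<in>I. c < z" using P_subset[OF ab(2)] by (intro bexI[of _ z]) auto
      qed
      obtain u v where uv: "u \<in> closure a" "g u < g m" "v \<in> closure a" "g m < g v"
      proof -
        obtain z z' where z: "z \<in> I" "z < g m" "z' \<in> I" "g m < z'" using unb_I[of "g m"] by blast
        obtain u where u: "u \<in> closure a" "z = g u" using z(1) unfolding img[symmetric] by (rule imageE)
        obtain v where v: "v \<in> closure a" "z' = g v" using z(3) unfolding img[symmetric] by (rule imageE)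
        show ?thesis by (rule that[OF u(1) _ v(1)]) (use z u v in auto)
      qed
      have "u \<noteq> m" "v \<noteq> m" using uv(2,4) by auto
      then have "u < m" "v < m" using le_m[OF uv(1)] le_m[OF uv(3)] by linarith+
      have key: False if "u < v" "v < m" "u \<in> closure a" "(g u < g m \<and> g m < g v) \<or> (g v < g m \<and> g m < g u)" for u v
      proof -
        have sub: "{u..m} \<subseteq> closure a" using icl that(3) m unfolding is_interval_1 by (meson atLeastAtMost_iff subsetI)
        have "(g u < g v \<and> g v < g m) \<or> (g m < g v \<and> g v < g u)"
          by (rule continuous_inj_imp_mono[OF that(1,2) continuous_on_subset[OF g(2) sub] inj_on_subset[OF inj sub]])
        then show False using that by linarith
      qed
      show False
      proof (cases u v rule: linorder_cases)
        case less
        show ?thesis by (rule key[OF less \<open>v < m\<close> uv(1)]) (simp add: uv)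
      next
        case equal
        then show ?thesis using uv(2,4) by simp
      next
        case greater
        show ?thesis by (rule key[OF greater \<open>u < m\<close> uv(3)]) (simp add: uv)
      qed
    qed
    from sep show ?thesis using contra[OF pq(1,2)] contra[OF pq(2,1)] by blast
  qed
  then obtain B where B: "\<forall>x\<in>I. \<bar>x\<bar> \<le> B" by (auto simp: bounded_iff)
  show ?thesis
  proof (intro exI[of _ "\<bar>B\<bar> * 2 + 1"] conjI ballI)
    fix p x y assume "p \<in> \<P>" "x \<in> p" "y \<in> p"
    then have "x \<in> I" "y \<in> I" using P_subset by auto
    then have "\<bar>x\<bar> \<le> B" "\<bar>y\<bar> \<le> B" using B by auto
    then show "\<bar>x - y\<bar> \<le> \<bar>B\<bar> * 2 + 1" by linarith
  qed simp
qed

lemma expansion: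
  obtains \<gamma> where "1 < \<gamma>" "\<And>p x y. p \<in> \<P> \<Longrightarrow> x \<in> p \<Longrightarrow> y \<in> p \<Longrightarrow> \<gamma> * \<bar>x - y\<bar> \<le> \<bar>f x - f y\<bar>"
proof -
  obtain \<gamma> where \<gamma>: "1 < \<gamma>" "\<forall>p\<in>\<P>. \<forall>x\<in>p. \<gamma> \<le> \<bar>deriv_within p f x\<bar>"
    using full unfolding full_branched_map_def by blast
  have less: "\<gamma> * \<bar>x - y\<bar> \<le> \<bar>f x - f y\<bar>" if p: "p \<in> \<P>" and xy: "x \<in> p" "y \<in> p" "x < y" for p x y
  proof -
    have "C_k_on (Suc (Suc 0)) p f" using full p by (auto simp: full_branched_map_def numeral_2_eq_2)
    then obtain D where D: "\<And>z. z \<in> p \<Longrightarrow> (f has_real_derivative D z) (at z within p)" by auto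
    have sub: "{x..y} \<subseteq> p"
      using interval_P[OF p] xy unfolding is_interval_1 by (meson atLeastAtMost_iff subsetI)
    have at: "at z within p = at z" if "x < z" "z < y" for z
      using that sub by (intro at_within_open_subset[of z "{x<..<y}"]) auto
    have "\<exists>l z. x < z \<and> z < y \<and> DERIV f z :> l \<and> f y - f x = (y - x) * l"
    proof (rule MVT[OF xy(3)])
      show "continuous_on {x..y} f" by (rule continuous_on_subset[OF continuous_branch[OF p] sub])
      fix z assume z: "x < z" "z < y"
      have "z \<in> p" using sub z by (intro subsetD[OF sub]) auto
      then have "(f has_real_derivative D z) (at z)" using D[of z] at[OF z] by simp
      then show "f differentiable (at z)" by (auto simp: real_differentiable_def)
    qed
    then obtain l z where lz: "x < z" "z < y" "DERIV f z :> l" "f y - f x = (y - x) * l" by blast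
    have "vector_derivative f (at z within p) = l"
      unfolding at[OF lz(1,2)] using lz(3)
      by (intro vector_derivative_at) (simp add: has_real_derivative_iff_has_vector_derivative)
    moreover have "z \<in> p" using sub lz by auto
    ultimately have "\<gamma> \<le> \<bar>l\<bar>" using \<gamma>(2) p by auto
    then have "\<bar>y - x\<bar> * \<gamma> \<le> \<bar>y - x\<bar> * \<bar>l\<bar>" by (intro mult_left_mono) auto
    also have "\<dots> = \<bar>f y - f x\<bar>" by (simp add: lz(4) abs_mult)
    finally show ?thesis by (simp add: abs_minus_commute mult.commute)
  qed
  have "\<gamma> * \<bar>x - y\<bar> \<le> \<bar>f x - f y\<bar>" if "p \<in> \<P>" "x \<in> p" "y \<in> p" for p x y
  proof (cases x y rule: linorder_cases)
    case greater
    then show ?thesis using less[of p y x] that by (simp add: abs_minus_commute)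
  qed (use less that in auto)
  then show ?thesis using that \<gamma>(1) by blast
qed

lemma cyl_diameter:
  assumes "2 \<le> card \<P>"
  obtains B \<gamma> where "0 < B" "1 < \<gamma>"
    "\<And>w x y. w \<in> lists \<P> \<Longrightarrow> w \<noteq> [] \<Longrightarrow> x \<in> cy w \<Longrightarrow> y \<in> cy w \<Longrightarrow> \<bar>x - y\<bar> \<le> B / \<gamma> ^ length w"
proof -
  obtain B where B: "0 < B" "\<forall>p\<in>\<P>. \<forall>x\<in>p. \<forall>y\<in>p. \<bar>x - y\<bar> \<le> B" using bounded_P[OF assms] by blast
  obtain \<gamma> where \<gamma>: "1 < \<gamma>" "\<And>p x y. p \<in> \<P> \<Longrightarrow> x \<in> p \<Longrightarrow> y \<in> p \<Longrightarrow> \<gamma> * \<bar>x - y\<bar> \<le> \<bar>f x - f y\<bar>"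
    by (rule expansion, rule that)
  have "\<bar>x - y\<bar> \<le> B * \<gamma> / \<gamma> ^ length w"
    if "w \<in> lists \<P>" "w \<noteq> []" "x \<in> cy w" "y \<in> cy w" for w x y
    using that
  proof (induction w arbitrary: x y rule: list.induct)
    case (Cons p w)
    then have p: "p \<in> \<P>" and w: "w \<in> lists \<P>" and xy: "x \<in> p" "y \<in> p" "f x \<in> cy w" "f y \<in> cy w" by auto
    show ?case
    proof (cases "w = []")
      case True
      then show ?thesis using B(2) p xy \<gamma>(1) by simp
    next
      case False
      have "\<gamma> * \<bar>x - y\<bar> \<le> \<bar>f x - f y\<bar>" by (rule \<gamma>(2)[OF p xy(1,2)])
      also have "\<dots> \<le> B * \<gamma> / \<gamma> ^ length w" by (rule Cons.IH[OF w False xy(3,4)])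
      finally show ?thesis using \<gamma>(1) by (simp add: field_simps)
    qed
  qed simp
  then show ?thesis using that[of "B * \<gamma>" \<gamma>] B(1) \<gamma>(1) by simp
qed

lemma holder_on_cylinders:
  assumes card: "2 \<le> card \<P>" and holder: "\<And>p. p \<in> \<P> \<Longrightarrow> holder_on p \<phi>"
  obtains H \<theta> where "0 \<le> H" "0 < \<theta>" "\<theta> < 1"
    "\<And>w x y. w \<in> lists \<P> \<Longrightarrow> w \<noteq> [] \<Longrightarrow> x \<in> cy w \<Longrightarrow> y \<in> cy w \<Longrightarrow> \<bar>\<phi> x - \<phi> y\<bar> \<le> H * \<theta> ^ length w"
proof -
  obtain B \<gamma> where B: "0 < B" and \<gamma>: "1 < \<gamma>"
    and diam: "\<And>w x y. w \<in> lists \<P> \<Longrightarrow> w \<noteq> [] \<Longrightarrow> x \<in> cy w \<Longrightarrow> y \<in> cy w \<Longrightarrow> \<bar>x - y\<bar> \<le> B / \<gamma> ^ length w"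
    by (rule cyl_diameter[OF card], rule that)
  have "\<forall>p\<in>\<P>. \<exists>\<alpha> K. 0 < \<alpha> \<and> (\<forall>x\<in>p. \<forall>y\<in>p. \<bar>\<phi> x - \<phi> y\<bar> \<le> K * \<bar>x - y\<bar> powr \<alpha>)"
    using holder unfolding holder_on_def by blast
  then obtain \<alpha> K where \<alpha>: "\<And>p. p \<in> \<P> \<Longrightarrow> 0 < \<alpha> p"
    and K: "\<And>p x y. p \<in> \<P> \<Longrightarrow> x \<in> p \<Longrightarrow> y \<in> p \<Longrightarrow> \<bar>\<phi> x - \<phi> y\<bar> \<le> K p * \<bar>x - y\<bar> powr \<alpha> p"
    by metis
  define H where "H = (\<Sum>p\<in>\<P>. \<bar>K p\<bar> * B powr \<alpha> p)"
  define \<theta> where "\<theta> = Max ((\<lambda>p. inverse \<gamma> powr \<alpha> p) ` \<P>)"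
  have ne: "\<P> \<noteq> {}" using card by auto
  have \<theta>_ge: "inverse \<gamma> powr \<alpha> p \<le> \<theta>" if "p \<in> \<P>" for p
    unfolding \<theta>_def using that finite_P by (intro Max_ge) auto
  have "\<theta> \<in> (\<lambda>p. inverse \<gamma> powr \<alpha> p) ` \<P>" unfolding \<theta>_def using finite_P ne by (intro Max_in) auto
  then obtain q where q: "q \<in> \<P>" "\<theta> = inverse \<gamma> powr \<alpha> q" by blast
  have "inverse \<gamma> powr \<alpha> q < 1 powr \<alpha> q"
    using \<gamma> \<alpha>[OF q(1)] by (intro powr_less_mono2) (auto simp: inverse_less_1_iff)
  then have \<theta>: "0 < \<theta>" "\<theta> < 1"
    using \<gamma> unfolding q(2) by auto
  have "\<bar>\<phi> x - \<phi> y\<bar> \<le> H * \<theta> ^ length w"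
    if w: "w \<in> lists \<P>" "w \<noteq> []" and xy: "x \<in> cy w" "y \<in> cy w" for w x y
  proof -
    obtain p v where pv: "w = p # v" using w by (cases w) auto
    have p: "p \<in> \<P>" "x \<in> p" "y \<in> p" using pv w xy by auto
    have "\<bar>\<phi> x - \<phi> y\<bar> \<le> K p * \<bar>x - y\<bar> powr \<alpha> p" by (rule K[OF p])
    also have "\<dots> \<le> \<bar>K p\<bar> * (B / \<gamma> ^ length w) powr \<alpha> p"
      using diam[OF w xy] \<alpha>[OF p(1)] by (intro mult_mono powr_mono2) auto
    also have "(B / \<gamma> ^ length w) powr \<alpha> p = B powr \<alpha> p * (inverse \<gamma> powr \<alpha> p) ^ length w"
    proof -
      have "(B / \<gamma> ^ length w) powr \<alpha> p = B powr \<alpha> p * (inverse \<gamma> ^ length w) powr \<alpha> p"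
        using B \<gamma> by (simp add: divide_inverse power_inverse powr_mult)
      also have "(inverse \<gamma> ^ length w) powr \<alpha> p = (inverse \<gamma> powr \<alpha> p) ^ length w"
        using \<gamma> by (simp add: powr_power powr_realpow[symmetric] powr_powr mult.commute)
      finally show ?thesis .
    qed
    also have "\<bar>K p\<bar> * (B powr \<alpha> p * (inverse \<gamma> powr \<alpha> p) ^ length w) \<le> \<bar>K p\<bar> * B powr \<alpha> p * \<theta> ^ length w"
      using \<theta>_ge[OF p(1)] unfolding mult.assoc by (intro mult_left_mono power_mono) auto
    also have "\<dots> \<le> H * \<theta> ^ length w"
    proof -
      have "\<bar>K p\<bar> * B powr \<alpha> p \<le> H"
        unfolding H_def using p finite_P by (intro member_le_sum[of p _ "\<lambda>p. \<bar>K p\<bar> * B powr \<alpha> p"]) auto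
      then show ?thesis using \<theta> by (intro mult_right_mono) auto
    qed
    finally show ?thesis .
  qed
  moreover have "0 \<le> H" unfolding H_def by (intro sum_nonneg) auto
  ultimately show ?thesis using that[of H \<theta>] \<theta> by blast
qed

lemma cylinders_eq: "cylinders I \<P> f n = cy ` words \<P> n"
proof -
  have word_set: "cy w = {x \<in> I. \<forall>i<length w. (f ^^ i) x \<in> w ! i}" if "w \<in> lists \<P>" for w
    using that
  proof (induction w rule: list.induct)
    case (Cons p w)
    then have p: "p \<in> \<P>" by auto
    have "x \<in> cy (p # w) \<longleftrightarrow> x \<in> I \<and> (\<forall>i<length (p # w). (f ^^ i) x \<in> (p # w) ! i)" for x
    proof -
      have "(\<forall>i<Suc (length w). (f ^^ i) x \<in> (p # w) ! i)
          \<longleftrightarrow> x \<in> p \<and> (\<forall>i<length w. (f ^^ i) (f x) \<in> w ! i)"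
        by (simp add: All_less_Suc2 funpow_swap1)
      then show ?thesis using Cons P_subset[OF p] f_maps by auto
    qed
    then show ?case by blast
  qed simp
  show ?thesis
  proof (intro equalityI subsetI)
    fix Q assume "Q \<in> cylinders I \<P> f n"
    then obtain p where p: "\<forall>i<n. p i \<in> \<P>" "Q = {x\<in>I. \<forall>i<n. (f ^^ i) x \<in> p i}"
      by (auto simp: cylinders_def)
    have w: "map p [0..<n] \<in> words \<P> n" using p by (auto simp: words_def)
    have "Q = cy (map p [0..<n])" using word_set[OF wordsD(1)[OF w]] p by simp
    then show "Q \<in> cy ` words \<P> n" using w by blast
  next
    fix Q assume "Q \<in> cy ` words \<P> n"
    then obtain w where w: "w \<in> words \<P> n" "Q = cy w" by blast
    then have wl: "w \<in> lists \<P>" "length w = n" by (auto simp: words_def)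
    have "Q \<noteq> {}" using cyl_nonempty[OF wl(1)] w by simp
    moreover have "\<forall>i<n. w ! i \<in> \<P>" using wl by (auto simp: in_lists_conv_set)
    moreover have "Q = {x\<in>I. \<forall>i<n. (f ^^ i) x \<in> w ! i}" using word_set[OF wl(1)] w wl by simp
    ultimately show "Q \<in> cylinders I \<P> f n" unfolding cylinders_def by blast
  qed
qed

definition inside :: "real set \<Rightarrow> nat \<Rightarrow> real set list set" where
  "inside A k = {w \<in> words \<P> k. cy w \<subseteq> A}"

lemma markov_hits_iff:
  assumes A: "\<Q> \<subseteq> cylinders I \<P> f k" "A = \<Union>\<Q>"
    and w: "w \<in> lists \<P>" "k \<le> length w" and x: "x \<in> cy w"
  shows "x \<in> A \<longleftrightarrow> hits k (inside A k) w"
proof -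
  have tk: "take k w \<in> words \<P> k" using w by (auto simp: words_def in_lists_conv_set dest: in_set_takeD)
  have dl: "drop k w \<in> lists \<P>" using w by (auto simp: in_lists_conv_set dest: in_set_dropD)
  have xt: "x \<in> cy (take k w)"
    using cyl_append[of x "take k w" "drop k w"] x dl wordsD(1)[OF tk] by simp
  show ?thesis
  proof
    assume "x \<in> A"
    then obtain v where v: "v \<in> words \<P> k" "x \<in> cy v" "cy v \<subseteq> A"
      using A unfolding cylinders_eq by blast
    have "v = take k w" using v tk xt by (intro cyl_unique[of x]) (auto simp: words_def)
    then show "hits k (inside A k) w" using v by (simp add: hits_def inside_def)
  next
    assume "hits k (inside A k) w"
    then show "x \<in> A" using xt by (auto simp: hits_def inside_def)
  qed
qed

text \<open>
  An interval that meets \<open>A\<close> and is not contained in \<open>A\<close> has a point to the left of \<open>A\<close> or a point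
  to the right of \<open>A\<close>. Two intervals of the same kind overlap, and distinct cylinders of the same
  length are disjoint.
\<close>

lemma card_cut_words:
  assumes A: "is_interval A" "\<Q> \<subseteq> cylinders I \<P> f k" "A = \<Union>\<Q>"
  shows "card (cut_words \<P> k (inside A k) m) \<le> 2"
proof -
  let ?C = "cut_words \<P> k (inside A k) m"
  have C: "q \<in> words \<P> m \<and> cy q \<inter> A \<noteq> {} \<and> cy q - A \<noteq> {}" if q: "q \<in> ?C" for q
  proof -
    obtain u v where u: "u \<in> words \<P> k" "hits k (inside A k) (q @ u)"
      and v: "v \<in> words \<P> k" "\<not> hits k (inside A k) (q @ v)" and qm: "q \<in> words \<P> m"
      using q by (auto simp: cut_words_def)
    have l: "q @ u \<in> lists \<P>" "q @ v \<in> lists \<P>" "k \<le> length (q @ u)" "k \<le> length (q @ v)"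
      "q \<in> lists \<P>" "u \<in> lists \<P>" "v \<in> lists \<P>"
      using u(1) v(1) qm by (auto simp: words_def)
    obtain x where x: "x \<in> cy (q @ u)" using cyl_nonempty[OF l(1)] by blast
    obtain y where y: "y \<in> cy (q @ v)" using cyl_nonempty[OF l(2)] by blast
    have "x \<in> A" using markov_hits_iff[OF A(2,3) l(1,3) x] u by simp
    moreover have "y \<notin> A" using markov_hits_iff[OF A(2,3) l(2,4) y] v by simp
    moreover have "x \<in> cy q" by (rule cyl_append[OF x l(6,5)])
    moreover have "y \<in> cy q" by (rule cyl_append[OF y l(7,5)])
    ultimately show ?thesis using qm by blast
  qed
  define L where "L = {q \<in> ?C. \<exists>x\<in>cy q. \<forall>a\<in>A. x < a}"
  define R where "R = {q \<in> ?C. \<exists>x\<in>cy q. \<forall>a\<in>A. a < x}"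
  have fin: "finite ?C" unfolding cut_words_def using finite_P by auto
  have uniq: "q = r" if "q \<in> ?C" "r \<in> ?C" "x \<in> cy q" "x \<in> cy r" for q r x
    using that C[of q] C[of r] by (intro cyl_unique[of x]) (auto simp: words_def)
  have between: "x \<in> cy q" if "q \<in> ?C" "a \<in> cy q" "b \<in> cy q" "a \<le> x" "x \<le> b" for q a b x
    using interval_cyl[of q] C[OF that(1)] that unfolding is_interval_1 words_def by blast
  have L1: "q = r" if q: "q \<in> ?C" "x \<in> cy q" "\<forall>a\<in>A. x < a" and r: "r \<in> ?C" "y \<in> cy r" "\<forall>a\<in>A. y < a"
    and xy: "x \<le> y" for q r x y
  proof -
    obtain a where "a \<in> cy q" "a \<in> A" using C[OF q(1)] by blast
    then have "y \<in> cy q" using r(3) by (intro between[OF q(1,2) _ xy]) (auto intro: less_imp_le)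
    then show ?thesis by (rule uniq[OF q(1) r(1) _ r(2)])
  qed
  have R1: "q = r" if q: "q \<in> ?C" "x \<in> cy q" "\<forall>a\<in>A. a < x" and r: "r \<in> ?C" "y \<in> cy r" "\<forall>a\<in>A. a < y"
    and xy: "x \<le> y" for q r x y
  proof -
    obtain a where "a \<in> cy r" "a \<in> A" using C[OF r(1)] by blast
    then have "x \<in> cy r" using q(3) by (intro between[OF r(1) _ r(2) _ xy]) (auto intro: less_imp_le)
    then show ?thesis by (rule uniq[OF q(1) r(1) q(2)])
  qed
  have finL: "finite L" and finR: "finite R" using fin by (auto simp: L_def R_def)
  have "card L \<le> Suc 0"
    unfolding card_le_Suc0_iff_eq[OF finL]
  proof (intro ballI)
    fix q r assume "q \<in> L" "r \<in> L"
    then obtain x y where "q \<in> ?C" "x \<in> cy q" "\<forall>a\<in>A. x < a" "r \<in> ?C" "y \<in> cy r" "\<forall>a\<in>A. y < a"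
      unfolding L_def by blast
    then show "q = r" using L1[of q x r y] L1[of r y q x] linear[of x y] by metis
  qed
  moreover have "card R \<le> Suc 0"
    unfolding card_le_Suc0_iff_eq[OF finR]
  proof (intro ballI)
    fix q r assume "q \<in> R" "r \<in> R"
    then obtain x y where "q \<in> ?C" "x \<in> cy q" "\<forall>a\<in>A. a < x" "r \<in> ?C" "y \<in> cy r" "\<forall>a\<in>A. a < y"
      unfolding R_def by blast
    then show "q = r" using R1[of q x r y] R1[of r y q x] linear[of x y] by metis
  qed
  moreover have "?C \<subseteq> L \<union> R"
  proof
    fix q assume q: "q \<in> ?C"
    then obtain x where x: "x \<in> cy q" "x \<notin> A" using C by blast
    have "(\<forall>a\<in>A. x < a) \<or> (\<forall>a\<in>A. a < x)"
    proof (rule ccontr)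
      assume "\<not> ?thesis"
      then obtain a b where "a \<in> A" "a \<le> x" "b \<in> A" "x \<le> b" by (auto simp: not_less)
      then show False using A(1) x(2) unfolding is_interval_1 by blast
    qed
    then show "q \<in> L \<union> R" using q x by (auto simp: L_def R_def)
  qed
  then have "card ?C \<le> card (L \<union> R)" using finL finR by (intro card_mono) auto
  moreover have "card (L \<union> R) \<le> card L + card R" by (rule card_Un_le)
  ultimately show ?thesis by simp
qed

end

section \<open>Late hitting times\<close>

lemma hitting_time_le:
  assumes n: "1 \<le> n" and many: "n \<le> card {j\<in>{1..T}. (f ^^ j) x \<in> A}"
  shows "hitting_time f A n x \<le> enat T"
proof -
  define N where "N k = card {j\<in>{1..k}. (f ^^ j) x \<in> A}" for k
  have N_Suc: "N (Suc k) = N k + of_bool ((f ^^ Suc k) x \<in> A)" for k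
  proof -
    have "{j\<in>{1..Suc k}. (f ^^ j) x \<in> A}
        = {j\<in>{1..k}. (f ^^ j) x \<in> A} \<union> {j\<in>{Suc k}. (f ^^ j) x \<in> A}"
      by (auto simp: le_Suc_eq)
    also have "card \<dots> = N k + card {j\<in>{Suc k}. (f ^^ j) x \<in> A}"
      unfolding N_def by (intro card_Un_disjoint) auto
    also have "{j\<in>{Suc k}. (f ^^ j) x \<in> A} = (if (f ^^ Suc k) x \<in> A then {Suc k} else {})" by auto
    finally show ?thesis unfolding N_def by (simp split: if_splits)
  qed
  define k where "k = (LEAST k. n \<le> N k)"
  have "n \<le> N T" using many by (simp add: N_def)
  then have k: "n \<le> N k" "k \<le> T" unfolding k_def by (rule LeastI, rule Least_le)
  have "N 0 = 0" by (simp add: N_def)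
  then have "k \<noteq> 0" using k n by (metis not_one_le_zero le_zero_eq)
  then obtain i where i: "k = Suc i" by (cases k) auto
  have "\<not> n \<le> N i" using not_less_Least[of i "\<lambda>k. n \<le> N k"] i unfolding k_def[symmetric] by simp
  then have "N k = n" "(f ^^ k) x \<in> A" using k(1) N_Suc[of i] unfolding i by (cases "(f ^^ Suc i) x \<in> A"; simp)+
  then have "enat k \<in> enat ` {k. k \<ge> 1 \<and> (f ^^ k) x \<in> A \<and> card {j\<in>{1..k}. (f ^^ j) x \<in> A} = n}"
    using i by (auto simp: N_def)
  then have "hitting_time f A n x \<le> enat k" unfolding hitting_time_def by (rule Inf_lower)
  also have "\<dots> \<le> enat T" using k by simp
  finally show ?thesis .
qed

lemma few_hits_if_late:
  assumes "1 \<le> n" "ereal r \<le> ereal_of_enat (hitting_time f A n x)" "real T < r"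
  shows "card {j\<in>{1..T}. (f ^^ j) x \<in> A} < n"
proof (rule ccontr)
  assume "\<not> ?thesis"
  then have "hitting_time f A n x \<le> enat T" using assms(1) by (intro hitting_time_le) auto
  then have "ereal_of_enat (hitting_time f A n x) \<le> ereal_of_enat (enat T)"
    by (simp only: ereal_of_enat_le_iff)
  from order_trans[OF assms(2) this] have "r \<le> real T" by simp
  then show False using assms(3) by simp
qed

locale gibbs_interval_map = full_branched I \<P> f + prob_space \<mu>
  for I :: "real set" and \<P> and f and \<mu> :: "real measure" +
  fixes \<phi> :: "real \<Rightarrow> real"
  assumes sets_mu: "sets \<mu> = sets (restrict_space borel I)"
    and invariant: "invariant_measure f \<mu>"
    and gibbs: "gibbs_measure I \<P> f \<phi> \<mu>"
    and holder: "\<And>p. p \<in> \<P> \<Longrightarrow> holder_on p \<phi>"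
    and two_branches: "2 \<le> card \<P>"
begin

lemma space_mu: "space \<mu> = I"
  using sets_eq_imp_space_eq[OF sets_mu] by (simp add: space_restrict_space)

lemma measurable_f: "f \<in> measurable \<mu> \<mu>"
  using invariant by (simp add: invariant_measure_def)

lemma measure_preimage: "B \<in> sets \<mu> \<Longrightarrow> measure \<mu> (f -` B \<inter> I) = measure \<mu> B"
  using measure_distr[OF measurable_f, of B] invariant by (simp add: invariant_measure_def space_mu)

lemma sets_cyl: "w \<in> lists \<P> \<Longrightarrow> cy w \<in> sets \<mu>"
proof (induction w rule: list.induct)
  case Nil
  then show ?case using sets.top[of \<mu>] by (simp add: space_mu)
next
  case (Cons p w)
  then have p: "p \<in> \<P>" and w: "cy w \<in> sets \<mu>" by auto
  have "p \<in> sets borel" using interval_P[OF p] by (rule real_interval_borel_measurable)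
  then have "p \<in> sets \<mu>"
    unfolding sets_mu using P_subset[OF p] by (auto simp: sets_restrict_space image_iff intro!: bexI[of _ p])
  moreover have "f -` cy w \<inter> space \<mu> \<in> sets \<mu>" by (rule measurable_sets[OF measurable_f w])
  moreover have "cy (p # w) = p \<inter> (f -` cy w \<inter> space \<mu>)" using P_subset[OF p] by (auto simp: space_mu)
  ultimately show ?case by auto
qed

abbreviation m where "m w \<equiv> measure \<mu> (cy w)"

lemma measure_Union_cyl:
  assumes "S \<subseteq> words \<P> n"
  shows "measure \<mu> (\<Union>w\<in>S. cy w) = (\<Sum>w\<in>S. m w)"
proof (rule finite_measure_finite_Union)
  show "finite S" using assms finite_P by (blast intro: finite_subset finite_words)
  show "cy ` S \<subseteq> sets \<mu>" using assms sets_cyl wordsD(1) by blast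
  show "disjoint_family_on cy S"
    unfolding disjoint_family_on_def
  proof (intro ballI impI)
    fix v w assume vw: "v \<in> S" "w \<in> S" "v \<noteq> w"
    then have "v \<in> words \<P> n" "w \<in> words \<P> n" using assms by auto
    then have "v = w" if "x \<in> cy v" "x \<in> cy w" for x using that by (intro cyl_unique[of x]) (auto simp: words_def)
    then show "cy v \<inter> cy w = {}" using vw(3) by blast
  qed
qed

lemma cyl_split: "w \<in> lists \<P> \<Longrightarrow> cy w = (\<Union>p\<in>\<P>. cy (w @ [p]))"
proof (intro equalityI subsetI)
  fix x assume w: "w \<in> lists \<P>" and x: "x \<in> cy w"
  then have "x \<in> I" using cyl_subset by blast
  then obtain v where v: "v \<in> words \<P> (Suc (length w))" "x \<in> cy v" using cyl_exists by blast
  then obtain u p where u: "v = u @ [p]" by (cases v rule: rev_cases) (auto simp: words_def)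
  then have up: "u \<in> lists \<P>" "p \<in> \<P>" "length u = length w" using v by (auto simp: words_def)
  have "x \<in> cy u" using v u up by (intro cyl_append[of x u "[p]"]) auto
  then have "u = w" using x up w by (intro cyl_unique[of x]) auto
  then show "x \<in> (\<Union>p\<in>\<P>. cy (w @ [p]))" using v u up by auto
next
  fix x assume "w \<in> lists \<P>" "x \<in> (\<Union>p\<in>\<P>. cy (w @ [p]))"
  then show "x \<in> cy w" using cyl_append[of x w] by auto
qed

lemma gibbs_bounds:
  obtains C where "0 < C"
    "\<And>w x. w \<in> lists \<P> \<Longrightarrow> w \<noteq> [] \<Longrightarrow> x \<in> cy w \<Longrightarrow> m w \<le> C * exp (birkhoff_sum f \<phi> (length w) x)"
    "\<And>w x. w \<in> lists \<P> \<Longrightarrow> w \<noteq> [] \<Longrightarrow> x \<in> cy w \<Longrightarrow> exp (birkhoff_sum f \<phi> (length w) x) \<le> C * m w"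
proof -
  obtain C where C: "0 < C" and g: "\<forall>n\<ge>1. \<forall>Q\<in>cylinders I \<P> f n. \<forall>x\<in>Q.
        1 / C \<le> measure \<mu> Q / exp (birkhoff_sum f \<phi> n x) \<and>
        measure \<mu> Q / exp (birkhoff_sum f \<phi> n x) \<le> C"
    using gibbs unfolding gibbs_measure_def by blast
  have *: "1 / C \<le> m w / exp (birkhoff_sum f \<phi> (length w) x) \<and>
        m w / exp (birkhoff_sum f \<phi> (length w) x) \<le> C"
    if w: "w \<in> lists \<P>" "w \<noteq> []" "x \<in> cy w" for w x
  proof -
    have "1 \<le> length w" using w by (simp add: Suc_le_eq)
    moreover have "cy w \<in> cylinders I \<P> f (length w)"
      unfolding cylinders_eq using w by (auto simp: words_def)
    ultimately show ?thesis using g w(3) by blast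
  qed
  have "m w \<le> C * exp (birkhoff_sum f \<phi> (length w) x)"
    if "w \<in> lists \<P>" "w \<noteq> []" "x \<in> cy w" for w x
    using *[OF that] by (simp add: field_simps)
  moreover have "exp (birkhoff_sum f \<phi> (length w) x) \<le> C * m w"
    if "w \<in> lists \<P>" "w \<noteq> []" "x \<in> cy w" for w x
    using *[OF that] C by (simp add: field_simps)
  ultimately show ?thesis using that[of C] C by blast
qed

lemma word_measure_m: "word_measure \<P> m"
proof
  show "finite \<P>" by (rule finite_P)
  show "m [] = 1" using prob_space by (simp add: space_mu)
  show "0 < m w" if w: "w \<in> lists \<P>" for w
  proof (cases "w = []")
    case True
    then show ?thesis using prob_space by (simp add: space_mu)
  next
    case False
    obtain C where C: "0 < C"
      "\<And>w x. w \<in> lists \<P> \<Longrightarrow> w \<noteq> [] \<Longrightarrow> x \<in> cy w \<Longrightarrow> exp (birkhoff_sum f \<phi> (length w) x) \<le> C * m w"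
      by (rule gibbs_bounds, rule that)
    obtain x where "x \<in> cy w" using cyl_nonempty[OF w] by blast
    then have "0 < C * m w" using C(2)[OF w False] by (meson exp_gt_zero less_le_trans)
    then show ?thesis using C(1) by (simp add: zero_less_mult_iff)
  qed
  show "additive_on_words \<P> m"
    unfolding additive_on_words_def
  proof
    fix w assume w: "w \<in> lists \<P>"
    have "m w = measure \<mu> (\<Union>v\<in>(\<lambda>p. w @ [p]) ` \<P>. cy v)" using cyl_split[OF w] by simp
    also have "\<dots> = (\<Sum>v\<in>(\<lambda>p. w @ [p]) ` \<P>. m v)"
      using w by (intro measure_Union_cyl[of _ "Suc (length w)"]) (auto simp: words_def)
    also have "\<dots> = (\<Sum>p\<in>\<P>. m (w @ [p]))" by (subst sum.reindex) (auto simp: inj_on_def)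
    finally show "m w = (\<Sum>p\<in>\<P>. m (w @ [p]))" .
  qed
  show "(\<Sum>p\<in>\<P>. m (p # w)) = m w" if w: "w \<in> lists \<P>" for w
  proof -
    have "(\<Sum>p\<in>\<P>. m (p # w)) = (\<Sum>v\<in>(\<lambda>p. p # w) ` \<P>. m v)" by (subst sum.reindex) (auto simp: inj_on_def)
    also have "\<dots> = measure \<mu> (\<Union>v\<in>(\<lambda>p. p # w) ` \<P>. cy v)"
      using w by (intro measure_Union_cyl[of _ "Suc (length w)", symmetric]) (auto simp: words_def)
    also have "(\<Union>v\<in>(\<lambda>p. p # w) ` \<P>. cy v) = f -` cy w \<inter> I"
      using P_cover P_subset by fastforce
    also have "measure \<mu> \<dots> = m w" by (rule measure_preimage[OF sets_cyl[OF w]])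
    finally show ?thesis .
  qed
qed

text \<open>
  An arbitrary point of the cylinder serves as its representative; the choices for different
  words are unrelated, and the Hoelder bound on cylinders absorbs this.
\<close>

definition word_potential :: "real set list \<Rightarrow> real" where
  "word_potential w = \<phi> (SOME x. x \<in> cy w)"

text \<open>
  The Birkhoff sum along the representatives differs from the Birkhoff sum of \<open>\<phi>\<close> at a point of
  the cylinder by a convergent geometric series, so the Gibbs constant changes by a bounded
  factor only.
\<close>

lemma gibbs_word_measure_m:
  "\<exists>H \<theta> C. gibbs_word_measure \<P> m word_potential H \<theta> C"
proof -
  obtain H \<theta> where H: "0 \<le> H" and \<theta>: "0 < \<theta>" "\<theta> < 1"
    and var: "\<And>w x y. w \<in> lists \<P> \<Longrightarrow> w \<noteq> [] \<Longrightarrow> x \<in> cy w \<Longrightarrow> y \<in> cy w \<Longrightarrow> \<bar>\<phi> x - \<phi> y\<bar> \<le> H * \<theta> ^ length w"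
    by (rule holder_on_cylinders[OF two_branches holder], assumption, rule that)
  obtain C where C: "0 < C"
    and lower: "\<And>w x. w \<in> lists \<P> \<Longrightarrow> w \<noteq> [] \<Longrightarrow> x \<in> cy w \<Longrightarrow> m w \<le> C * exp (birkhoff_sum f \<phi> (length w) x)"
    and upper: "\<And>w x. w \<in> lists \<P> \<Longrightarrow> w \<noteq> [] \<Longrightarrow> x \<in> cy w \<Longrightarrow> exp (birkhoff_sum f \<phi> (length w) x) \<le> C * m w"
    by (rule gibbs_bounds, rule that)
  have point: "(SOME x. x \<in> cy w) \<in> cy w" if "w \<in> lists \<P>" for w
    using cyl_nonempty[OF that] by (simp add: some_in_eq)
  have pot: "\<bar>word_potential (w @ u) - \<phi> x\<bar> \<le> H * \<theta> ^ length w"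
    if w: "w \<in> lists \<P>" "w \<noteq> []" "u \<in> lists \<P>" "x \<in> cy w" for w u x
    unfolding word_potential_def
  proof (rule var[OF w(1,2) _ w(4)])
    show "(SOME x. x \<in> cy (w @ u)) \<in> cy w"
      using point[of "w @ u"] w by (intro cyl_append[of _ w u]) auto
  qed
  define c where "c = H / (1 - \<theta>)"
  have c: "0 \<le> c" using H \<theta> by (simp add: c_def)
  have birk: "\<bar>word_birkhoff word_potential w - birkhoff_sum f \<phi> (length w) x\<bar> \<le> c"
    if "w \<in> lists \<P>" "x \<in> cy w" for w x
  proof -
    have "\<bar>word_birkhoff word_potential w - birkhoff_sum f \<phi> (length w) x\<bar> \<le> c * (1 - \<theta> ^ length w)"
      using that
    proof (induction w arbitrary: x rule: list.induct)
      case Nil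
      then show ?case by (simp add: birkhoff_sum_def)
    next
      case (Cons p w)
      then have pw: "p # w \<in> lists \<P>" "w \<in> lists \<P>" "f x \<in> cy w" by auto
      have "\<bar>word_potential ((p # w) @ []) - \<phi> x\<bar> \<le> H * \<theta> ^ length (p # w)"
        using Cons.prems by (intro pot) auto
      also have "\<dots> \<le> H * \<theta> ^ length w" using H \<theta> by (intro mult_left_mono power_decreasing) auto
      also have "\<dots> = c * (\<theta> ^ length w * (1 - \<theta>))" using \<theta> by (simp add: c_def)
      also have "\<theta> ^ length w * (1 - \<theta>) = \<theta> ^ length w - \<theta> ^ length (p # w)" by (simp add: algebra_simps)
      finally have 1: "\<bar>word_potential (p # w) - \<phi> x\<bar> \<le> c * (\<theta> ^ length w - \<theta> ^ length (p # w))" by simp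
      have 2: "birkhoff_sum f \<phi> (length (p # w)) x = \<phi> x + birkhoff_sum f \<phi> (length w) (f x)"
        by (simp add: birkhoff_sum_def sum.lessThan_Suc_shift funpow_swap1 del: sum.lessThan_Suc)
      show ?case using 1 2 Cons.IH[OF pw(2,3)] unfolding right_diff_distrib by simp
    qed
    also have "\<dots> \<le> c * 1" using c \<theta> by (intro mult_left_mono) auto
    finally show ?thesis by simp
  qed
  define C' where "C' = max 1 (C * exp c)"
  have C': "1 \<le> C'" "C * exp c \<le> C'" by (auto simp: C'_def)
  interpret word_measure \<P> m by (rule word_measure_m)
  have up: "exp (word_birkhoff word_potential w) \<le> C' * m w" if w: "w \<in> lists \<P>" for w
  proof (cases "w = []")
    case True
    then show ?thesis using C'(1) M_Nil by simp
  next
    case False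
    obtain x where x: "x \<in> cy w" using cyl_nonempty[OF w] by blast
    have "exp (word_birkhoff word_potential w) \<le> exp (c + birkhoff_sum f \<phi> (length w) x)"
      using birk[OF w x] by simp
    also have "\<dots> \<le> exp c * (C * m w)" unfolding exp_add by (intro mult_left_mono upper[OF w False x]) simp
    also have "\<dots> = C * exp c * m w" by simp
    also have "\<dots> \<le> C' * m w" by (intro mult_right_mono C') simp
    finally show ?thesis .
  qed
  have low: "m w / C' \<le> exp (word_birkhoff word_potential w)" if w: "w \<in> lists \<P>" for w
  proof (cases "w = []")
    case True
    then show ?thesis using C'(1) M_Nil by simp
  next
    case False
    obtain x where x: "x \<in> cy w" using cyl_nonempty[OF w] by blast
    have "m w \<le> C * exp (birkhoff_sum f \<phi> (length w) x)" by (rule lower[OF w False x])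
    also have "\<dots> \<le> C * exp (c + word_birkhoff word_potential w)"
      using birk[OF w x] C by (intro mult_left_mono) auto
    also have "\<dots> = C * exp c * exp (word_birkhoff word_potential w)" by (simp add: exp_add)
    also have "\<dots> \<le> C' * exp (word_birkhoff word_potential w)" by (intro mult_right_mono C') simp
    finally show ?thesis using C'(1) by (simp add: field_simps)
  qed
  have reg: "\<bar>word_potential (w @ u) - word_potential (w @ v)\<bar> \<le> 2 * H * \<theta> ^ length w"
    if w: "w \<in> lists \<P>" "u \<in> lists \<P>" "v \<in> lists \<P>" "w \<noteq> []" for w u v
  proof -
    obtain x where x: "x \<in> cy w" using cyl_nonempty[OF w(1)] by blast
    show ?thesis using pot[OF w(1,4,2) x] pot[OF w(1,4,3) x] by linarith
  qed
  have "gibbs_word_measure \<P> m word_potential (2 * H) \<theta> C'"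
    by (unfold_locales) (use \<theta> H C' reg low up in auto)
  then show ?thesis by blast
qed

text \<open>
  The event depends on \<open>f x\<close> through finitely many letters: hits are counted from time 1 on, and
  invariance of \<open>\<mu>\<close> removes the first iterate.
\<close>

theorem late_hitting_bound:
  obtains c where "0 < c"
    and "\<And>A \<eta> n. markov_interval I \<P> f A \<Longrightarrow> 0 < \<eta> \<Longrightarrow> \<eta> < 1 / measure \<mu> A \<Longrightarrow> 1 \<le> n \<Longrightarrow>
      measure \<mu> {x\<in>I. ereal (real n * (1 / measure \<mu> A + \<eta>)) \<le> ereal_of_enat (hitting_time f A n x)}
        \<le> 3 * exp 1 * exp (- c * \<eta>\<^sup>2 * (measure \<mu> A)\<^sup>2 * real n)"
proof -
  obtain H \<theta> C where "gibbs_word_measure \<P> m word_potential H \<theta> C"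
    using gibbs_word_measure_m by blast
  then interpret gibbs_word_measure \<P> m word_potential H \<theta> C .
  interpret quasi_bernoulli_measure \<P> m "3 * K" \<theta>
    by unfold_locales (use \<theta> K_nonneg quasi_bernoulli in auto)
  obtain c where c: "0 < c"
    and tail: "\<And>A k T n \<epsilon>. A \<subseteq> words \<P> k \<Longrightarrow> (\<And>i. card (cut_words \<P> k A i) \<le> 2) \<Longrightarrow>
      0 < \<epsilon> \<Longrightarrow> \<epsilon> < 1 \<Longrightarrow> real n * (1 + \<epsilon>) - 1 \<le> real T * (\<Sum>a\<in>A. m a) \<Longrightarrow>
      (\<Sum>w | w \<in> words \<P> (T + k) \<and> card {j\<in>{..<T}. hits k A (drop j w)} < n. m w)
        \<le> 3 * exp 1 * exp (- c * \<epsilon>\<^sup>2 * real n)"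
  proof (rule few_hits_tail[OF two_branches], goal_cases)
    case (1 c)
    show ?case by (rule 1(1)[OF 1(2)], rule 1(3))
  qed
  have "measure \<mu> {x\<in>I. ereal (real n * (1 / measure \<mu> A + \<eta>)) \<le> ereal_of_enat (hitting_time f A n x)}
        \<le> 3 * exp 1 * exp (- c * \<eta>\<^sup>2 * (measure \<mu> A)\<^sup>2 * real n)"
    if A: "markov_interval I \<P> f A" and \<eta>: "0 < \<eta>" "\<eta> < 1 / measure \<mu> A" and n: "1 \<le> n" for A \<eta> n
  proof -
    obtain k \<Q> where ne: "A \<noteq> {}" and int: "is_interval A" and Q: "\<Q> \<subseteq> cylinders I \<P> f k" "A = \<Union>\<Q>"
      using A unfolding markov_interval_def by blast
    let ?W = "inside A k"
    have W: "?W \<subseteq> words \<P> k" by (auto simp: inside_def)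
    have A_eq: "A = (\<Union>w\<in>?W. cy w)"
      using Q unfolding cylinders_eq inside_def by blast
    define p where "p = measure \<mu> A"
    have p_sum: "p = (\<Sum>w\<in>?W. m w)"
      unfolding p_def by (subst A_eq) (rule measure_Union_cyl[OF W])
    have "?W \<noteq> {}" using ne A_eq by blast
    then have p0: "0 < p"
      unfolding p_sum
    proof (intro sum_pos)
      show "finite ?W" using finite_subset[OF W] finite_P by simp
      show "0 < m w" if "w \<in> ?W" for w using M_pos wordsD(1)[of w \<P> k] W that by blast
    qed
    define \<epsilon> where "\<epsilon> = \<eta> * p"
    have \<epsilon>: "0 < \<epsilon>" "\<epsilon> < 1" using \<eta> p0 by (auto simp: \<epsilon>_def p_def[symmetric] field_simps)
    define r where "r = real n * (1 / p + \<eta>)"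
    \<comment> \<open>the largest integer strictly below \<open>r\<close>: a hit at time \<open>T\<close> is still too early\<close>
    define T where "T = nat (\<lceil>r\<rceil> - 1)"
    have "0 < r" using n p0 \<eta> by (auto simp: r_def intro!: mult_pos_pos add_pos_pos)
    then have T: "real T < r" "r - 1 \<le> real T" by (auto simp: T_def) linarith+
    have "(r - 1) * p \<le> real T * p" using T(2) p0 by (intro mult_right_mono) auto
    moreover have "r * p = real n * (1 + \<epsilon>)" using p0 by (simp add: r_def \<epsilon>_def field_simps)
    moreover have "p \<le> 1" unfolding p_def by (rule prob_le_1)
    ultimately have Tp: "real n * (1 + \<epsilon>) - 1 \<le> real T * (\<Sum>w\<in>?W. m w)"
      by (simp add: p_sum[symmetric] left_diff_distrib)
    define F where "F = {w. w \<in> words \<P> (T + k) \<and> card {j\<in>{..<T}. hits k ?W (drop j w)} < n}"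
    define B where "B = (\<Union>w\<in>F. cy w)"
    have F: "F \<subseteq> words \<P> (T + k)" by (auto simp: F_def)
    have B: "B \<in> sets \<mu>"
      unfolding B_def
    proof (intro sets.finite_UN)
      show "finite F" using finite_subset[OF F] finite_P by simp
      show "cy w \<in> sets \<mu>" if "w \<in> F" for w using sets_cyl wordsD(1)[of w \<P>] F that by blast
    qed
    have "{x\<in>I. ereal r \<le> ereal_of_enat (hitting_time f A n x)} \<subseteq> f -` B \<inter> I"
    proof
      fix x assume "x \<in> {x\<in>I. ereal r \<le> ereal_of_enat (hitting_time f A n x)}"
      then have x: "x \<in> I" "ereal r \<le> ereal_of_enat (hitting_time f A n x)" by auto
      obtain w where w: "w \<in> words \<P> (T + k)" "f x \<in> cy w" using cyl_exists[OF f_maps[OF x(1)]] by blast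
      have wl: "w \<in> lists \<P>" "length w = T + k" using w by (auto simp: words_def)
      have hit: "(f ^^ Suc j) x \<in> A \<longleftrightarrow> hits k ?W (drop j w)" if "j < T" for j
      proof -
        have "(f ^^ j) (f x) \<in> cy (drop j w)" using w wl that by (intro cyl_drop) auto
        moreover have "drop j w \<in> lists \<P>" using wl by (auto simp: in_lists_conv_set dest: in_set_dropD)
        ultimately show ?thesis
          using markov_hits_iff[OF Q, of "drop j w" "(f ^^ j) (f x)"] wl that by (simp add: funpow_swap1)
      qed
      have "{j\<in>{1..T}. (f ^^ j) x \<in> A} = Suc ` {j\<in>{..<T}. hits k ?W (drop j w)}"
      proof (intro equalityI subsetI)
        fix j assume j: "j \<in> {j\<in>{1..T}. (f ^^ j) x \<in> A}"
        then obtain i where "j = Suc i" "i < T" by (cases j) auto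
        then show "j \<in> Suc ` {j\<in>{..<T}. hits k ?W (drop j w)}" using j hit by auto
      next
        fix j assume "j \<in> Suc ` {j\<in>{..<T}. hits k ?W (drop j w)}"
        then obtain i where "j = Suc i" "i < T" "hits k ?W (drop i w)" by auto
        then show "j \<in> {j\<in>{1..T}. (f ^^ j) x \<in> A}" using hit[of i] by auto
      qed
      then have "card {j\<in>{..<T}. hits k ?W (drop j w)} = card {j\<in>{1..T}. (f ^^ j) x \<in> A}"
        by (simp add: card_image)
      also have "\<dots> < n" by (rule few_hits_if_late[OF n x(2) T(1)])
      finally show "x \<in> f -` B \<inter> I" using x w by (auto simp: B_def F_def)
    qed
    then have "measure \<mu> {x\<in>I. ereal r \<le> ereal_of_enat (hitting_time f A n x)} \<le> measure \<mu> (f -` B \<inter> I)"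
      using measurable_sets[OF measurable_f B] by (intro finite_measure_mono) (auto simp: space_mu)
    also have "\<dots> = (\<Sum>w\<in>F. m w)" unfolding measure_preimage[OF B] unfolding B_def by (rule measure_Union_cyl[OF F])
    also have "\<dots> \<le> 3 * exp 1 * exp (- c * \<epsilon>\<^sup>2 * real n)"
      unfolding F_def by (rule tail[OF W card_cut_words[OF int Q] \<epsilon> Tp])
    also have "\<dots> = 3 * exp 1 * exp (- c * \<eta>\<^sup>2 * p\<^sup>2 * real n)"
      by (simp add: \<epsilon>_def power_mult_distrib)
    finally show ?thesis by (simp only: r_def p_def)
  qed
  then show ?thesis using that[of c] c by blast
qed

end

theorem proposition2p4:
  fixes I :: "real set" and \<P> :: "real set set" and f \<phi> :: "real \<Rightarrow> real"
    and \<mu> :: "real measure"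
  assumes "full_branched_map I \<P> f"
    and "bounded_distortion I \<P> f"
    and "\<And>P. P \<in> \<P> \<Longrightarrow> holder_on P \<phi>"
    and "has_pressure I f \<phi> 0"
    and "prob_space \<mu>" and "sets \<mu> = sets (restrict_space borel I)"
    and "invariant_measure f \<mu>"
    and "gibbs_measure I \<P> f \<phi> \<mu>"
    and "fully_supported_on I \<mu>"
  shows "\<exists>c\<^sub>1 c\<^sub>2 c\<^sub>3 :: real. c\<^sub>1 > 0 \<and> c\<^sub>2 > 0 \<and> c\<^sub>3 > 0 \<and>
    (\<exists>r\<^sub>0>0. \<forall>A. markov_interval I \<P> f A \<and> bounded A \<and> diameter A < r\<^sub>0 \<longrightarrow>
      (\<forall>\<eta>::real. 0 < \<eta> \<and> \<eta> < c\<^sub>1 / measure \<mu> A \<longrightarrow>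
        (\<forall>n\<ge>1.
          measure \<mu> {x\<in>I. ereal_of_enat (hitting_time f A n x)
                             \<ge> ereal (real n * (1 / measure \<mu> A + \<eta>))}
            \<le> c\<^sub>3 * exp (- c\<^sub>2 * \<eta>\<^sup>2 * (measure \<mu> A)\<^sup>2 * real n))))"
proof -
  interpret full_branched I \<P> f by (rule full_branched.intro) (rule assms)
  interpret prob_space \<mu> by (rule assms)
  show ?thesis
  proof (cases "2 \<le> card \<P>")
    case True
    interpret gibbs_interval_map I \<P> f \<mu> \<phi>
      by unfold_locales (use assms True in auto)
    obtain c where c: "0 < c"
      and bound: "\<And>A \<eta> n. markov_interval I \<P> f A \<Longrightarrow> 0 < \<eta> \<Longrightarrow> \<eta> < 1 / measure \<mu> A \<Longrightarrow> 1 \<le> n \<Longrightarrow>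
        measure \<mu> {x\<in>I. ereal (real n * (1 / measure \<mu> A + \<eta>)) \<le> ereal_of_enat (hitting_time f A n x)}
          \<le> 3 * exp 1 * exp (- c * \<eta>\<^sup>2 * (measure \<mu> A)\<^sup>2 * real n)"
      by (rule late_hitting_bound, rule that)
    show ?thesis
      by (rule exI[of _ 1], rule exI[of _ c], rule exI[of _ "3 * exp 1"], intro conjI exI[of _ 1] allI impI)
         (use c bound in auto)
  next
    case False
    \<comment> \<open>with a single branch every cylinder is \<open>I\<close>, and the \<open>n\<close>th hitting time of \<open>I\<close> is \<open>n\<close>\<close>
    have whole: "A = I" if markov: "markov_interval I \<P> f A" for A
    proof -
      obtain k \<Q> where ne: "A \<noteq> {}" and Q: "\<Q> \<subseteq> cylinders I \<P> f k" "A = \<Union>\<Q>"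
        using markov unfolding markov_interval_def by blast
      then obtain w where w: "w \<in> words \<P> k" "cy w \<subseteq> A" unfolding cylinders_eq by blast
      have "A \<subseteq> I" using Q cyl_subset wordsD(1) unfolding cylinders_eq by blast
      moreover have "I \<subseteq> A"
      proof
        fix x assume "x \<in> I"
        then obtain v where v: "v \<in> words \<P> k" "x \<in> cy v" using cyl_exists by blast
        have "card \<P> \<le> Suc 0" using False by simp
        then have eq: "p = q" if "p \<in> \<P>" "q \<in> \<P>" for p q
          using that finite_P unfolding card_le_Suc0_iff_eq[OF finite_P] by blast
        have "v = w"
          using v(1) w(1) by (intro nth_equalityI) (auto simp: words_def in_lists_conv_set intro!: eq)
        then show "x \<in> A" using v w by blast
      qed
      ultimately show ?thesis by blast
    qed
    have "space \<mu> = I" using sets_eq_imp_space_eq[OF assms(6)] by (simp add: space_restrict_space)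
    then have one: "measure \<mu> I = 1" using prob_space by simp
    have empty: "{x\<in>I. ereal_of_enat (hitting_time f I n x) \<ge> ereal (real n * (1 / measure \<mu> I + \<eta>))} = {}"
      if "0 < \<eta>" "1 \<le> n" for \<eta> n
    proof -
      have "\<not> ereal (real n * (1 / measure \<mu> I + \<eta>)) \<le> ereal_of_enat (hitting_time f I n x)" if x: "x \<in> I" for x
      proof
        assume late: "ereal (real n * (1 / measure \<mu> I + \<eta>)) \<le> ereal_of_enat (hitting_time f I n x)"
        have "(f ^^ j) x \<in> I" for j using x f_maps by (induction j) auto
        then have "{j\<in>{1..n}. (f ^^ j) x \<in> I} = {1..n}" by blast
        then have "card {j\<in>{1..n}. (f ^^ j) x \<in> I} = n" by simp
        moreover have "real n < real n * (1 / measure \<mu> I + \<eta>)" using \<open>0 < \<eta>\<close> \<open>1 \<le> n\<close> by (simp add: one)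
        ultimately show False using few_hits_if_late[OF \<open>1 \<le> n\<close> late, of n] by simp
      qed
      then show ?thesis by blast
    qed
    show ?thesis
      by (intro exI[of _ "1::real"] conjI allI impI) (auto dest!: whole simp: empty)
  qed
qed

end
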